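(* Let $(X_i,* )$, $1\le i\le m$, be CW-power couples and let $c$ be a power sequence of length $m$. For any simplicial complex $K$ on $[m]$, the composite $$e(K,c)\colon\Sigma(\underline{X},\underline{*})^{K,c}\xrightarrow{\ s\ }\bigvee_{\tau\in K}\Sigma(\underline{X},\underline{*})^{K,c}\xrightarrow{\bigvee_{\tau}\Sigma p_{K,c}^{\tau,c}}\bigvee_{\tau\in K}\Sigma(\underline{X},\underline{*})^{\tau,c}\xrightarrow{\bigvee_{\tau}\Sigma q_{\tau,c}}\bigvee_{\tau\in K}\Sigma\underline{X}^{\wedge\tau},$$ where $s$ is an iterated comultiplication, is a homotopy equivalence.
   Context: Conventions. Spaces are compactly generated, products are taken in that category, and maps are pointed. $\mathbb{N}=\{1,2,\dots\}$, $[m]=\{1,\dots,m\}$, $\Delta^{m-1}$ is the simplicial complex of all subsets of $[m]$ including $\emptyset$; a simplicial complex on $[m]$ contains $\emptyset$ and may have ghost vertices. Power couples. A pair $(X,A)$ is a pointed space $X$ with a subspace $A$ containing the basepoint. A power couple is a pair with maps of pairs $\rho_a\colon(X,A)\to(X,A)$, $a\in\mathbb{N}$, such that $\rho_1=\mathrm{id}$ and $\rho_a\circ\rho_b=\rho_{ab}$; it is a CW-power couple if $(X,A)$ is a pointed relative CW-complex. Polyhedral products. For a sequence $(\underline{X},\underline{A})=\{(X_i,A_i)\}$ of power couples, $(\underline{X},\underline{A})^\sigma=\{(x_i)\in\prod_i X_i\mid x_i\in A_i\text{ if }i\notin\sigma\}$ and $(\underline{X},\underline{A})^K=\bigcup_{\sigma\in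 K}(\underline{X},\underline{A})^\sigma$. Here all $A_i=*$, so $(\underline{X},\underline{*})^\sigma=\prod_{i\in\sigma}X_i$. Power sequences. A power sequence is a map $c\colon\Delta^{m-1}\to\mathbb{N}^m$, $\sigma\mapsto(c_1^\sigma,\dots,c_m^\sigma)$, with $c_i^\sigma=1$ for $i\notin\sigma$ and $c_i^\tau\mid c_i^\sigma$ whenever $\tau\subseteq\sigma$. For $\tau\subseteq\sigma$, $\underline{c}^{\sigma/\tau}$ is the self-map of any $(\underline{X},\underline{A})^K$ obtained by restricting $\prod_i\rho_{c_i^\sigma/c_i^\tau}$. Weighted polyhedral products. Spaces $(\underline{X},\underline{A})^{\sigma,c}$ and maps $\eta(\sigma)\colon(\underline{X},\underline{A})^\sigma\to(\underline{X},\underline{A})^{\sigma,c}$ are defined by induction on $|\sigma|$, forming a functor on the face poset with structure maps $\imath_{\tau,c}^{\sigma,c}$, $\tau\subseteq\sigma$. First, $(\underline{X},\underline{A})^{\emptyset,c}=\prod_i A_i$, $\eta(\emptyset)=\mathrm{id}$. For $|\sigma|\ge1$, $(\underline{X},\underline{A})^{\partial\sigma,c}=\mathrm{colim}_{\tau\subsetneq\sigma}(\underline{X},\underline{A})^{\tau,c}$, the map $\eta(\partial\sigma)\colon(\underline{X},\underline{A})^{\partial\sigma}\to(\underline{X},\underline{A})^{\partial\sigma,c}$ is induced by the composites $(\underline{X},\underline{A})^\tau\xrightarrow{\underline{c}^{\sigma/\tau}}(\underline{X},\underline{A})^\tau\xrightarrow{\eta(\tau)}(\underline{X},\underline{A})^{\tau,c}\to(\underline{X},\underline{A})^{\partial\sigma,c}$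 over $\tau\subsetneq\sigma$, and $(\underline{X},\underline{A})^{\sigma,c}$ is the pushout of the inclusion $(\underline{X},\underline{A})^{\partial\sigma}\to(\underline{X},\underline{A})^\sigma$ and $\eta(\partial\sigma)$, with $\eta(\sigma)$ the map from $(\underline{X},\underline{A})^\sigma$ and $\imath_{\partial\sigma,c}^{\sigma,c}$ the map from $(\underline{X},\underline{A})^{\partial\sigma,c}$. Finally $(\underline{X},\underline{A})^{K,c}=\mathrm{colim}_{\sigma\in K}(\underline{X},\underline{A})^{\sigma,c}$. Projections. For $\delta\in\Delta^{m-1}$ and a fixed $\tau\in K$ let $p_{\delta,c}^{\delta\cap\tau,c}\colon(\underline{X},\underline{*})^{\delta,c}\to(\underline{X},\underline{*})^{\delta\cap\tau,c}$ be the (well-defined) maps determined by induction on $|\delta|$ by the two conditions $p_{\delta,c}^{\delta\cap\tau,c}\circ\eta(\delta)=\eta(\delta\cap\tau)\circ\underline{c}^{\delta/(\delta\cap\tau)}\circ\mathrm{proj}$, where $\mathrm{proj}\colon\prod_{i\in\delta}X_i\to\prod_{i\in\delta\cap\tau}X_i$ is the projection, and $p_{\delta,c}^{\delta\cap\tau,c}\circ\imath_{\mu,c}^{\delta,c}=\imath_{\mu\cap\tau,c}^{\delta\cap\tau,c}\circ p_{\mu,c}^{\mu\cap\tau,c}$ for $\mu\subsetneq\delta$. The map $p_{K,c}^{\tau,c}\colon(\underline{X},\underline{*})^{K,c}\to(\underline{X},\underline{*})^{\tau,c}$ is induced on the colimit by the composites $\imath_{\delta\cap\tau,c}^{\tau,c}\circ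 p_{\delta,c}^{\delta\cap\tau,c}$, $\delta\in K$. Quotient maps. $\underline{X}^{\wedge\tau}=\bigwedge_{i\in\tau}X_i$ for $\tau\ne\emptyset$ and $\underline{X}^{\wedge\emptyset}=*$. $q_\tau\colon(\underline{X},\underline{*})^\tau\to\underline{X}^{\wedge\tau}$ is the quotient by the fat wedge $(\underline{X},\underline{*})^{\partial\tau}$. By the defining pushout, $\eta(\tau)$ induces a homeomorphism $\underline{X}^{\wedge\tau}\cong(\underline{X},\underline{*})^{\tau,c}/(\underline{X},\underline{*})^{\partial\tau,c}$, and $q_{\tau,c}\colon(\underline{X},\underline{*})^{\tau,c}\to\underline{X}^{\wedge\tau}$ is the corresponding quotient map, so $q_{\tau,c}\circ\eta(\tau)=q_\tau$. *)

theory Defs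
  imports "HOL-Analysis.Analysis"
begin

section \<open>Quotients, coproducts, colimits and pushouts of topologies\<close>

text \<open>
  The points of a quotient are chosen representatives of the equivalence classes, so that a quotient
  lives on the same type as the space it is a quotient of. Consequently the map induced on a
  quotient by a compatible map \<open>f\<close> is \<open>f\<close> itself, evaluated on representatives.
\<close>

definition cls :: "('p \<times> 'p) set \<Rightarrow> 'p \<Rightarrow> 'p" where
  "cls R p = (SOME q. (p, q) \<in> (R \<union> R\<inverse>)\<^sup>*)"

definition final_topology :: "('p \<Rightarrow> 'q) \<Rightarrow> 'p topology \<Rightarrow> 'q topology" where
  "final_topology f Y =
     topology (\<lambda>U. U \<subseteq> f ` topspace Y \<and> openin Y {y \<in> topspace Y. f y \<in> U})"

text \<open>The quotient by the equivalence relation generated by \<open>R\<close>; the quotient map is \<open>cls R\<close>.\<close>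

definition quot :: "'p topology \<Rightarrow> ('p \<times> 'p) set \<Rightarrow> 'p topology" where
  "quot Y R = final_topology (cls R) Y"

definition coprod :: "'p topology \<Rightarrow> 'q topology \<Rightarrow> ('p + 'q) topology" where
  "coprod Y Z = topology (\<lambda>U. openin Y (Inl -` U) \<and> openin Z (Inr -` U))"

definition pushout_rel :: "'b topology \<Rightarrow> ('b \<Rightarrow> 'p) \<Rightarrow> ('b \<Rightarrow> 'q) \<Rightarrow> (('p + 'q) \<times> ('p + 'q)) set" where
  "pushout_rel B f g = {(Inl (f b), Inr (g b)) | b. b \<in> topspace B}"

definition pushout ::
  "'b topology \<Rightarrow> 'p topology \<Rightarrow> 'q topology \<Rightarrow> ('b \<Rightarrow> 'p) \<Rightarrow> ('b \<Rightarrow> 'q) \<Rightarrow> ('p + 'q) topology" where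
  "pushout B Y Z f g = quot (coprod Y Z) (pushout_rel B f g)"

text \<open>
  Colimit of a diagram indexed by a collection \<open>J\<close> of sets ordered by inclusion, with structure maps
  \<open>i \<tau> \<tau>' : W \<tau> \<rightarrow> W \<tau>'\<close> for \<open>\<tau> \<subseteq> \<tau>'\<close>.
\<close>

definition colim_rel ::
  "'i set set \<Rightarrow> ('i set \<Rightarrow> 'w topology) \<Rightarrow> ('i set \<Rightarrow> 'i set \<Rightarrow> 'w \<Rightarrow> 'w)
    \<Rightarrow> (('i set \<times> 'w) \<times> ('i set \<times> 'w)) set" where
  "colim_rel J W i =
     {((\<tau>, w), (\<tau>', i \<tau> \<tau>' w)) | \<tau> \<tau>' w. \<tau> \<in> J \<and> \<tau>' \<in> J \<and> \<tau> \<subseteq> \<tau>' \<and> w \<in> topspace (W \<tau>)}"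

definition colim ::
  "'i set set \<Rightarrow> ('i set \<Rightarrow> 'w topology) \<Rightarrow> ('i set \<Rightarrow> 'i set \<Rightarrow> 'w \<Rightarrow> 'w)
    \<Rightarrow> ('i set \<times> 'w) topology" where
  "colim J W i = quot (sum_topology W J) (colim_rel J W i)"


section \<open>Products and subspaces of compactly generated spaces\<close>

definition cg_product :: "('i \<Rightarrow> 'p topology) \<Rightarrow> 'i set \<Rightarrow> ('i \<Rightarrow> 'p) topology" where
  "cg_product X I = kification (product_topology X I)"

definition cg_times :: "'p topology \<Rightarrow> 'q topology \<Rightarrow> ('p \<times> 'q) topology" where
  "cg_times Y Z = kification (prod_topology Y Z)"

definition cg_subspace :: "'p topology \<Rightarrow> 'p set \<Rightarrow> 'p topology" where
  "cg_subspace Y S = kification (subtopology Y S)"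


section \<open>Relative CW-complexes and power couples\<close>

definition disc :: "nat \<Rightarrow> (nat \<Rightarrow> real) topology" where
  "disc n = subtopology (Euclidean_space n) {x. (\<Sum>i<n. x i ^ 2) \<le> 1}"

definition disc_boundary :: "nat \<Rightarrow> (nat \<Rightarrow> real) topology" where
  "disc_boundary n = subtopology (Euclidean_space n) {x. (\<Sum>i<n. x i ^ 2) = 1}"

text \<open>
  \<open>Sk 0\<close> is \<open>A\<close> (the \<open>(-1)\<close>-skeleton) and \<open>Sk (Suc n)\<close> is the \<open>n\<close>-skeleton. The set \<open>\<Phi> n\<close> consists of
  the characteristic maps of the \<open>n\<close>-cells, so that it also serves as the index set of the cells.
\<close>

definition relative_CW_complex :: "'a topology \<Rightarrow> 'a set \<Rightarrow> bool" where
  "relative_CW_complex X A \<longleftrightarrow>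
    (\<exists>(Sk :: nat \<Rightarrow> 'a set) (\<Phi> :: nat \<Rightarrow> ((nat \<Rightarrow> real) \<Rightarrow> 'a) set).
       Sk 0 = A \<and> (\<forall>n. Sk n \<subseteq> Sk (Suc n)) \<and> (\<Union>n. Sk n) = topspace X \<and>
       (\<forall>n. \<forall>\<phi> \<in> \<Phi> n. continuous_map (disc_boundary n) (subtopology X (Sk n)) \<phi>) \<and>
       (\<forall>n. homeomorphic_map
              (pushout (sum_topology (\<lambda>_. disc_boundary n) (\<Phi> n))
                       (sum_topology (\<lambda>_. disc n) (\<Phi> n)) (subtopology X (Sk n))
                       (\<lambda>z. z) (\<lambda>(\<phi>, z). \<phi> z))
              (subtopology X (Sk (Suc n)))
              (case_sum (\<lambda>(\<phi>, z). \<phi> z) (\<lambda>x. x))) \<and>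
       (\<forall>U \<subseteq> topspace X.
          openin X U \<longleftrightarrow> (\<forall>n. openin (subtopology X (Sk n)) (U \<inter> Sk n))))"

definition power_couple :: "'a topology \<Rightarrow> 'a set \<Rightarrow> 'a \<Rightarrow> (nat \<Rightarrow> 'a \<Rightarrow> 'a) \<Rightarrow> bool" where
  "power_couple X A x0 rho \<longleftrightarrow>
     k_space X \<and> A \<subseteq> topspace X \<and> x0 \<in> A \<and>
     (\<forall>a\<ge>1. continuous_map X X (rho a) \<and> rho a ` A \<subseteq> A \<and> rho a x0 = x0) \<and>
     (\<forall>x \<in> topspace X. rho 1 x = x) \<and>
     (\<forall>a\<ge>1. \<forall>b\<ge>1. \<forall>x \<in> topspace X. rho a (rho b x) = rho (a * b) x)"

definition CW_power_couple :: "'a topology \<Rightarrow> 'a set \<Rightarrow> 'a \<Rightarrow> (nat \<Rightarrow> 'a \<Rightarrow> 'a) \<Rightarrow> bool" where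
  "CW_power_couple X A x0 rho \<longleftrightarrow> power_couple X A x0 rho \<and> relative_CW_complex X A"


section \<open>Simplicial complexes and power sequences\<close>

definition simplicial_complex_on :: "nat \<Rightarrow> nat set set \<Rightarrow> bool" where
  "simplicial_complex_on m K \<longleftrightarrow>
     {} \<in> K \<and> (\<forall>\<sigma> \<in> K. \<sigma> \<subseteq> {1..m}) \<and> (\<forall>\<sigma> \<in> K. \<forall>\<tau>. \<tau> \<subseteq> \<sigma> \<longrightarrow> \<tau> \<in> K)"

definition power_sequence :: "nat \<Rightarrow> (nat set \<Rightarrow> nat \<Rightarrow> nat) \<Rightarrow> bool" where
  "power_sequence m c \<longleftrightarrow>
     (\<forall>\<sigma> \<subseteq> {1..m}. \<forall>i \<in> {1..m}. c \<sigma> i \<ge> 1 \<and> (i \<notin> \<sigma> \<longrightarrow> c \<sigma> i = 1)) \<and>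
     (\<forall>\<sigma> \<subseteq> {1..m}. \<forall>\<tau> \<subseteq> \<sigma>. \<forall>i \<in> {1..m}. c \<tau> i dvd c \<sigma> i)"


section \<open>Weighted polyhedral products\<close>

text \<open>
  One type for the points of all the spaces \<open>(X,A)\<^bsup>\<sigma>,c\<^esup>\<close>: each is a quotient of the
  coproduct of \<open>(X,A)\<^bsup>\<sigma>\<^esup>\<close> with a colimit of earlier such spaces.
\<close>

datatype 'a wpoint = Wpoint "(nat \<Rightarrow> 'a) + (nat set \<times> 'a wpoint)"

locale polyhedral =
  fixes m :: nat
    and X :: "nat \<Rightarrow> 'a topology"
    and A :: "nat \<Rightarrow> 'a set"
    and rho :: "nat \<Rightarrow> nat \<Rightarrow> 'a \<Rightarrow> 'a"
    and c :: "nat set \<Rightarrow> nat \<Rightarrow> nat"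
begin

definition poly_set :: "nat set \<Rightarrow> (nat \<Rightarrow> 'a) set" where
  "poly_set \<sigma> = {x \<in> topspace (cg_product X {1..m}). \<forall>i \<in> {1..m}. i \<notin> \<sigma> \<longrightarrow> x i \<in> A i}"

definition poly :: "nat set set \<Rightarrow> (nat \<Rightarrow> 'a) topology" where
  "poly K = cg_subspace (cg_product X {1..m}) (\<Union>\<sigma>\<in>K. poly_set \<sigma>)"

definition face_poly :: "nat set \<Rightarrow> (nat \<Rightarrow> 'a) topology" where
  "face_poly \<sigma> = cg_subspace (cg_product X {1..m}) (poly_set \<sigma>)"

definition bd :: "nat set \<Rightarrow> nat set set" where
  "bd \<sigma> = {\<tau>. \<tau> \<subset> \<sigma>}"

text \<open>The self-map \<open>c\<^bsup>\<sigma>/\<tau>\<^esup>\<close>.\<close>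

definition cmap :: "nat set \<Rightarrow> nat set \<Rightarrow> (nat \<Rightarrow> 'a) \<Rightarrow> nat \<Rightarrow> 'a" where
  "cmap \<sigma> \<tau> x = (\<lambda>i \<in> {1..m}. rho i (c \<sigma> i div c \<tau> i) (x i))"

text \<open>
  One step of the recursion defining the triples consisting of the space \<open>(X,A)\<^bsup>\<sigma>,c\<^esup>\<close>, the map
  \<open>\<eta>(\<sigma>)\<close> and the structure maps into \<open>(X,A)\<^bsup>\<sigma>,c\<^esup>\<close> (the first argument of the third component
  is their source \<open>\<tau>\<close>); \<open>F\<close> supplies the triples of the proper faces. In \<open>eta_bd\<close>, which is
  \<open>\<eta>(\<partial>\<sigma>)\<close>, any proper face \<open>\<tau>\<close> with \<open>x \<in> (X,A)\<^bsup>\<tau>\<^esup>\<close> gives the same value.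
\<close>

definition wstep ::
  "nat set \<Rightarrow>
   (nat set \<Rightarrow> 'a wpoint topology \<times> ((nat \<Rightarrow> 'a) \<Rightarrow> 'a wpoint) \<times> (nat set \<Rightarrow> 'a wpoint \<Rightarrow> 'a wpoint)) \<Rightarrow>
   'a wpoint topology \<times> ((nat \<Rightarrow> 'a) \<Rightarrow> 'a wpoint) \<times> (nat set \<Rightarrow> 'a wpoint \<Rightarrow> 'a wpoint)" where
  "wstep \<sigma> F =
    (if \<sigma> = {} then
       (final_topology (Wpoint \<circ> Inl) (face_poly {}), Wpoint \<circ> Inl, \<lambda>_ w. w)
     else
       let WF = (\<lambda>\<tau>. fst (F \<tau>));
           etaF = (\<lambda>\<tau>. fst (snd (F \<tau>)));
           iotaF = (\<lambda>\<tau> \<tau>'. snd (snd (F \<tau>')) \<tau>);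
           C = colim (bd \<sigma>) WF iotaF;
           inC = (\<lambda>\<tau> w. cls (colim_rel (bd \<sigma>) WF iotaF) (\<tau>, w));
           eta_bd = (\<lambda>x. let \<tau> = (SOME \<tau>. \<tau> \<in> bd \<sigma> \<and> x \<in> poly_set \<tau>)
                         in inC \<tau> (etaF \<tau> (cmap \<sigma> \<tau> x)));
           toP = cls (pushout_rel (poly (bd \<sigma>)) (\<lambda>x. x) eta_bd)
       in (final_topology Wpoint (pushout (poly (bd \<sigma>)) (face_poly \<sigma>) C (\<lambda>x. x) eta_bd),
           \<lambda>x. Wpoint (toP (Inl x)),
           \<lambda>\<tau> w. if \<tau> = \<sigma> then w else Wpoint (toP (Inr (inC \<tau> w)))))"

function wdata ::
  "nat set \<Rightarrow>
   'a wpoint topology \<times> ((nat \<Rightarrow> 'a) \<Rightarrow> 'a wpoint) \<times> (nat set \<Rightarrow> 'a wpoint \<Rightarrow> 'a wpoint)" where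
  "wdata \<sigma> = wstep \<sigma> (\<lambda>\<tau>. if finite \<sigma> \<and> \<tau> \<subset> \<sigma> then wdata \<tau> else undefined)"
  by auto
termination
  by (relation "Wellfounded.measure card") (auto intro: psubset_card_mono)

text \<open>The space \<open>(X,A)\<^bsup>\<sigma>,c\<^esup>\<close>, the map \<open>\<eta>(\<sigma>)\<close>, and the structure map from \<open>\<tau>\<close> to \<open>\<sigma>\<close>.\<close>

definition W :: "nat set \<Rightarrow> 'a wpoint topology" where
  "W \<sigma> = fst (wdata \<sigma>)"

definition eta :: "nat set \<Rightarrow> (nat \<Rightarrow> 'a) \<Rightarrow> 'a wpoint" where
  "eta \<sigma> = fst (snd (wdata \<sigma>))"

definition iota :: "nat set \<Rightarrow> nat set \<Rightarrow> 'a wpoint \<Rightarrow> 'a wpoint" where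
  "iota \<tau> \<sigma> = snd (snd (wdata \<sigma>)) \<tau>"

definition WK :: "nat set set \<Rightarrow> (nat set \<times> 'a wpoint) topology" where
  "WK K = colim K W iota"

definition inK :: "nat set set \<Rightarrow> nat set \<Rightarrow> 'a wpoint \<Rightarrow> nat set \<times> 'a wpoint" where
  "inK K \<sigma> w = cls (colim_rel K W iota) (\<sigma>, w)"

text \<open>The image of \<open>(X,A)\<^bsup>\<partial>\<sigma>,c\<^esup>\<close> in \<open>(X,A)\<^bsup>\<sigma>,c\<^esup>\<close>.\<close>

definition W_bd :: "nat set \<Rightarrow> 'a wpoint set" where
  "W_bd \<sigma> = (\<Union>\<tau>\<in>bd \<sigma>. iota \<tau> \<sigma> ` topspace (W \<tau>))"

end


section \<open>Pointed spaces, suspensions, wedges and comultiplications\<close>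

type_synonym 'p pointed = "'p topology \<times> 'p"

definition pointed_map :: "'p pointed \<Rightarrow> 'q pointed \<Rightarrow> ('p \<Rightarrow> 'q) \<Rightarrow> bool" where
  "pointed_map P Q f \<longleftrightarrow> continuous_map (fst P) (fst Q) f \<and> f (snd P) = snd Q"

text \<open>
  The library's homotopies use the ordinary product with \<open>[0,1]\<close>; for a k-space this is the product of
  compactly generated spaces, since \<open>[0,1]\<close> is compact Hausdorff.
\<close>

definition pointed_homotopic :: "'p pointed \<Rightarrow> 'q pointed \<Rightarrow> ('p \<Rightarrow> 'q) \<Rightarrow> ('p \<Rightarrow> 'q) \<Rightarrow> bool" where
  "pointed_homotopic P Q = homotopic_with (\<lambda>h. h (snd P) = snd Q) (fst P) (fst Q)"

definition pointed_homotopy_equivalence :: "'p pointed \<Rightarrow> 'q pointed \<Rightarrow> ('p \<Rightarrow> 'q) \<Rightarrow> bool" where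
  "pointed_homotopy_equivalence P Q f \<longleftrightarrow>
     pointed_map P Q f \<and>
     (\<exists>g. pointed_map Q P g \<and> pointed_homotopic P P (g \<circ> f) id \<and> pointed_homotopic Q Q (f \<circ> g) id)"

text \<open>The quotient by a subspace; collapsing the empty set changes nothing.\<close>

definition collapse_map :: "'p set \<Rightarrow> 'p \<Rightarrow> 'p" where
  "collapse_map S = cls (S \<times> S)"

definition collapse :: "'p topology \<Rightarrow> 'p set \<Rightarrow> 'p topology" where
  "collapse Y S = quot Y (S \<times> S)"

text \<open>Reduced suspension; \<open>susp_in P (y, t)\<close> is the class of \<open>(y, t)\<close>.\<close>

definition susp_base :: "'p pointed \<Rightarrow> ('p \<times> real) set" where
  "susp_base P = {(y, t). y \<in> topspace (fst P) \<and> t \<in> {0..1} \<and> (t = 0 \<or> t = 1 \<or> y = snd P)}"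

definition susp_in :: "'p pointed \<Rightarrow> 'p \<times> real \<Rightarrow> 'p \<times> real" where
  "susp_in P = collapse_map (susp_base P)"

definition susp :: "'p pointed \<Rightarrow> ('p \<times> real) pointed" where
  "susp P = (collapse (cg_times (fst P) (top_of_set {0..1})) (susp_base P), susp_in P (snd P, 0))"

definition susp_map :: "'q pointed \<Rightarrow> ('p \<Rightarrow> 'q) \<Rightarrow> 'p \<times> real \<Rightarrow> 'q \<times> real" where
  "susp_map Q f = (\<lambda>(y, t). susp_in Q (f y, t))"

text \<open>Wedge over a nonempty index set; \<open>wedge_in Z J (j, z)\<close> is the point \<open>z\<close> of the summand \<open>j\<close>.\<close>

definition wedge_base :: "('j \<Rightarrow> 'p pointed) \<Rightarrow> 'j set \<Rightarrow> ('j \<times> 'p) set" where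
  "wedge_base Z J = {(j, snd (Z j)) | j. j \<in> J}"

definition wedge_in :: "('j \<Rightarrow> 'p pointed) \<Rightarrow> 'j set \<Rightarrow> 'j \<times> 'p \<Rightarrow> 'j \<times> 'p" where
  "wedge_in Z J = collapse_map (wedge_base Z J)"

definition wedge :: "('j \<Rightarrow> 'p pointed) \<Rightarrow> 'j set \<Rightarrow> ('j \<times> 'p) pointed" where
  "wedge Z J = (collapse (sum_topology (\<lambda>j. fst (Z j)) J) (wedge_base Z J),
                wedge_in Z J (SOME p. p \<in> wedge_base Z J))"

definition wedge_map ::
  "('j \<Rightarrow> 'q pointed) \<Rightarrow> 'j set \<Rightarrow> ('j \<Rightarrow> 'p \<Rightarrow> 'q) \<Rightarrow> 'j \<times> 'p \<Rightarrow> 'j \<times> 'q" where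
  "wedge_map Z J f = (\<lambda>(j, y). wedge_in Z J (j, f j y))"

text \<open>The comultiplication of a suspension; \<open>False\<close> and \<open>True\<close> index the first and the second summand.\<close>

definition comult :: "'p pointed \<Rightarrow> 'p \<times> real \<Rightarrow> bool \<times> ('p \<times> real)" where
  "comult P = (\<lambda>(y, t).
     if t \<le> 1/2 then wedge_in (\<lambda>_. susp P) UNIV (False, susp_in P (y, 2 * t))
     else wedge_in (\<lambda>_. susp P) UNIV (True, susp_in P (y, 2 * t - 1)))"

text \<open>
  Iterated comultiplications are indexed by bracketings of an ordering of the summands: for
  \<open>Branch l r\<close> one comultiplies once, iterates on the two summands according to \<open>l\<close> and \<open>r\<close>,
  and identifies the wedge of the two resulting wedges with a wedge over all leaves.
\<close>

datatype 'j bracketing = Single 'j | Branch "'j bracketing" "'j bracketing"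

fun leaves :: "'j bracketing \<Rightarrow> 'j list" where
  "leaves (Single j) = [j]"
| "leaves (Branch l r) = leaves l @ leaves r"

fun iterated_comult ::
  "'p pointed \<Rightarrow> 'j set \<Rightarrow> 'j bracketing \<Rightarrow> 'p \<times> real \<Rightarrow> 'j \<times> ('p \<times> real)" where
  "iterated_comult P J (Single j) z = wedge_in (\<lambda>_. susp P) J (j, z)"
| "iterated_comult P J (Branch l r) z =
     (case comult P z of
        (False, z') \<Rightarrow> iterated_comult P J l z'
      | (True, z') \<Rightarrow> iterated_comult P J r z')"


section \<open>The map \<open>e(K,c)\<close> for the pairs \<open>(X,*)\<close>\<close>

locale pointed_polyhedral = polyhedral m X "\<lambda>i. {pt i}" rho c
  for m :: nat and X :: "nat \<Rightarrow> 'a topology" and pt :: "nat \<Rightarrow> 'a"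
    and rho :: "nat \<Rightarrow> nat \<Rightarrow> 'a \<Rightarrow> 'a" and c :: "nat set \<Rightarrow> nat \<Rightarrow> nat"
begin

definition base_point :: "nat \<Rightarrow> 'a" where
  "base_point = (\<lambda>i \<in> {1..m}. pt i)"

definition pW :: "nat set \<Rightarrow> 'a wpoint pointed" where
  "pW \<sigma> = (W \<sigma>, iota {} \<sigma> (eta {} base_point))"

definition pWK :: "nat set set \<Rightarrow> (nat set \<times> 'a wpoint) pointed" where
  "pWK K = (WK K, inK K {} (eta {} base_point))"

text \<open>
  The projection from the product over \<open>\<delta>\<close> to the product over \<open>\<delta> \<inter> \<tau>\<close>, both regarded as
  subspaces of the product over \<open>{1..m}\<close>.
\<close>

definition proj :: "nat set \<Rightarrow> (nat \<Rightarrow> 'a) \<Rightarrow> nat \<Rightarrow> 'a" where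
  "proj \<tau> x = (\<lambda>i \<in> {1..m}. if i \<in> \<tau> then x i else pt i)"

definition projection_family :: "nat set \<Rightarrow> (nat set \<Rightarrow> 'a wpoint \<Rightarrow> 'a wpoint) \<Rightarrow> bool" where
  "projection_family \<tau> p \<longleftrightarrow>
     (\<forall>\<delta> \<subseteq> {1..m}.
        (\<forall>x \<in> poly_set \<delta>. p \<delta> (eta \<delta> x) = eta (\<delta> \<inter> \<tau>) (cmap \<delta> (\<delta> \<inter> \<tau>) (proj \<tau> x))) \<and>
        (\<forall>\<mu>. \<mu> \<subset> \<delta> \<longrightarrow> (\<forall>w \<in> topspace (W \<mu>).
           p \<delta> (iota \<mu> \<delta> w) = iota (\<mu> \<inter> \<tau>) (\<delta> \<inter> \<tau>) (p \<mu> w))))"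

text \<open>On the spaces \<open>W \<delta>\<close> a projection family is unique, because \<open>eta\<close> and the \<open>iota\<close> are jointly onto.\<close>

definition p :: "nat set \<Rightarrow> nat set \<Rightarrow> 'a wpoint \<Rightarrow> 'a wpoint" where
  "p \<tau> = (SOME p. projection_family \<tau> p)"

definition pK :: "nat set \<Rightarrow> nat set \<times> 'a wpoint \<Rightarrow> 'a wpoint" where
  "pK \<tau> = (\<lambda>(\<delta>, w). iota (\<delta> \<inter> \<tau>) \<tau> (p \<tau> \<delta> w))"

definition fat_wedge :: "nat set \<Rightarrow> (nat \<Rightarrow> 'a) set" where
  "fat_wedge \<tau> = topspace (poly (bd \<tau>))"

text \<open>The smash product of the \<open>X i\<close>, \<open>i \<in> \<tau>\<close>; it is a single point for \<open>\<tau> = {}\<close>.\<close>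

definition smash :: "nat set \<Rightarrow> (nat \<Rightarrow> 'a) pointed" where
  "smash \<tau> = (collapse (face_poly \<tau>) (fat_wedge \<tau>), collapse_map (fat_wedge \<tau>) base_point)"

text \<open>
  \<open>eta_bar \<tau>\<close> is the homeomorphism from \<open>smash \<tau>\<close> to the quotient of \<open>W \<tau>\<close> by \<open>W_bd \<tau>\<close>
  induced by \<open>eta \<tau>\<close>, and \<open>qc \<tau>\<close> is the quotient map followed by its inverse.
\<close>

definition eta_bar :: "nat set \<Rightarrow> (nat \<Rightarrow> 'a) \<Rightarrow> 'a wpoint" where
  "eta_bar \<tau> z = collapse_map (W_bd \<tau>) (eta \<tau> z)"

definition qc :: "nat set \<Rightarrow> 'a wpoint \<Rightarrow> nat \<Rightarrow> 'a" where
  "qc \<tau> w = inv_into (topspace (fst (smash \<tau>))) (eta_bar \<tau>) (collapse_map (W_bd \<tau>) w)"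

definition e ::
  "nat set set \<Rightarrow> nat set bracketing
    \<Rightarrow> (nat set \<times> 'a wpoint) \<times> real \<Rightarrow> nat set \<times> ((nat \<Rightarrow> 'a) \<times> real)" where
  "e K T =
     wedge_map (\<lambda>\<tau>. susp (smash \<tau>)) K (\<lambda>\<tau>. susp_map (smash \<tau>) (qc \<tau>)) \<circ>
     wedge_map (\<lambda>\<tau>. susp (pW \<tau>)) K (\<lambda>\<tau>. susp_map (pW \<tau>) (pK \<tau>)) \<circ>
     iterated_comult (pWK K) K T"

end

end

theory Submission
  imports Defs
begin

text \<open>
  Write \<open>Y\<close> for the weighted polyhedral product over \<open>K\<close>, \<open>C\<^sub>\<tau>\<close> for the smash product over \<open>\<tau>\<close>,
  \<open>f\<^sub>\<tau> : Y \<rightarrow> C\<^sub>\<tau>\<close> for the projection to \<open>\<tau>\<close> followed by the quotient map (\<open>face_map\<close>), and \<open>V\<close> for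
  the wedge of the suspensions of the \<open>C\<^sub>\<tau>\<close>. The proof is dual: instead of \<open>e\<close> it studies the maps
  that \<open>e\<close> induces on homotopy classes of maps into a space \<open>Z\<close>. Pointed maps out of the suspension
  of \<open>Y\<close> are pointed maps from \<open>Y\<close> to the loop space \<open>\<Omega>Z\<close>, where they can be multiplied, and the
  adjoint of \<open>e\<close> is the product, in the order and with the bracketing prescribed by \<open>T\<close>, of the
  composites of the \<open>f\<^sub>\<tau>\<close> with the canonical maps \<open>C\<^sub>\<tau> \<rightarrow> \<Omega>V\<close>. Therefore \<open>e\<close> is an equivalence once the
  following is known for every group up to homotopy \<open>G\<close>: forming the bracketed product of the maps
  \<open>a\<^sub>\<tau> \<circ> f\<^sub>\<tau>\<close> is a bijection from families of classes \<open>a\<^sub>\<tau> \<in> [C\<^sub>\<tau>, G]\<close> to \<open>[Y, G]\<close>. Surjectivity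
  (\<open>maps_from_WK_surj\<close>), applied to the unit \<open>Y \<rightarrow> \<Omega>\<Sigma>Y\<close>, yields a left homotopy inverse of \<open>e\<close>;
  injectivity (\<open>maps_from_WK_inj\<close>) for \<open>G = \<Omega>V\<close> shows that it is a right inverse on every summand.

  The bijection is proved by adding facets one at a time. Let \<open>\<sigma>\<close> be a facet of \<open>K\<close> and \<open>L\<close> the
  complex without it. The map \<open>f\<^sub>\<sigma>\<close> is constant on the part of \<open>Y\<close> over \<open>L\<close> and is the quotient map
  that collapses this part, the other \<open>f\<^sub>\<tau>\<close> restrict to those of \<open>L\<close>, and the inclusion over \<open>L\<close> has
  the homotopy extension property. Given \<open>y : Y \<rightarrow> G\<close>, choose by induction \<open>a\<^sub>\<tau>\<close> for \<open>\<tau> \<in> L\<close> that represent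
  \<open>y\<close> over \<open>L\<close>. The factor that has to be inserted at the position of \<open>\<sigma>\<close> in order to obtain \<open>y\<close> is then
  trivial over \<open>L\<close>, so it can be deformed to a map that factors through \<open>f\<^sub>\<sigma>\<close>. For injectivity it
  remains to see that \<open>d \<circ> f\<^sub>\<sigma>\<close> is null homotopic only if \<open>d\<close> is (\<open>face_map_kernel\<close>). Over \<open>L\<close> a null
  homotopy is a family of loops in \<open>G\<close>. By surjectivity for \<open>\<Omega>G\<close> this family extends, up to homotopy,
  to all of \<open>Y\<close>; dividing the null homotopy by the extension makes it trivial over \<open>L\<close>, and
  then it descends to \<open>C\<^sub>\<sigma>\<close>.

  Two facts about weighted polyhedral products are used. Although they are defined by a recursion of
  colimits and pushouts, they are colimits of the ordinary products \<open>X\<^sup>\<sigma>\<close> over the faces, a point \<open>x\<close> of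
  a subproduct \<open>X\<^sup>\<tau>\<close> of \<open>X\<^sup>\<sigma>\<close> being identified with \<open>c\<^bsup>\<sigma>/\<tau>\<^esup> x\<close> in \<open>X\<^sup>\<tau>\<close> (\<open>face_ok\<close>, \<open>weighted_colimit_WK\<close>);
  so a map out of them is a compatible family of maps on products. And a fat wedge has the homotopy
  extension property in the product (\<open>fat_wedge_strom\<close>), because a relative CW-complex carries a
  Strom structure and these can be multiplied.

  Homotopies are treated as maps into the path space with the compact-open topology. Then a homotopy
  on a quotient is a map on the quotient, and descends by the universal property alone.
\<close>

section \<open>Spaces of paths\<close>

abbreviation I01 :: "real topology" where "I01 \<equiv> top_of_set {0..1}"

text \<open>
  Paths are \<open>undefined\<close> outside the unit interval, so that a path is determined by its values in it.
\<close>

definition paths :: "'z topology \<Rightarrow> (real \<Rightarrow> 'z) set" where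
  "paths Z = {f \<in> extensional {0..1}. continuous_map I01 Z f}"

text \<open>
  The compact-open topology.
\<close>

definition path_space :: "'z topology \<Rightarrow> (real \<Rightarrow> 'z) topology" where
  "path_space Z = topology_generated_by
     {{f \<in> paths Z. f ` C \<subseteq> U} | C U. compact C \<and> C \<subseteq> {0..1} \<and> openin Z U}"

lemma topspace_path_space [simp]: "topspace (path_space Z) = paths Z"
proof -
  have "{f \<in> paths Z. f ` {} \<subseteq> topspace Z} \<in>
      {{f \<in> paths Z. f ` C \<subseteq> U} | C U. compact C \<and> C \<subseteq> {0..1} \<and> openin Z U}"
    by (intro CollectI exI[of _ "{}"] exI[of _ "topspace Z"] conjI) auto
  then show ?thesis
    unfolding path_space_def topology_generated_by_topspace by blast
qed

lemma path_in_topspace: "f \<in> paths Z \<Longrightarrow> t \<in> {0..1} \<Longrightarrow> f t \<in> topspace Z"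
  by (auto simp: paths_def continuous_map_def)

lemma paths_ext: "f \<in> paths Z \<Longrightarrow> g \<in> paths Z \<Longrightarrow> (\<And>t. t \<in> {0..1} \<Longrightarrow> f t = g t) \<Longrightarrow> f = g"
  unfolding paths_def by (metis (mono_tags, lifting) extensionalityI mem_Collect_eq)

text \<open>
  The preimage of a subbasic open set is open by the tube lemma, applied to the compact set of times.
\<close>

lemma continuous_map_curry:
  assumes F: "continuous_map (prod_topology I01 Y) Z F"
  shows "continuous_map Y (path_space Z) (\<lambda>y. \<lambda>t\<in>{0..1}. F (t, y))"
  unfolding path_space_def
proof (rule continuous_on_generated_topo)
  have P: "(\<lambda>t\<in>{0..1}. F (t, y)) \<in> paths Z" if "y \<in> topspace Y" for y
  proof -
    have "continuous_map I01 Z (F \<circ> (\<lambda>t. (t, y)))"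
      by (rule continuous_map_compose[OF _ F]) (simp add: continuous_map_paired that)
    then have "continuous_map I01 Z (\<lambda>t\<in>{0..1}. F (t, y))"
      by (rule continuous_map_eq) auto
    then show ?thesis
      by (simp add: paths_def)
  qed
  show "(\<lambda>y. \<lambda>t\<in>{0..1}. F (t, y)) ` topspace Y
      \<subseteq> \<Union> {{f \<in> paths Z. f ` C \<subseteq> U} |C U. compact C \<and> C \<subseteq> {0..1} \<and> openin Z U}"
  proof -
    have "{f \<in> paths Z. f ` {} \<subseteq> topspace Z} \<in>
        {{f \<in> paths Z. f ` C \<subseteq> U} | C U. compact C \<and> C \<subseteq> {0..1} \<and> openin Z U}"
      by (intro CollectI exI[of _ "{}"] exI[of _ "topspace Z"] conjI) auto
    then show ?thesis
      using P by blast
  qed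
  fix S
  assume "S \<in> {{f \<in> paths Z. f ` C \<subseteq> U} |C U. compact C \<and> C \<subseteq> {0..1} \<and> openin Z U}"
  then obtain C U where S: "S = {f \<in> paths Z. f ` C \<subseteq> U}" and C: "compact C" "C \<subseteq> {0..1}"
    and U: "openin Z U"
    by blast
  let ?W = "{p \<in> topspace (prod_topology I01 Y). F p \<in> U}"
  have W: "openin (prod_topology I01 Y) ?W"
    using F U by (rule openin_continuous_map_preimage)
  have cC: "compactin I01 C"
    using C by (simp add: compactin_subtopology)
  let ?S = "(\<lambda>y. \<lambda>t\<in>{0..1}. F (t, y)) -` S \<inter> topspace Y"
  have eq: "?S = {y \<in> topspace Y. \<forall>t\<in>C. F (t, y) \<in> U}"
    using C(2) P S by (auto simp: image_subset_iff subset_iff)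
  show "openin Y ?S"
    unfolding eq
  proof (subst openin_subopen, clarify)
    fix y assume y: "y \<in> topspace Y" and "\<forall>t\<in>C. F (t, y) \<in> U"
    then have "C \<times> {y} \<subseteq> ?W"
      using C(2) by auto
    from tube_lemma_left[OF W cC y this] obtain A B
      where AB: "openin Y B" "C \<subseteq> A" "y \<in> B" "A \<times> B \<subseteq> ?W"
      by blast
    have "B \<subseteq> {y \<in> topspace Y. \<forall>t\<in>C. F (t, y) \<in> U}"
      using AB openin_subset by fastforce
    then show "\<exists>T. openin Y T \<and> y \<in> T \<and> T \<subseteq> {y \<in> topspace Y. \<forall>t\<in>C. F (t, y) \<in> U}"
      using AB by blast
  qed
qed

text \<open>
  This direction uses that the interval is locally compact: a path that is in \<open>U\<close> at time \<open>t\<close> stays in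
  \<open>U\<close> during a compact neighbourhood of \<open>t\<close>, which is an open condition on the path.
\<close>

lemma continuous_map_uncurry:
  assumes f: "continuous_map Y (path_space Z) f"
  shows "continuous_map (prod_topology I01 Y) Z (\<lambda>(t, y). f y t)"
proof -
  have P: "f y \<in> paths Z" if "y \<in> topspace Y" for y
    using f that by (auto simp: continuous_map_def)
  have "openin (prod_topology I01 Y) {p \<in> topspace (prod_topology I01 Y). (case p of (t, y) \<Rightarrow> f y t) \<in> U}"
    (is "openin _ ?W") if U: "openin Z U" for U
  proof (subst openin_subopen, clarify)
    fix t y assume ty: "(t, y) \<in> topspace (prod_topology I01 Y)" and tU: "f y t \<in> U"
    then have t: "t \<in> {0..1}" and y: "y \<in> topspace Y" by auto
    have "openin I01 {s \<in> topspace I01. f y s \<in> U}"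
      using P[OF y] U by (intro openin_continuous_map_preimage) (auto simp: paths_def)
    then obtain V where V: "open V" "{s \<in> {0..1}. f y s \<in> U} = {0..1} \<inter> V"
      by (auto simp: openin_open)
    then have "t \<in> V" using t tU by auto
    then obtain r where r: "r > 0" "cball t r \<subseteq> V"
      using V(1) open_contains_cball by blast
    let ?C = "{0..1} \<inter> cball t r"
    have cC: "compact ?C" by (intro compact_Int compact_cball compact_Icc)
    have "openin (path_space Z) {h \<in> paths Z. h ` ?C \<subseteq> U}"
      unfolding path_space_def
      by (rule topology_generated_by_Basis) (use cC U in blast)
    then have B: "openin Y {y \<in> topspace Y. f y \<in> {h \<in> paths Z. h ` ?C \<subseteq> U}}"
      using f openin_continuous_map_preimage by blast
    have A: "openin I01 ({0..1} \<inter> ball t r)"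
      by auto
    show "\<exists>T. openin (prod_topology I01 Y) T \<and> (t, y) \<in> T \<and> T \<subseteq> ?W"
    proof (intro exI conjI)
      show "openin (prod_topology I01 Y) (({0..1} \<inter> ball t r) \<times>
              {y \<in> topspace Y. f y \<in> {h \<in> paths Z. h ` ?C \<subseteq> U}})"
        using A B by (simp add: openin_prod_Times_iff)
      have "f y s \<in> U" if "s \<in> ?C" for s
    proof -
      have "s \<in> {0..1} \<inter> V" using that r by blast
      then show ?thesis unfolding V(2)[symmetric] by blast
    qed
      then show "(t, y) \<in> ({0..1} \<inter> ball t r) \<times>
              {y \<in> topspace Y. f y \<in> {h \<in> paths Z. h ` ?C \<subseteq> U}}"
        using t y r P[OF y] by auto
      show "({0..1} \<inter> ball t r) \<times> {y \<in> topspace Y. f y \<in> {h \<in> paths Z. h ` ?C \<subseteq> U}} \<subseteq> ?W"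
        by (auto simp: image_subset_iff)
    qed
  qed
  then show ?thesis
    using P by (auto simp: continuous_map_def path_in_topspace)
qed

lemma continuous_map_path_eval:
  assumes f: "continuous_map Y (path_space Z) f" and s: "continuous_map Y I01 s"
  shows "continuous_map Y Z (\<lambda>y. f y (s y))"
proof -
  have "continuous_map Y Z ((\<lambda>(t, y). f y t) \<circ> (\<lambda>y. (s y, y)))"
    by (rule continuous_map_compose[OF _ continuous_map_uncurry[OF f]])
      (use s in \<open>simp add: continuous_map_paired\<close>)
  then show ?thesis by (simp add: o_def)
qed

section \<open>Pointed homotopies as maps into a path space\<close>

lemma pointed_homotopicI_paths:
  assumes h: "continuous_map Y (path_space Z) h" and y0: "y0 \<in> topspace Y"
    and h0: "\<And>y. y \<in> topspace Y \<Longrightarrow> h y 0 = f y" and h1: "\<And>y. y \<in> topspace Y \<Longrightarrow> h y 1 = g y"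
    and b: "\<And>t. t \<in> {0..1} \<Longrightarrow> h y0 t = z0"
  shows "pointed_homotopic (Y, y0) (Z, z0) f g"
proof -
  have "\<exists>k. continuous_map (prod_topology I01 Y) Z k \<and>
      (\<forall>x\<in>topspace Y. k (0, x) = f x) \<and> (\<forall>x\<in>topspace Y. k (1, x) = g x) \<and>
      (\<forall>t\<in>{0..1}. k (t, y0) = z0)"
    by (rule exI[of _ "\<lambda>(t, y). h y t"]) (use continuous_map_uncurry[OF h] h0 h1 b in auto)
  then show ?thesis
    unfolding pointed_homotopic_def fst_conv snd_conv
    by (subst homotopic_with[where P = "\<lambda>h. h y0 = z0"]) (use y0 in auto)
qed

lemma pointed_homotopic_path:
  assumes "pointed_homotopic (Y, y0) (Z, z0) f g" and y0: "y0 \<in> topspace Y"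
  shows "\<exists>h. continuous_map Y (path_space Z) h \<and> (\<forall>y. h y 0 = f y) \<and> (\<forall>y. h y 1 = g y) \<and>
    h y0 = (\<lambda>t\<in>{0..1}. z0)"
proof -
  from assms obtain k where k: "continuous_map (prod_topology I01 Y) Z k"
      "\<forall>x. k (0, x) = f x" "\<forall>x. k (1, x) = g x" "\<forall>t\<in>{0..1}. k (t, y0) = z0"
    unfolding pointed_homotopic_def homotopic_with_def by auto
  show ?thesis
    by (intro exI[of _ "\<lambda>y. \<lambda>t\<in>{0..1}. k (t, y)"] conjI continuous_map_curry[OF k(1)]) (use k in auto)
qed

lemma pointed_homotopic_refl: "pointed_map P Q f \<Longrightarrow> pointed_homotopic P Q f f"
  by (simp add: pointed_map_def pointed_homotopic_def)

lemma pointed_homotopic_sym: "pointed_homotopic P Q f g \<Longrightarrow> pointed_homotopic P Q g f"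
  by (simp add: pointed_homotopic_def homotopic_with_sym)

lemma pointed_homotopic_trans [trans]:
  "pointed_homotopic P Q f g \<Longrightarrow> pointed_homotopic P Q g h \<Longrightarrow> pointed_homotopic P Q f h"
  unfolding pointed_homotopic_def by (rule homotopic_with_trans)

lemma pointed_homotopic_imp_maps:
  "pointed_homotopic P Q f g \<Longrightarrow> pointed_map P Q f \<and> pointed_map P Q g"
  using homotopic_with_imp_continuous_maps[of "\<lambda>h. h (snd P) = snd Q" "fst P" "fst Q" f g]
    homotopic_with_imp_property[of "\<lambda>h. h (snd P) = snd Q" "fst P" "fst Q" f g]
  by (simp add: pointed_homotopic_def pointed_map_def)

lemma pointed_homotopic_eq:
  assumes "pointed_map (Y, y0) Q f" "y0 \<in> topspace Y" "\<And>y. y \<in> topspace Y \<Longrightarrow> f y = g y"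
  shows "pointed_homotopic (Y, y0) Q f g"
  unfolding pointed_homotopic_def fst_conv snd_conv
  by (rule homotopic_with_equal) (use assms in \<open>auto simp: pointed_map_def\<close>)

lemma pointed_homotopic_compose_left:
  assumes "pointed_homotopic P Q f g" "pointed_map Q R h"
  shows "pointed_homotopic P R (\<lambda>x. h (f x)) (\<lambda>x. h (g x))"
  using assms unfolding pointed_homotopic_def pointed_map_def
  using homotopic_with_compose_continuous_map_left[of "\<lambda>h. h (snd P) = snd Q" "fst P" "fst Q" f g
      "fst R" h "\<lambda>h. h (snd P) = snd R"]
  by (auto simp: o_def)

lemma pointed_homotopic_compose_right:
  assumes "pointed_homotopic Q R f g" "pointed_map P Q h"
  shows "pointed_homotopic P R (\<lambda>x. f (h x)) (\<lambda>x. g (h x))"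
  using assms unfolding pointed_homotopic_def pointed_map_def
  using homotopic_with_compose_continuous_map_right[of "\<lambda>h. h (snd Q) = snd R" "fst Q" "fst R" f g
      "fst P" h "\<lambda>h. h (snd P) = snd R"]
  by (auto simp: o_def)

lemma pointed_homotopic_pair:
  assumes f: "pointed_homotopic (Y, y0) (Z, z0) f f'" and g: "pointed_homotopic (Y, y0) (W, w0) g g'"
    and y0: "y0 \<in> topspace Y"
  shows "pointed_homotopic (Y, y0) (prod_topology Z W, (z0, w0)) (\<lambda>y. (f y, g y)) (\<lambda>y. (f' y, g' y))"
proof -
  obtain h where h: "continuous_map (prod_topology I01 Y) Z h" "\<forall>x. h (0, x) = f x"
      "\<forall>x. h (1, x) = f' x" "\<forall>t\<in>{0..1}. h (t, y0) = z0"
    using f unfolding pointed_homotopic_def homotopic_with_def by auto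
  obtain k where k: "continuous_map (prod_topology I01 Y) W k" "\<forall>x. k (0, x) = g x"
      "\<forall>x. k (1, x) = g' x" "\<forall>t\<in>{0..1}. k (t, y0) = w0"
    using g unfolding pointed_homotopic_def homotopic_with_def by auto
  show ?thesis
    unfolding pointed_homotopic_def homotopic_with_def
    by (rule exI[of _ "\<lambda>p. (h p, k p)"]) (use h k in \<open>auto simp: continuous_map_paired\<close>)
qed

section \<open>Groups up to homotopy\<close>

fun bracket :: "('g \<Rightarrow> 'g \<Rightarrow> 'g) \<Rightarrow> 'j bracketing \<Rightarrow> ('j \<Rightarrow> 'g) \<Rightarrow> 'g" where
  "bracket mul (Single j) x = x j"
| "bracket mul (Branch l r) x = mul (bracket mul l x) (bracket mul r x)"

lemma bracket_cong:
  "(\<And>j. j \<in> set (leaves T) \<Longrightarrow> x j = y j) \<Longrightarrow> bracket mul T x = bracket mul T y"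
  by (induction T) auto

text \<open>
  A group object in the pointed homotopy category. The two equations at \<open>e\<close> hold strictly, so that
  pointwise products and inverses of pointed maps are pointed.
\<close>

locale h_group =
  fixes G :: "'g topology" and e :: 'g and mul :: "'g \<Rightarrow> 'g \<Rightarrow> 'g" and neg :: "'g \<Rightarrow> 'g"
  assumes e_in [simp]: "e \<in> topspace G"
    and mul_cont: "continuous_map (prod_topology G G) G (\<lambda>(x, y). mul x y)"
    and neg_cont: "continuous_map G G neg"
    and mul_e_e [simp]: "mul e e = e" and neg_e [simp]: "neg e = e"
    and h_unit_l: "pointed_homotopic (G, e) (G, e) (\<lambda>x. mul e x) (\<lambda>x. x)"
    and h_unit_r: "pointed_homotopic (G, e) (G, e) (\<lambda>x. mul x e) (\<lambda>x. x)"
    and h_inv_l: "pointed_homotopic (G, e) (G, e) (\<lambda>x. mul (neg x) x) (\<lambda>x. e)"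
    and h_inv_r: "pointed_homotopic (G, e) (G, e) (\<lambda>x. mul x (neg x)) (\<lambda>x. e)"
    and h_assoc: "pointed_homotopic (prod_topology G (prod_topology G G), (e, e, e)) (G, e)
       (\<lambda>(x, y, z). mul (mul x y) z) (\<lambda>(x, y, z). mul x (mul y z))"
begin

lemma mul_map:
  assumes "pointed_map P (G, e) u" "pointed_map P (G, e) v"
  shows "pointed_map P (G, e) (\<lambda>y. mul (u y) (v y))"
proof -
  have "continuous_map (fst P) G ((\<lambda>(x, y). mul x y) \<circ> (\<lambda>y. (u y, v y)))"
    using assms by (intro continuous_map_compose[OF _ mul_cont])
      (simp add: pointed_map_def continuous_map_paired)
  then show ?thesis using assms by (simp add: pointed_map_def o_def)
qed

lemma neg_map: "pointed_map P (G, e) u \<Longrightarrow> pointed_map P (G, e) (\<lambda>y. neg (u y))"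
  using continuous_map_compose[OF _ neg_cont, of "fst P" u] by (simp add: pointed_map_def o_def)

lemma const_map: "pointed_map P (G, e) (\<lambda>_. e)"
  by (simp add: pointed_map_def)

lemma mul_cong:
  assumes "pointed_homotopic (Y, y0) (G, e) u u'" "pointed_homotopic (Y, y0) (G, e) v v'"
    and "y0 \<in> topspace Y"
  shows "pointed_homotopic (Y, y0) (G, e) (\<lambda>y. mul (u y) (v y)) (\<lambda>y. mul (u' y) (v' y))"
proof -
  have "pointed_map (prod_topology G G, (e, e)) (G, e) (\<lambda>(x, y). mul x y)"
    using mul_cont by (simp add: pointed_map_def)
  from pointed_homotopic_compose_left[OF pointed_homotopic_pair[OF assms] this]
  show ?thesis by simp
qed

lemma unit_l: "pointed_map P (G, e) u \<Longrightarrow> pointed_homotopic P (G, e) (\<lambda>y. mul e (u y)) u"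
  by (rule pointed_homotopic_compose_right[OF h_unit_l])

lemma unit_r: "pointed_map P (G, e) u \<Longrightarrow> pointed_homotopic P (G, e) (\<lambda>y. mul (u y) e) u"
  by (rule pointed_homotopic_compose_right[OF h_unit_r])

lemma inv_l: "pointed_map P (G, e) u \<Longrightarrow> pointed_homotopic P (G, e) (\<lambda>y. mul (neg (u y)) (u y)) (\<lambda>_. e)"
  by (rule pointed_homotopic_compose_right[OF h_inv_l])

lemma inv_r: "pointed_map P (G, e) u \<Longrightarrow> pointed_homotopic P (G, e) (\<lambda>y. mul (u y) (neg (u y))) (\<lambda>_. e)"
  by (rule pointed_homotopic_compose_right[OF h_inv_r])

lemma assoc:
  assumes "pointed_map P (G, e) u" "pointed_map P (G, e) v" "pointed_map P (G, e) w"
  shows "pointed_homotopic P (G, e) (\<lambda>y. mul (mul (u y) (v y)) (w y)) (\<lambda>y. mul (u y) (mul (v y) (w y)))"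
proof -
  have "pointed_map P (prod_topology G (prod_topology G G), (e, e, e)) (\<lambda>y. (u y, v y, w y))"
    using assms by (simp add: pointed_map_def continuous_map_paired)
  from pointed_homotopic_compose_right[OF h_assoc this] show ?thesis by simp
qed

context
  fixes Y :: "'y topology" and y0 :: 'y
  assumes y0: "y0 \<in> topspace Y"
begin

lemma mul_neg_r:
  assumes x: "pointed_map (Y, y0) (G, e) x" and v: "pointed_map (Y, y0) (G, e) v"
  shows "pointed_homotopic (Y, y0) (G, e) (\<lambda>y. mul (mul (x y) (v y)) (neg (v y))) x"
  using pointed_homotopic_trans[OF assoc[OF x v neg_map[OF v]]
      pointed_homotopic_trans[OF mul_cong[OF pointed_homotopic_refl[OF x] inv_r[OF v] y0] unit_r[OF x]]] .

lemma mul_neg_r':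
  assumes x: "pointed_map (Y, y0) (G, e) x" and v: "pointed_map (Y, y0) (G, e) v"
  shows "pointed_homotopic (Y, y0) (G, e) (\<lambda>y. mul (mul (x y) (neg (v y))) (v y)) x"
  using pointed_homotopic_trans[OF assoc[OF x neg_map[OF v] v]
      pointed_homotopic_trans[OF mul_cong[OF pointed_homotopic_refl[OF x] inv_l[OF v] y0] unit_r[OF x]]] .

lemma neg_mul_l:
  assumes x: "pointed_map (Y, y0) (G, e) x" and u: "pointed_map (Y, y0) (G, e) u"
  shows "pointed_homotopic (Y, y0) (G, e) (\<lambda>y. mul (neg (u y)) (mul (u y) (x y))) x"
  using pointed_homotopic_trans[OF pointed_homotopic_sym[OF assoc[OF neg_map[OF u] u x]]
      pointed_homotopic_trans[OF mul_cong[OF inv_l[OF u] pointed_homotopic_refl[OF x] y0] unit_l[OF x]]] .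

lemma neg_mul_l':
  assumes x: "pointed_map (Y, y0) (G, e) x" and u: "pointed_map (Y, y0) (G, e) u"
  shows "pointed_homotopic (Y, y0) (G, e) (\<lambda>y. mul (u y) (mul (neg (u y)) (x y))) x"
  using pointed_homotopic_trans[OF pointed_homotopic_sym[OF assoc[OF u neg_map[OF u] x]]
      pointed_homotopic_trans[OF mul_cong[OF inv_r[OF u] pointed_homotopic_refl[OF x] y0] unit_l[OF x]]] .

text \<open>
  Equal outer factors can be cancelled; with \<open>bracket_isolate\<close> this compares two bracketed products
  that differ in one factor.
\<close>

lemma cancel:
  assumes u: "pointed_map (Y, y0) (G, e) u" and v: "pointed_map (Y, y0) (G, e) v"
    and b: "pointed_map (Y, y0) (G, e) b" and b': "pointed_map (Y, y0) (G, e) b'"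
    and eq: "pointed_homotopic (Y, y0) (G, e)
      (\<lambda>y. mul (mul (u y) (b y)) (v y)) (\<lambda>y. mul (mul (u y) (b' y)) (v y))"
  shows "pointed_homotopic (Y, y0) (G, e) b b'"
proof -
  have nv: "pointed_homotopic (Y, y0) (G, e) (\<lambda>y. neg (v y)) (\<lambda>y. neg (v y))"
    by (rule pointed_homotopic_refl[OF neg_map[OF v]])
  have nu: "pointed_homotopic (Y, y0) (G, e) (\<lambda>y. neg (u y)) (\<lambda>y. neg (u y))"
    by (rule pointed_homotopic_refl[OF neg_map[OF u]])
  have "pointed_homotopic (Y, y0) (G, e) (\<lambda>y. mul (u y) (b y)) (\<lambda>y. mul (u y) (b' y))"
    using pointed_homotopic_trans[OF pointed_homotopic_sym[OF mul_neg_r[OF mul_map[OF u b] v]]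
        pointed_homotopic_trans[OF mul_cong[OF eq nv y0] mul_neg_r[OF mul_map[OF u b'] v]]] .
  then show ?thesis
    using pointed_homotopic_trans[OF pointed_homotopic_sym[OF neg_mul_l[OF b u]]
        pointed_homotopic_trans[OF mul_cong[OF nu _ y0] neg_mul_l[OF b' u]]] by blast
qed

lemma homotopic_if_quotient_trivial:
  assumes b: "pointed_map (Y, y0) (G, e) b" and b': "pointed_map (Y, y0) (G, e) b'"
    and eq: "pointed_homotopic (Y, y0) (G, e) (\<lambda>y. mul (neg (b y)) (b' y)) (\<lambda>_. e)"
  shows "pointed_homotopic (Y, y0) (G, e) b b'"
proof -
  have "pointed_homotopic (Y, y0) (G, e) b' (\<lambda>y. mul (b y) e)"
    using pointed_homotopic_trans[OF pointed_homotopic_sym[OF neg_mul_l'[OF b' b]]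
        mul_cong[OF pointed_homotopic_refl[OF b] eq y0]] .
  then show ?thesis
    using pointed_homotopic_sym[OF pointed_homotopic_trans[OF _ unit_r[OF b]]] by blast
qed

lemma bracket_map:
  assumes "\<And>j. j \<in> set (leaves T) \<Longrightarrow> pointed_map (Y, y0) (G, e) (h j)"
  shows "pointed_map (Y, y0) (G, e) (\<lambda>y. bracket mul T (\<lambda>j. h j y))"
  using assms by (induction T) (auto intro!: mul_map)

lemma bracket_homotopic:
  assumes "\<And>j. j \<in> set (leaves T) \<Longrightarrow> pointed_homotopic (Y, y0) (G, e) (h j) (h' j)"
  shows "pointed_homotopic (Y, y0) (G, e)
    (\<lambda>y. bracket mul T (\<lambda>j. h j y)) (\<lambda>y. bracket mul T (\<lambda>j. h' j y))"
  using assms by (induction T) (auto intro!: mul_cong y0)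

text \<open>
  By associativity, the factors to the left and to the right of \<open>s\<close> can be gathered into one
  factor each. These do not depend on the factor at \<open>s\<close>.
\<close>

lemma bracket_isolate:
  assumes "distinct (leaves T)" "s \<in> set (leaves T)"
    and "\<And>j. j \<in> set (leaves T) \<Longrightarrow> pointed_map (Y, y0) (G, e) (h j)"
  shows "\<exists>u v. pointed_map (Y, y0) (G, e) u \<and> pointed_map (Y, y0) (G, e) v \<and>
    (\<forall>b. pointed_map (Y, y0) (G, e) b \<longrightarrow> pointed_homotopic (Y, y0) (G, e)
        (\<lambda>y. bracket mul T (\<lambda>j. if j = s then b y else h j y)) (\<lambda>y. mul (mul (u y) (b y)) (v y)))"
  using assms
proof (induction T)
  case (Single j)
  have "pointed_homotopic (Y, y0) (G, e) b (\<lambda>y. mul (mul e (b y)) e)"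
    if b: "pointed_map (Y, y0) (G, e) b" for b
    using pointed_homotopic_sym[OF pointed_homotopic_trans[OF
          unit_r[OF mul_map[OF const_map b]] unit_l[OF b]]] .
  then show ?case
    using Single by (intro exI[of _ "\<lambda>_. e"]) (auto simp: const_map)
next
  case (Branch l r)
  show ?case
  proof (cases "s \<in> set (leaves l)")
    case True
    then have "s \<notin> set (leaves r)"
      using Branch.prems by auto
    then have r: "bracket mul r (\<lambda>j. if j = s then b else h j y) = bracket mul r (\<lambda>j. h j y)" for b y
      by (intro bracket_cong) auto
    let ?R = "\<lambda>y. bracket mul r (\<lambda>j. h j y)"
    have R: "pointed_map (Y, y0) (G, e) ?R"
      using Branch.prems by (intro bracket_map) auto
    obtain u v where u: "pointed_map (Y, y0) (G, e) u" and v: "pointed_map (Y, y0) (G, e) v"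
      and uv: "\<And>b. pointed_map (Y, y0) (G, e) b \<Longrightarrow> pointed_homotopic (Y, y0) (G, e)
        (\<lambda>y. bracket mul l (\<lambda>j. if j = s then b y else h j y)) (\<lambda>y. mul (mul (u y) (b y)) (v y))"
      using Branch.IH(1) Branch.prems True by auto
    have main: "pointed_homotopic (Y, y0) (G, e)
        (\<lambda>y. bracket mul (Branch l r) (\<lambda>j. if j = s then b y else h j y))
        (\<lambda>y. mul (mul (u y) (b y)) (mul (v y) (?R y)))" if b: "pointed_map (Y, y0) (G, e) b" for b
      using pointed_homotopic_trans[OF mul_cong[OF uv[OF b] pointed_homotopic_refl[OF R] y0]
          assoc[OF mul_map[OF u b] v R]] by (simp add: r)
    show ?thesis
      by (intro exI[of _ u] exI[of _ "\<lambda>y. mul (v y) (?R y)"] conjI allI impI u mul_map[OF v R] main)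
  next
    case False
    then have l: "bracket mul l (\<lambda>j. if j = s then b else h j y) = bracket mul l (\<lambda>j. h j y)" for b y
      by (intro bracket_cong) auto
    let ?L = "\<lambda>y. bracket mul l (\<lambda>j. h j y)"
    have L: "pointed_map (Y, y0) (G, e) ?L"
      using Branch.prems by (intro bracket_map) auto
    obtain u v where u: "pointed_map (Y, y0) (G, e) u" and v: "pointed_map (Y, y0) (G, e) v"
      and uv: "\<And>b. pointed_map (Y, y0) (G, e) b \<Longrightarrow> pointed_homotopic (Y, y0) (G, e)
        (\<lambda>y. bracket mul r (\<lambda>j. if j = s then b y else h j y)) (\<lambda>y. mul (mul (u y) (b y)) (v y))"
      using Branch.IH(2) Branch.prems False by auto
    have main: "pointed_homotopic (Y, y0) (G, e)
        (\<lambda>y. bracket mul (Branch l r) (\<lambda>j. if j = s then b y else h j y))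
        (\<lambda>y. mul (mul (mul (?L y) (u y)) (b y)) (v y))" if b: "pointed_map (Y, y0) (G, e) b" for b
      using pointed_homotopic_trans[OF mul_cong[OF pointed_homotopic_refl[OF L] uv[OF b] y0]
          pointed_homotopic_trans[OF pointed_homotopic_sym[OF assoc[OF L mul_map[OF u b] v]]
            mul_cong[OF pointed_homotopic_sym[OF assoc[OF L u b]] pointed_homotopic_refl[OF v] y0]]]
      by (simp add: l)
    show ?thesis
      by (intro exI[of _ "\<lambda>y. mul (?L y) (u y)"] exI[of _ v] conjI allI impI mul_map[OF L u] v main)
  qed
qed

end

end


section \<open>Loop spaces\<close>

definition loops :: "'z topology \<Rightarrow> 'z \<Rightarrow> (real \<Rightarrow> 'z) topology" where
  "loops Z z0 = subtopology (path_space Z) {f. f 0 = z0 \<and> f 1 = z0}"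

definition const_path :: "'z \<Rightarrow> real \<Rightarrow> 'z" where
  "const_path z = (\<lambda>t\<in>{0..1}. z)"

definition concat_path :: "(real \<Rightarrow> 'z) \<Rightarrow> (real \<Rightarrow> 'z) \<Rightarrow> real \<Rightarrow> 'z" where
  "concat_path f g = (\<lambda>t\<in>{0..1}. if t \<le> 1/2 then f (2 * t) else g (2 * t - 1))"

definition rev_path :: "(real \<Rightarrow> 'z) \<Rightarrow> real \<Rightarrow> 'z" where
  "rev_path f = (\<lambda>t\<in>{0..1}. f (1 - t))"

lemma const_path_apply [simp]: "t \<in> {0..1} \<Longrightarrow> const_path z t = z"
  by (simp add: const_path_def)

lemma topspace_loops: "topspace (loops Z z0) = {f \<in> paths Z. f 0 = z0 \<and> f 1 = z0}"
  by (auto simp: loops_def)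

lemma const_path_in_loops [simp]: "z0 \<in> topspace Z \<Longrightarrow> const_path z0 \<in> topspace (loops Z z0)"
proof -
  assume z0: "z0 \<in> topspace Z"
  have "continuous_map I01 Z (const_path z0)"
    by (rule continuous_map_eq[of _ _ "\<lambda>_. z0"]) (use z0 in auto)
  then show ?thesis
    by (simp add: topspace_loops paths_def const_path_def)
qed

lemma continuous_map_loops_iff:
  "continuous_map Y (loops Z z0) f \<longleftrightarrow>
     continuous_map Y (path_space Z) f \<and> (\<forall>y\<in>topspace Y. f y 0 = z0 \<and> f y 1 = z0)"
  by (auto simp: loops_def continuous_map_in_subtopology)

lemma continuous_map_into_I01:
  "continuous_map Y I01 s \<longleftrightarrow> continuous_map Y euclideanreal s \<and> (\<forall>y\<in>topspace Y. 0 \<le> s y \<and> s y \<le> 1)"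
  by (auto simp: continuous_map_in_subtopology)

text \<open>A loop-valued homotopy, given with the loop parameter as the first coordinate.\<close>

text \<open>
  Loop-valued homotopies are most easily described with the loop parameter as the first of
  the coordinates, because that is the coordinate to be curried.
\<close>

lemma loop_homotopyI:
  assumes k: "continuous_map (prod_topology I01 (prod_topology I01 Y)) Z (\<lambda>(t, s, y). k t s y)"
    and y0: "y0 \<in> topspace Y"
    and ends: "\<And>s y. s \<in> {0..1} \<Longrightarrow> y \<in> topspace Y \<Longrightarrow> k 0 s y = z0 \<and> k 1 s y = z0"
    and base: "\<And>t s. t \<in> {0..1} \<Longrightarrow> s \<in> {0..1} \<Longrightarrow> k t s y0 = z0"
    and f: "\<And>y t. y \<in> topspace Y \<Longrightarrow> f y = (\<lambda>t\<in>{0..1}. k t 0 y)"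
    and g: "\<And>y t. y \<in> topspace Y \<Longrightarrow> g y = (\<lambda>t\<in>{0..1}. k t 1 y)"
  shows "pointed_homotopic (Y, y0) (loops Z z0, const_path z0) f g"
proof -
  let ?h = "\<lambda>p. \<lambda>t\<in>{0..1}. (\<lambda>(t, s, y). k t s y) (t, p)"
  have "continuous_map (prod_topology I01 Y) (loops Z z0) ?h"
    unfolding continuous_map_loops_iff
    using continuous_map_curry[OF k] ends by auto
  moreover have "\<forall>t\<in>{0..1}. ?h (t, y0) = const_path z0"
    using base by (auto simp: const_path_def fun_eq_iff)
  moreover have "\<forall>y\<in>topspace Y. ?h (0, y) = f y" "\<forall>y\<in>topspace Y. ?h (1, y) = g y"
    using f g by auto
  ultimately show ?thesis
    unfolding pointed_homotopic_def fst_conv snd_conv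
    using y0 by (subst homotopic_with[where P = "\<lambda>h. h y0 = const_path z0"]) (auto intro!: exI[of _ ?h])
qed

lemma continuous_map_real_fst_of:
  "continuous_on {0..1} \<alpha> \<Longrightarrow> continuous_map (prod_topology I01 Y) euclideanreal (\<lambda>p. \<alpha> (fst p))"
  using continuous_map_compose[of "prod_topology I01 Y" I01 fst euclideanreal \<alpha>]
  by (simp add: o_def continuous_map_fst)

text \<open>
  The two parameter changes are joined by a straight line, which is constant at both ends.
\<close>

lemma loop_reparam:
  fixes Z :: "'z topology"
  assumes \<alpha>: "continuous_on {0..1} \<alpha>" "\<alpha> \<in> {0..1} \<rightarrow> {0..1}" "\<alpha> 0 \<in> {0, 1}" "\<alpha> 1 \<in> {0, 1}"
    and \<beta>: "continuous_on {0..1} \<beta>" "\<beta> \<in> {0..1} \<rightarrow> {0..1}" "\<beta> 0 = \<alpha> 0" "\<beta> 1 = \<alpha> 1"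
    and z0: "z0 \<in> topspace Z"
  shows "pointed_homotopic (loops Z z0, const_path z0) (loops Z z0, const_path z0)
     (\<lambda>f. \<lambda>t\<in>{0..1}. f (\<alpha> t)) (\<lambda>f. \<lambda>t\<in>{0..1}. f (\<beta> t))"
proof (rule loop_homotopyI[where k = "\<lambda>t s f. f ((1 - s) * \<alpha> t + s * \<beta> t)"])
  let ?Y = "prod_topology I01 (prod_topology I01 (loops Z z0))"
  have f: "continuous_map ?Y (path_space Z) (\<lambda>p. snd (snd p))"
    using continuous_map_compose[OF continuous_map_snd continuous_map_snd, of I01 I01 "loops Z z0"]
    by (simp add: continuous_map_loops_iff o_def)
  have s: "continuous_map ?Y euclideanreal (\<lambda>p. fst (snd p))"
  proof -
    have "continuous_map ?Y I01 (fst \<circ> snd)"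
      by (intro continuous_map_compose[OF continuous_map_snd continuous_map_fst])
    then show ?thesis by (simp add: continuous_map_into_I01 o_def)
  qed
  have a01: "0 \<le> \<alpha> t" "\<alpha> t \<le> 1" "0 \<le> \<beta> t" "\<beta> t \<le> 1" if "0 \<le> t" "t \<le> 1" for t
    using \<alpha>(2) \<beta>(2) that by (auto simp: Pi_iff)
  have conv: "0 \<le> (1 - s) * \<alpha> t + s * \<beta> t \<and> (1 - s) * \<alpha> t + s * \<beta> t \<le> 1"
    if "0 \<le> s" "s \<le> 1" "0 \<le> t" "t \<le> 1" for s t :: real
  proof
    show "0 \<le> (1 - s) * \<alpha> t + s * \<beta> t"
      using a01[OF that(3,4)] that(1,2) by simp
    show "(1 - s) * \<alpha> t + s * \<beta> t \<le> 1"
      using convex_bound_le[OF a01(2)[OF that(3,4)] a01(4)[OF that(3,4)], of "1 - s" s] that(1,2) by simp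
  qed
  have "continuous_map ?Y I01 (\<lambda>p. (1 - fst (snd p)) * \<alpha> (fst p) + fst (snd p) * \<beta> (fst p))"
    unfolding continuous_map_into_I01
    by (intro conjI continuous_intros s continuous_map_real_fst_of \<alpha> \<beta>) (use conv in auto)
  from continuous_map_path_eval[OF f this]
  show "continuous_map ?Y Z (\<lambda>(t, s, f). f ((1 - s) * \<alpha> t + s * \<beta> t))"
    by (simp add: case_prod_unfold)
  show "const_path z0 \<in> topspace (loops Z z0)" using z0 by simp
  show "f ((1 - s) * \<alpha> 0 + s * \<beta> 0) = z0 \<and> f ((1 - s) * \<alpha> 1 + s * \<beta> 1) = z0"
    if "f \<in> topspace (loops Z z0)" for f s
    using that \<alpha>(3,4) \<beta>(3,4) by (auto simp: topspace_loops)
  show "const_path z0 ((1 - s) * \<alpha> t + s * \<beta> t) = z0" if "t \<in> {0..1}" "s \<in> {0..1}" for s t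
    using conv that by simp
  show "(\<lambda>t\<in>{0..1}. f (\<alpha> t)) = (\<lambda>t\<in>{0..1}. f ((1 - 0) * \<alpha> t + 0 * \<beta> t))" for f :: "real \<Rightarrow> 'z"
    by simp
  show "(\<lambda>t\<in>{0..1}. f (\<beta> t)) = (\<lambda>t\<in>{0..1}. f ((1 - 1) * \<alpha> t + 1 * \<beta> t))" for f :: "real \<Rightarrow> 'z"
    by simp
qed

lemma concat_path_continuous:
  "continuous_map (prod_topology (loops Z z0) (loops Z z0)) (loops Z z0) (\<lambda>(f, g). concat_path f g)"
  (is "continuous_map ?LL _ _")
proof -
  let ?Y = "prod_topology I01 ?LL"
  have f: "continuous_map ?Y (path_space Z) (\<lambda>p. fst (snd p))"
    and g: "continuous_map ?Y (path_space Z) (\<lambda>p. snd (snd p))"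
    using continuous_map_compose[OF continuous_map_snd continuous_map_fst, of I01 "loops Z z0" "loops Z z0"]
      continuous_map_compose[OF continuous_map_snd continuous_map_snd, of I01 "loops Z z0" "loops Z z0"]
    by (simp_all add: continuous_map_loops_iff o_def)
  have t: "continuous_map ?Y euclideanreal fst"
    using continuous_map_fst[of I01 ?LL] by (simp add: continuous_map_into_I01)
  have "continuous_map ?Y Z (\<lambda>p. if fst p \<le> 1/2 then fst (snd p) (2 * fst p) else snd (snd p) (2 * fst p - 1))"
  proof (rule continuous_map_cases_le[OF t])
    show "continuous_map (subtopology ?Y {x \<in> topspace ?Y. fst x \<le> 1 / 2}) Z (\<lambda>x. fst (snd x) (2 * fst x))"
      by (rule continuous_map_path_eval)
        (auto simp: continuous_map_into_I01 f intro!: continuous_map_from_subtopology t continuous_intros)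
    show "continuous_map (subtopology ?Y {x \<in> topspace ?Y. 1 / 2 \<le> fst x}) Z (\<lambda>x. snd (snd x) (2 * fst x - 1))"
      by (rule continuous_map_path_eval)
        (auto simp: continuous_map_into_I01 g intro!: continuous_map_from_subtopology t continuous_intros)
    show "fst (snd p) (2 * fst p) = snd (snd p) (2 * fst p - 1)" if "p \<in> topspace ?Y" "fst p = 1/2" for p
    proof -
      have 1: "2 * fst p = 1" using that(2) by simp
      show ?thesis unfolding 1 using that(1) by (auto simp: topspace_loops)
    qed
  qed simp
  from continuous_map_curry[OF this]
  have "continuous_map ?LL (path_space Z) (\<lambda>(f, g). concat_path f g)"
    by (simp add: case_prod_unfold concat_path_def cong: if_cong)
  then show ?thesis
    by (auto simp: continuous_map_loops_iff concat_path_def topspace_loops)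
qed

lemma rev_path_continuous: "continuous_map (loops Z z0) (loops Z z0) rev_path"
proof -
  let ?Y = "prod_topology I01 (loops Z z0)"
  have f: "continuous_map ?Y (path_space Z) (\<lambda>p. snd p)"
    using continuous_map_snd[of I01 "loops Z z0"] by (simp add: continuous_map_loops_iff)
  have t: "continuous_map ?Y euclideanreal fst"
    using continuous_map_fst[of I01 "loops Z z0"] by (simp add: continuous_map_into_I01)
  have "continuous_map ?Y Z (\<lambda>p. snd p (1 - fst p))"
    by (rule continuous_map_path_eval[OF f])
      (auto simp: continuous_map_into_I01 intro!: t continuous_intros)
  from continuous_map_curry[OF this] show ?thesis
    by (auto simp: continuous_map_loops_iff rev_path_def[abs_def] topspace_loops)
qed

text \<open>
  Each group law holds because the two sides are, up to a change of parameter, the same loop: the unit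
  laws remove a pause, the inverse laws shrink a path that runs forth and back along the loop to
  its starting point, and for associativity the parameter is changed by a piecewise linear map with
  slopes \<open>2\<close>, \<open>1\<close> and \<open>1/2\<close>.
\<close>

lemma loops_h_group:
  assumes z0: "z0 \<in> topspace Z"
  shows "h_group (loops Z z0) (const_path z0) concat_path rev_path"
proof
  let ?L = "loops Z z0" and ?P = "(loops Z z0, const_path z0)"
  show "const_path z0 \<in> topspace ?L" using z0 by simp
  show cc: "concat_path (const_path z0) (const_path z0) = const_path z0"
    by (auto simp: concat_path_def const_path_def fun_eq_iff)
  show "rev_path (const_path z0) = const_path z0"
    by (auto simp: rev_path_def const_path_def fun_eq_iff)
  have cpin: "const_path z0 \<in> topspace ?L" using z0 by (rule const_path_in_loops)
  have cst: "pointed_map ?P ?P (\<lambda>_. const_path z0)"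
    unfolding pointed_map_def fst_conv snd_conv using cpin by simp
  have idp: "pointed_map ?P ?P (\<lambda>x. x)"
    unfolding pointed_map_def fst_conv snd_conv by simp
  have id: "pointed_homotopic ?P ?P (\<lambda>f. f) (\<lambda>f. \<lambda>t\<in>{0..1}. f t)"
    by (rule pointed_homotopic_eq[OF idp cpin])
      (simp add: topspace_loops paths_def extensional_restrict)
  have revp: "pointed_map ?P ?P rev_path"
    using rev_path_continuous \<open>rev_path (const_path z0) = const_path z0\<close> by (simp add: pointed_map_def)
  have cp: "pointed_map Q ?P (\<lambda>x. concat_path (u x) (v x))"
    if "pointed_map Q ?P u" "pointed_map Q ?P v" for Q and u v
  proof -
    have "continuous_map (fst Q) ?L ((\<lambda>(f, g). concat_path f g) \<circ> (\<lambda>x. (u x, v x)))"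
      using that by (intro continuous_map_compose[OF _ concat_path_continuous])
        (simp add: pointed_map_def continuous_map_paired)
    then show ?thesis
      using that cc by (simp add: pointed_map_def o_def)
  qed
  show "pointed_homotopic ?P ?P (\<lambda>x. concat_path (const_path z0) x) (\<lambda>x. x)"
  proof -
    have "pointed_homotopic ?P ?P (\<lambda>x. concat_path (const_path z0) x) (\<lambda>f. \<lambda>t\<in>{0..1}. f (max 0 (2 * t - 1)))"
      by (rule pointed_homotopic_eq[OF cp[OF cst idp] cpin])
        (auto simp: concat_path_def topspace_loops fun_eq_iff max.absorb1 max.absorb2)
    also have "pointed_homotopic ?P ?P \<dots> (\<lambda>f. \<lambda>t\<in>{0..1}. f t)"
      by (rule loop_reparam) (use z0 in \<open>auto intro!: continuous_intros\<close>)
    finally show ?thesis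
      using pointed_homotopic_sym[OF id] pointed_homotopic_trans by blast
  qed
  show "pointed_homotopic ?P ?P (\<lambda>x. concat_path x (const_path z0)) (\<lambda>x. x)"
  proof -
    have "pointed_homotopic ?P ?P (\<lambda>x. concat_path x (const_path z0)) (\<lambda>f. \<lambda>t\<in>{0..1}. f (min 1 (2 * t)))"
      by (rule pointed_homotopic_eq[OF cp[OF idp cst] cpin])
        (auto simp: concat_path_def topspace_loops fun_eq_iff min.absorb1 min.absorb2)
    also have "pointed_homotopic ?P ?P \<dots> (\<lambda>f. \<lambda>t\<in>{0..1}. f t)"
      by (rule loop_reparam) (use z0 in \<open>auto intro!: continuous_intros\<close>)
    finally show ?thesis
      using pointed_homotopic_sym[OF id] pointed_homotopic_trans by blast
  qed
  show "pointed_homotopic ?P ?P (\<lambda>x. concat_path (rev_path x) x) (\<lambda>x. const_path z0)"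
  proof -
    have "pointed_homotopic ?P ?P (\<lambda>x. concat_path (rev_path x) x) (\<lambda>f. \<lambda>t\<in>{0..1}. f \<bar>1 - 2 * t\<bar>)"
      by (rule pointed_homotopic_eq[OF cp[OF revp idp] cpin])
        (auto simp: concat_path_def rev_path_def topspace_loops fun_eq_iff abs_if)
    also have "pointed_homotopic ?P ?P \<dots> (\<lambda>f. \<lambda>t\<in>{0..1}. f 1)"
      by (rule loop_reparam) (use z0 in \<open>auto intro!: continuous_intros\<close>)
    also have "pointed_homotopic ?P ?P \<dots> (\<lambda>x. const_path z0)"
      by (rule pointed_homotopic_sym[OF pointed_homotopic_eq[OF cst cpin]])
        (auto simp: const_path_def topspace_loops)
    finally show ?thesis .
  qed
  show "pointed_homotopic ?P ?P (\<lambda>x. concat_path x (rev_path x)) (\<lambda>x. const_path z0)"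
  proof -
    have "pointed_homotopic ?P ?P (\<lambda>x. concat_path x (rev_path x)) (\<lambda>f. \<lambda>t\<in>{0..1}. f (1 - \<bar>1 - 2 * t\<bar>))"
      by (rule pointed_homotopic_eq[OF cp[OF idp revp] cpin])
        (auto simp: concat_path_def rev_path_def topspace_loops fun_eq_iff abs_if)
    also have "pointed_homotopic ?P ?P \<dots> (\<lambda>f. \<lambda>t\<in>{0..1}. f 0)"
      by (rule loop_reparam) (use z0 in \<open>auto intro!: continuous_intros\<close>)
    also have "pointed_homotopic ?P ?P \<dots> (\<lambda>x. const_path z0)"
      by (rule pointed_homotopic_sym[OF pointed_homotopic_eq[OF cst cpin]])
        (auto simp: const_path_def topspace_loops)
    finally show ?thesis .
  qed
  let ?L3 = "prod_topology ?L (prod_topology ?L ?L)"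
  let ?P3 = "(?L3, (const_path z0, const_path z0, const_path z0))"
  have p1: "pointed_map ?P3 ?P (\<lambda>x. fst x)" and p2: "pointed_map ?P3 ?P (\<lambda>x. fst (snd x))"
    and p3: "pointed_map ?P3 ?P (\<lambda>x. snd (snd x))"
    using continuous_map_compose[OF continuous_map_snd continuous_map_fst, of ?L ?L ?L]
      continuous_map_compose[OF continuous_map_snd continuous_map_snd, of ?L ?L ?L]
    by (simp_all add: pointed_map_def continuous_map_fst o_def)
  show "pointed_homotopic ?P3 ?P (\<lambda>(x, y, z). concat_path (concat_path x y) z)
     (\<lambda>(x, y, z). concat_path x (concat_path y z))"
  proof -
    let ?\<alpha> = "\<lambda>t::real. min (2 * t) (min (t + 1/4) ((t + 1)/2))"
    have "pointed_homotopic ?P3 ?P (\<lambda>x. concat_path (concat_path (fst x) (fst (snd x))) (snd (snd x)))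
      (\<lambda>x. \<lambda>t\<in>{0..1}. concat_path (fst x) (concat_path (fst (snd x)) (snd (snd x))) (?\<alpha> t))"
    proof (rule pointed_homotopic_eq[OF cp[OF cp[OF p1 p2] p3]])
      fix x assume x: "x \<in> topspace ?L3"
      obtain a b c where [simp]: "x = (a, b, c)" by (metis surj_pair)
      have abc: "a 1 = z0" "b 0 = z0" "b 1 = z0" "c 0 = z0"
        using x by (auto simp: topspace_loops)
      show "concat_path (concat_path (fst x) (fst (snd x))) (snd (snd x)) =
        (\<lambda>t\<in>{0..1}. concat_path (fst x) (concat_path (fst (snd x)) (snd (snd x))) (?\<alpha> t))"
      proof
        fix t :: real
        consider "t \<notin> {0..1}" | "0 \<le> t" "t \<le> 1/4" | "1/4 < t" "t \<le> 1/2" | "1/2 < t" "t \<le> 1"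
          by fastforce
        then show "concat_path (concat_path (fst x) (fst (snd x))) (snd (snd x)) t =
          (\<lambda>t\<in>{0..1}. concat_path (fst x) (concat_path (fst (snd x)) (snd (snd x))) (?\<alpha> t)) t"
        proof cases
          case 1
          then show ?thesis by (auto simp: concat_path_def)
        next
          case 2
          then have "?\<alpha> t = 2 * t" by (auto simp: min_def)
          with 2 show ?thesis by (simp add: concat_path_def)
        next
          case 3
          then have "?\<alpha> t = t + 1/4" by (auto simp: min_def)
          with 3 show ?thesis by (simp add: concat_path_def algebra_simps)
        next
          case 4
          then have "?\<alpha> t = (t + 1)/2" by (auto simp: min_def)
          with 4 show ?thesis by (simp add: concat_path_def field_simps)
        qed
      qed
    qed (use cpin in simp)
    also have "pointed_homotopic ?P3 ?P \<dots>
      (\<lambda>x. \<lambda>t\<in>{0..1}. concat_path (fst x) (concat_path (fst (snd x)) (snd (snd x))) t)"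
      by (rule pointed_homotopic_compose_right[OF loop_reparam cp[OF p1 cp[OF p2 p3]]])
        (use z0 in \<open>auto simp: min_le_iff_disj intro!: continuous_intros\<close>)
    also have "pointed_homotopic ?P3 ?P \<dots> (\<lambda>x. concat_path (fst x) (concat_path (fst (snd x)) (snd (snd x))))"
      by (rule pointed_homotopic_sym[OF pointed_homotopic_eq[OF cp[OF p1 cp[OF p2 p3]]]])
        (use cpin in \<open>auto simp: concat_path_def\<close>)
    finally show ?thesis by (simp add: case_prod_unfold)
  qed
qed (simp_all add: concat_path_continuous rev_path_continuous)

section \<open>Quotients, pushouts and sums\<close>

lemma cls_rel: "(p, cls R p) \<in> (R \<union> R\<inverse>)\<^sup>*"
  unfolding cls_def by (rule someI[of "\<lambda>q. (p, q) \<in> (R \<union> R\<inverse>)\<^sup>*" p]) simp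

lemma sym_closure_sym: "(p, q) \<in> (R \<union> R\<inverse>)\<^sup>* \<Longrightarrow> (q, p) \<in> (R \<union> R\<inverse>)\<^sup>*"
  by (rule symD[OF sym_rtrancl[OF sym_Un_converse]])

lemma cls_eq_iff: "cls R p = cls R q \<longleftrightarrow> (p, q) \<in> (R \<union> R\<inverse>)\<^sup>*"
proof
  assume "cls R p = cls R q"
  then show "(p, q) \<in> (R \<union> R\<inverse>)\<^sup>*"
    by (metis cls_rel rtrancl_trans sym_closure_sym)
next
  assume pq: "(p, q) \<in> (R \<union> R\<inverse>)\<^sup>*"
  have "(\<lambda>r. (p, r) \<in> (R \<union> R\<inverse>)\<^sup>*) = (\<lambda>r. (q, r) \<in> (R \<union> R\<inverse>)\<^sup>*)"
    using pq sym_closure_sym[OF pq] by (auto simp: fun_eq_iff intro: rtrancl_trans)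
  then show "cls R p = cls R q" by (simp add: cls_def)
qed

lemma cls_eqI: "(p, q) \<in> R \<Longrightarrow> cls R p = cls R q"
  by (auto simp: cls_eq_iff)

lemma rtrancl_respects:
  assumes "\<And>p q. (p, q) \<in> R \<Longrightarrow> f p = f q" "(p, q) \<in> (R \<union> R\<inverse>)\<^sup>*"
  shows "f p = f q"
  using assms(2)
proof induction
  case (step y z)
  then show ?case using assms(1)[of y z] assms(1)[of z y] by auto
qed simp

text \<open>
  As classes are replaced by representatives, a map that respects the relation is the map that it
  induces on the quotient.
\<close>

lemma cls_respects: "(\<And>p q. (p, q) \<in> R \<Longrightarrow> f p = f q) \<Longrightarrow> f (cls R p) = f p"
  by (metis rtrancl_respects cls_rel)

lemma openin_final_topology:
  "openin (final_topology f Y) U \<longleftrightarrow> U \<subseteq> f ` topspace Y \<and> openin Y {y \<in> topspace Y. f y \<in> U}"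
proof -
  have "istopology (\<lambda>U. U \<subseteq> f ` topspace Y \<and> openin Y {y \<in> topspace Y. f y \<in> U})"
    unfolding istopology_def
  proof (intro conjI allI impI)
    fix S T
    assume S: "S \<subseteq> f ` topspace Y \<and> openin Y {y \<in> topspace Y. f y \<in> S}"
      and T: "T \<subseteq> f ` topspace Y \<and> openin Y {y \<in> topspace Y. f y \<in> T}"
    have "{y \<in> topspace Y. f y \<in> S \<inter> T} = {y \<in> topspace Y. f y \<in> S} \<inter> {y \<in> topspace Y. f y \<in> T}"
      by auto
    then show "S \<inter> T \<subseteq> f ` topspace Y" "openin Y {y \<in> topspace Y. f y \<in> S \<inter> T}"
      using S T by auto
  next
    fix K
    assume K: "\<forall>S\<in>K. S \<subseteq> f ` topspace Y \<and> openin Y {y \<in> topspace Y. f y \<in> S}"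
    have "{y \<in> topspace Y. f y \<in> \<Union>K} = (\<Union>S\<in>K. {y \<in> topspace Y. f y \<in> S})"
      by auto
    then show "\<Union>K \<subseteq> f ` topspace Y" "openin Y {y \<in> topspace Y. f y \<in> \<Union>K}"
      using K by auto
  qed
  then show ?thesis
    by (simp add: final_topology_def topology_inverse')
qed

lemma topspace_final_topology [simp]: "topspace (final_topology f Y) = f ` topspace Y"
proof -
  have "{y \<in> topspace Y. f y \<in> f ` topspace Y} = topspace Y" by auto
  then have "openin (final_topology f Y) (f ` topspace Y)"
    by (simp add: openin_final_topology)
  then show ?thesis
    using openin_topspace[of "final_topology f Y", unfolded openin_final_topology]
    by (intro subset_antisym) (auto dest: openin_subset)
qed

lemma quotient_map_final_topology: "quotient_map Y (final_topology f Y) f"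
  by (auto simp: quotient_map_def openin_final_topology)

lemma quotient_map_quot: "quotient_map Y (quot Y R) (cls R)"
  by (simp add: quot_def quotient_map_final_topology)

lemma continuous_map_quotI:
  assumes "continuous_map Y Z F" "\<And>p q. (p, q) \<in> R \<Longrightarrow> F p = F q"
  shows "continuous_map (quot Y R) Z F"
proof (rule continuous_compose_quotient_map[OF quotient_map_quot])
  show "continuous_map Y Z (F \<circ> cls R)"
    by (rule continuous_map_eq[OF assms(1)]) (simp add: cls_respects[of R F, OF assms(2)])
qed

lemma openin_coprod: "openin (coprod Y Z) U \<longleftrightarrow> openin Y (Inl -` U) \<and> openin Z (Inr -` U)"
proof -
  have "istopology (\<lambda>U. openin Y (Inl -` U) \<and> openin Z (Inr -` U))"
    unfolding istopology_def
    by (auto simp: vimage_Union)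
  then show ?thesis
    by (simp add: coprod_def topology_inverse')
qed

lemma topspace_coprod: "topspace (coprod Y Z) = Inl ` topspace Y \<union> Inr ` topspace Z"
proof
  have "openin (coprod Y Z) (topspace (coprod Y Z))" by simp
  then have sub: "Inl -` topspace (coprod Y Z) \<subseteq> topspace Y" "Inr -` topspace (coprod Y Z) \<subseteq> topspace Z"
    unfolding openin_coprod by (simp_all add: openin_subset)
  show "topspace (coprod Y Z) \<subseteq> Inl ` topspace Y \<union> Inr ` topspace Z"
  proof
    fix x assume "x \<in> topspace (coprod Y Z)"
    then show "x \<in> Inl ` topspace Y \<union> Inr ` topspace Z"
      by (cases x) (use sub in auto)
  qed
  have "Inl -` (Inl ` topspace Y \<union> Inr ` topspace Z) = topspace Y"
    "Inr -` (Inl ` topspace Y \<union> Inr ` topspace Z) = topspace Z"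
    by auto
  then have "openin (coprod Y Z) (Inl ` topspace Y \<union> Inr ` topspace Z)"
    by (simp add: openin_coprod)
  then show "Inl ` topspace Y \<union> Inr ` topspace Z \<subseteq> topspace (coprod Y Z)"
    by (rule openin_subset)
qed

lemma continuous_map_from_coprod:
  assumes "continuous_map Y W F" "continuous_map Z W G"
  shows "continuous_map (coprod Y Z) W (case_sum F G)"
  unfolding continuous_map_def
proof (intro conjI allI impI)
  show "case_sum F G \<in> topspace (coprod Y Z) \<rightarrow> topspace W"
    using assms by (auto simp: topspace_coprod continuous_map_def)
  fix U assume U: "openin W U"
  have "Inl -` {x \<in> topspace (coprod Y Z). case_sum F G x \<in> U} = {y \<in> topspace Y. F y \<in> U}"
    "Inr -` {x \<in> topspace (coprod Y Z). case_sum F G x \<in> U} = {y \<in> topspace Z. G y \<in> U}"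
    by (auto simp: topspace_coprod)
  then show "openin (coprod Y Z) {x \<in> topspace (coprod Y Z). case_sum F G x \<in> U}"
    using U assms by (simp add: openin_coprod openin_continuous_map_preimage)
qed

lemma continuous_map_Inl: "continuous_map Y (coprod Y Z) Inl"
proof -
  have "{x \<in> topspace Y. Inl x \<in> U} = Inl -` U" if "openin (coprod Y Z) U" for U
    using that by (auto simp: openin_coprod dest: openin_subset)
  then show ?thesis
    by (auto simp: continuous_map_def topspace_coprod openin_coprod)
qed

lemma continuous_map_Inr: "continuous_map Z (coprod Y Z) Inr"
proof -
  have "{x \<in> topspace Z. Inr x \<in> U} = Inr -` U" if "openin (coprod Y Z) U" for U
    using that by (auto simp: openin_coprod dest: openin_subset)
  then show ?thesis
    by (auto simp: continuous_map_def topspace_coprod openin_coprod)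
qed

lemma continuous_map_from_sum:
  assumes "\<And>i. i \<in> I \<Longrightarrow> continuous_map (X i) Y (\<lambda>x. f (i, x))"
  shows "continuous_map (sum_topology X I) Y f"
  unfolding continuous_map_def
proof (intro conjI allI impI)
  show "f \<in> topspace (sum_topology X I) \<rightarrow> topspace Y"
  proof
    fix p assume "p \<in> topspace (sum_topology X I)"
    then obtain i x where "p = (i, x)" "i \<in> I" "x \<in> topspace (X i)" by auto
    then show "f p \<in> topspace Y"
      using funcset_mem[OF continuous_map_funspace[OF assms]] by auto
  qed
  fix U assume "openin Y U"
  then have "openin (X i) {x \<in> topspace (X i). f (i, x) \<in> U}" if "i \<in> I" for i
    using assms[OF that] by (simp add: openin_continuous_map_preimage)
  then show "openin (sum_topology X I) {x \<in> topspace (sum_topology X I). f x \<in> U}"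
    by (auto simp: openin_sum_topology elim: back_subst[of "openin (X _)"])
qed

lemma pushout_respects:
  assumes "\<And>b. b \<in> topspace B \<Longrightarrow> F (f b) = G (g b)" "(p, q) \<in> pushout_rel B f g"
  shows "case_sum F G p = case_sum F G q"
  using assms by (auto simp: pushout_rel_def)

text \<open>
  Attaching cells is expressed by a homeomorphism from a pushout; this transports the universal
  property of the pushout to the space itself.
\<close>

lemma homeomorphic_pushout_lift:
  assumes hom: "homeomorphic_map (pushout B Y Z f g) Q (case_sum \<alpha> \<beta>)"
    and comm: "\<And>b. b \<in> topspace B \<Longrightarrow> \<alpha> (f b) = \<beta> (g b)"
  shows "topspace Q = \<alpha> ` topspace Y \<union> \<beta> ` topspace Z"
    and "continuous_map Y Q \<alpha>" and "continuous_map Z Q \<beta>"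
    and "\<And>(W :: 'w topology) F G. \<lbrakk>continuous_map Y W F; continuous_map Z W G;
          \<And>b. b \<in> topspace B \<Longrightarrow> F (f b) = G (g b)\<rbrakk> \<Longrightarrow>
        \<exists>k. continuous_map Q W k \<and> (\<forall>y\<in>topspace Y. k (\<alpha> y) = F y) \<and> (\<forall>z\<in>topspace Z. k (\<beta> z) = G z)"
proof -
  let ?R = "pushout_rel B f g" and ?\<psi> = "case_sum \<alpha> \<beta>"
  have \<psi>: "?\<psi> (cls ?R p) = ?\<psi> p" for p
    by (rule cls_respects) (rule pushout_respects[where F = \<alpha> and G = \<beta> and f = f and g = g, OF comm])
  have q: "quotient_map (coprod Y Z) (pushout B Y Z f g) (cls ?R)"
    by (simp add: pushout_def quotient_map_quot)
  have "topspace Q = ?\<psi> ` topspace (pushout B Y Z f g)"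
    using hom by (simp add: homeomorphic_imp_surjective_map)
  also have "\<dots> = ?\<psi> ` topspace (coprod Y Z)"
    unfolding quotient_imp_surjective_map[OF q, symmetric] by (simp add: image_image \<psi>)
  finally show "topspace Q = \<alpha> ` topspace Y \<union> \<beta> ` topspace Z"
    by (simp add: topspace_coprod image_Un image_image)
  have "continuous_map (coprod Y Z) Q (?\<psi> \<circ> cls ?R)"
    using hom q by (intro continuous_map_compose) (auto dest: homeomorphic_imp_continuous_map quotient_imp_continuous_map)
  then have c: "continuous_map (coprod Y Z) Q ?\<psi>"
    by (simp add: o_def \<psi>)
  show "continuous_map Y Q \<alpha>"
    using continuous_map_compose[OF continuous_map_Inl c] by (simp add: o_def)
  show "continuous_map Z Q \<beta>"
    using continuous_map_compose[OF continuous_map_Inr c] by (simp add: o_def)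
  obtain \<theta> where \<theta>: "homeomorphic_maps (pushout B Y Z f g) Q ?\<psi> \<theta>"
    using hom homeomorphic_map_maps by blast
  fix W :: "'w topology" and F G
  assume F: "continuous_map Y W F" and G: "continuous_map Z W G"
    and FG: "\<And>b. b \<in> topspace B \<Longrightarrow> F (f b) = G (g b)"
  have FGc: "case_sum F G (cls ?R p) = case_sum F G p" for p
    by (rule cls_respects) (rule pushout_respects[where F = F and G = G and f = f and g = g, OF FG])
  have cont: "continuous_map (pushout B Y Z f g) W (case_sum F G)"
    unfolding pushout_def
    by (rule continuous_map_quotI[OF continuous_map_from_coprod[OF F G] pushout_respects[where F = F and G = G and f = f and g = g, OF FG]])
  have k: "(case_sum F G \<circ> \<theta>) (?\<psi> p) = case_sum F G p" if "p \<in> topspace (coprod Y Z)" for p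
  proof -
    have "cls ?R p \<in> topspace (pushout B Y Z f g)"
      using that quotient_imp_surjective_map[OF q] by blast
    then have "\<theta> (?\<psi> (cls ?R p)) = cls ?R p"
      using \<theta> by (simp add: homeomorphic_maps_def)
    then show ?thesis by (simp add: \<psi> FGc)
  qed
  show "\<exists>k. continuous_map Q W k \<and> (\<forall>y\<in>topspace Y. k (\<alpha> y) = F y) \<and> (\<forall>z\<in>topspace Z. k (\<beta> z) = G z)"
  proof (intro exI conjI ballI)
    show "continuous_map Q W (case_sum F G \<circ> \<theta>)"
      using \<theta> by (intro continuous_map_compose[OF _ cont]) (simp add: homeomorphic_maps_def)
    show "(case_sum F G \<circ> \<theta>) (\<alpha> y) = F y" if "y \<in> topspace Y" for y
      using k[of "Inl y"] that by (simp add: topspace_coprod)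
    show "(case_sum F G \<circ> \<theta>) (\<beta> y) = G y" if "y \<in> topspace Z" for y
      using k[of "Inr y"] that by (simp add: topspace_coprod)
  qed
qed

section \<open>The homotopy extension property\<close>

text \<open>
  Homotopy extension for the target \<open>Z\<close>, with homotopies written as maps into the path space.
\<close>

definition hep :: "'x topology \<Rightarrow> 'x set \<Rightarrow> 'z topology \<Rightarrow> bool" where
  "hep X A Z \<longleftrightarrow>
     (\<forall>f h. continuous_map X Z f \<and> continuous_map (subtopology X A) (path_space Z) h \<and>
            (\<forall>a\<in>topspace X \<inter> A. h a 0 = f a) \<longrightarrow>
        (\<exists>k. continuous_map X (path_space Z) k \<and> (\<forall>x\<in>topspace X. k x 0 = f x) \<and>
             (\<forall>a\<in>topspace X \<inter> A. k a = h a)))"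

text \<open>
  \<open>H\<close> moves \<open>x\<close> into \<open>A\<close> at time \<open>\<phi> x\<close> at the latest, and \<open>A\<close> stays fixed. Asking for
  \<open>H t x \<in> A\<close> already at time \<open>t = \<phi> x\<close>, and not only later, makes \<open>A\<close> the zero set of \<open>\<phi>\<close> and makes
  such structures easy to multiply.
\<close>

definition strom_structure :: "'x topology \<Rightarrow> 'x set \<Rightarrow> ('x \<Rightarrow> real) \<Rightarrow> (real \<Rightarrow> 'x \<Rightarrow> 'x) \<Rightarrow> bool" where
  "strom_structure X A \<phi> H \<longleftrightarrow>
     A \<subseteq> topspace X \<and> continuous_map X euclideanreal \<phi> \<and> (\<forall>x\<in>topspace X. 0 \<le> \<phi> x) \<and>
     continuous_map (prod_topology I01 X) X (\<lambda>(t, x). H t x) \<and>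
     (\<forall>x\<in>topspace X. H 0 x = x) \<and>
     (\<forall>a\<in>A. \<phi> a = 0 \<and> (\<forall>t\<in>{0..1}. H t a = a)) \<and>
     (\<forall>x\<in>topspace X. \<forall>t\<in>{0..1}. \<phi> x \<le> t \<longrightarrow> H t x \<in> A)"

text \<open>
  A point with \<open>\<phi> x = 0\<close> is in \<open>A\<close> at time \<open>0\<close>, before it has moved.
\<close>

lemma strom_closed:
  assumes "strom_structure X A \<phi> H"
  shows "closedin X A"
proof -
  have "A = {x \<in> topspace X. \<phi> x \<in> {..0}}"
  proof
    show "A \<subseteq> {x \<in> topspace X. \<phi> x \<in> {..0}}"
      using assms by (auto simp: strom_structure_def)
    show "{x \<in> topspace X. \<phi> x \<in> {..0}} \<subseteq> A"
    proof clarsimp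
      fix x assume x: "x \<in> topspace X" "\<phi> x \<le> 0"
      have "\<forall>x\<in>topspace X. \<forall>t\<in>{0..1}. \<phi> x \<le> t \<longrightarrow> H t x \<in> A" "\<forall>x\<in>topspace X. H 0 x = x"
        using assms unfolding strom_structure_def by blast+
      from bspec[OF bspec[OF this(1) x(1)], of 0] x this(2) show "x \<in> A" by simp
    qed
  qed
  moreover have "closedin X {x \<in> topspace X. \<phi> x \<in> {..0}}"
    using assms by (intro closedin_continuous_map_preimage[of _ euclideanreal]) (auto simp: strom_structure_def)
  ultimately show ?thesis by simp
qed

text \<open>
  Up to time \<open>\<phi> x\<close> the extended homotopy applies \<open>f\<close> to the moving point \<open>H t x\<close>. From then on \<open>H t x\<close> lies
  in \<open>A\<close>, and the remaining time \<open>t - \<phi> x\<close> is used for the homotopy \<open>h\<close>.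
\<close>

lemma strom_hep:
  fixes Z :: "'z topology"
  assumes S: "strom_structure X A \<phi> H"
  shows "hep X A Z"
  unfolding hep_def
proof (intro allI impI, elim conjE)
  fix f :: "'a \<Rightarrow> 'z" and h
  assume f: "continuous_map X Z f" and h: "continuous_map (subtopology X A) (path_space Z) h"
    and h0: "\<forall>a\<in>topspace X \<inter> A. h a 0 = f a"
  let ?Y = "prod_topology I01 X"
  have AX: "A \<subseteq> topspace X" and \<phi>: "continuous_map X euclideanreal \<phi>"
    and H: "continuous_map ?Y X (\<lambda>(t, x). H t x)"
    using S by (auto simp: strom_structure_def)
  have t: "continuous_map ?Y euclideanreal fst"
    using continuous_map_fst[of I01 X] by (simp add: continuous_map_into_I01)
  have \<phi>s: "continuous_map ?Y euclideanreal (\<lambda>p. \<phi> (snd p))"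
    using continuous_map_compose[OF continuous_map_snd \<phi>] by (simp add: o_def)
  have Hp: "continuous_map ?Y X (\<lambda>p. H (fst p) (snd p))"
    using H by (simp add: case_prod_unfold)
  have "continuous_map ?Y Z
    (\<lambda>p. if fst p \<le> \<phi> (snd p) then f (H (fst p) (snd p)) else h (H (fst p) (snd p)) (fst p - \<phi> (snd p)))"
  proof (rule continuous_map_cases_le[OF t \<phi>s])
    show "continuous_map (subtopology ?Y {p \<in> topspace ?Y. fst p \<le> \<phi> (snd p)}) Z (\<lambda>p. f (H (fst p) (snd p)))"
      using continuous_map_compose[OF Hp f] by (simp add: o_def continuous_map_from_subtopology)
    show "continuous_map (subtopology ?Y {p \<in> topspace ?Y. \<phi> (snd p) \<le> fst p}) Z
       (\<lambda>p. h (H (fst p) (snd p)) (fst p - \<phi> (snd p)))" (is "continuous_map ?S Z _")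
    proof (rule continuous_map_path_eval)
      have "continuous_map ?S (subtopology X A) (\<lambda>p. H (fst p) (snd p))"
        using S by (auto simp: continuous_map_in_subtopology strom_structure_def
            intro!: continuous_map_from_subtopology[OF Hp])
      from continuous_map_compose[OF this h]
      show "continuous_map ?S (path_space Z) (\<lambda>p. h (H (fst p) (snd p)))"
        by (simp add: o_def)
      show "continuous_map ?S I01 (\<lambda>p. fst p - \<phi> (snd p))"
        unfolding continuous_map_into_I01
      proof (intro conjI ballI)
        show "continuous_map ?S euclideanreal (\<lambda>p. fst p - \<phi> (snd p))"
          by (intro continuous_intros continuous_map_from_subtopology t \<phi>s)
        show "0 \<le> fst p - \<phi> (snd p)" if "p \<in> topspace ?S" for p using that by auto
        show "fst p - \<phi> (snd p) \<le> 1" if p: "p \<in> topspace ?S" for p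
        proof -
          have "0 \<le> \<phi> (snd p)" "fst p \<le> 1" using p S by (auto simp: strom_structure_def)
          then show ?thesis by simp
        qed
      qed
    qed
    show "f (H (fst p) (snd p)) = h (H (fst p) (snd p)) (fst p - \<phi> (snd p))"
      if "p \<in> topspace ?Y" "fst p = \<phi> (snd p)" for p
    proof -
      have "H (fst p) (snd p) \<in> A" using that S by (auto simp: strom_structure_def)
      then show ?thesis using h0 AX that(2) by auto
    qed
  qed
  from continuous_map_curry[OF this]
  have k: "continuous_map X (path_space Z)
     (\<lambda>x. \<lambda>t\<in>{0..1}. if t \<le> \<phi> x then f (H t x) else h (H t x) (t - \<phi> x))" (is "continuous_map _ _ ?k")
    by (simp cong: if_cong)
  show "\<exists>k. continuous_map X (path_space Z) k \<and> (\<forall>x\<in>topspace X. k x 0 = f x) \<and>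
             (\<forall>a\<in>topspace X \<inter> A. k a = h a)"
  proof (intro exI[of _ ?k] conjI ballI k)
    show "?k x 0 = f x" if "x \<in> topspace X" for x
      using S that by (auto simp: strom_structure_def)
    show "?k a = h a" if a: "a \<in> topspace X \<inter> A" for a
    proof (rule paths_ext[of _ Z])
      show "?k a \<in> paths Z" using continuous_map_funspace[OF k] a by auto
      show "h a \<in> paths Z" using continuous_map_funspace[OF h] a by auto
      show "?k a t = h a t" if "t \<in> {0..1}" for t
      proof (cases "t = 0")
        case True
        then show ?thesis using S a h0 that by (auto simp: strom_structure_def)
      next
        case False
        then show ?thesis using S a h0 that by (auto simp: strom_structure_def)
      qed
    qed
  qed
qed

text \<open>
  The sets where the supremum is less than \<open>a\<close> are open since projection along the compact interval
  is a closed map, those where it is greater since projections are open.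
\<close>

lemma continuous_map_Sup_I01:
  assumes g: "continuous_map (prod_topology I01 X) euclideanreal g"
  shows "continuous_map X euclideanreal (\<lambda>x. Sup ((\<lambda>t. g (t, x)) ` {0..1}))"
    and "\<And>t x. t \<in> {0..1} \<Longrightarrow> x \<in> topspace X \<Longrightarrow> g (t, x) \<le> Sup ((\<lambda>t. g (t, x)) ` {0..1})"
proof -
  let ?s = "\<lambda>x. Sup ((\<lambda>t. g (t, x)) ` {0..1})"
  have con: "continuous_on {0..1} (\<lambda>t. g (t, x))" if "x \<in> topspace X" for x
  proof -
    have "continuous_map I01 euclideanreal (g \<circ> (\<lambda>t. (t, x)))"
      by (rule continuous_map_compose[OF _ g]) (simp add: continuous_map_paired that)
    then show ?thesis by (simp add: o_def)
  qed
  have com: "compact ((\<lambda>t. g (t, x)) ` {0..1})" if "x \<in> topspace X" for x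
    by (rule compact_continuous_image[OF con[OF that]]) simp
  show ub: "g (t, x) \<le> ?s x" if "t \<in> {0..1}" "x \<in> topspace X" for t x
    using com[OF that(2)] that(1) by (intro cSup_upper) (auto intro: bounded_imp_bdd_above compact_imp_bounded)
  have att: "\<exists>t\<in>{0..1}. ?s x = g (t, x)" if x: "x \<in> topspace X" for x
  proof -
    have "?s x \<in> (\<lambda>t. g (t, x)) ` {0..1}"
      by (rule closed_contains_Sup)
        (use com[OF x] in \<open>auto intro: bounded_imp_bdd_above compact_imp_bounded compact_imp_closed\<close>)
    then show ?thesis by auto
  qed
  show "continuous_map X euclideanreal ?s"
    unfolding continuous_map_upper_lower_semicontinuous_lt
  proof (intro conjI allI)
    fix a
    have "{x \<in> topspace X. a < ?s x} = snd ` {p \<in> topspace (prod_topology I01 X). g p \<in> {a<..}}"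
      using att ub by (fastforce simp: image_iff intro: less_le_trans)
    moreover have "openin (prod_topology I01 X) {p \<in> topspace (prod_topology I01 X). g p \<in> {a<..}}"
      using g by (rule openin_continuous_map_preimage) auto
    ultimately show "openin X {x \<in> topspace X. a < ?s x}"
      using open_map_snd[of I01 X] unfolding open_map_def by simp
    have "?s x < a \<longleftrightarrow> (\<forall>t\<in>{0..1}. g (t, x) < a)" if "x \<in> topspace X" for x
      using att[OF that] ub[OF _ that] by (metis le_less_trans)
    then have "{x \<in> topspace X. ?s x < a} = topspace X - {x \<in> topspace X. \<exists>t\<in>{0..1}. a \<le> g (t, x)}"
      unfolding set_eq_iff Diff_iff mem_Collect_eq not_le[symmetric] by blast
    also have "{x \<in> topspace X. \<exists>t\<in>{0..1}. a \<le> g (t, x)} =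
        snd ` {p \<in> topspace (prod_topology I01 X). g p \<in> {a..}}"
      by (auto simp: image_iff)
    finally have "{x \<in> topspace X. ?s x < a} =
        topspace X - snd ` {p \<in> topspace (prod_topology I01 X). g p \<in> {a..}}" .
    moreover have "closedin (prod_topology I01 X) {p \<in> topspace (prod_topology I01 X). g p \<in> {a..}}"
      using g by (rule closedin_continuous_map_preimage) auto
    moreover have "closed_map (prod_topology I01 X) X snd"
      by (rule closed_map_snd) (simp add: compact_space_subtopology)
    ultimately show "openin X {x \<in> topspace X. ?s x < a}"
      unfolding closed_map_def by (simp add: openin_diff)
  qed
qed

text \<open>
  Extending the homotopy \<open>t \<mapsto> (t, a)\<close> yields a retraction of the cylinder onto its base together with
  the cylinder over \<open>A\<close>. Let \<open>b\<close> be its first component and \<open>H\<close> its second. At a time when \<open>b > 0\<close> the point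
  \<open>H t x\<close> is in \<open>A\<close>, and this holds if \<open>t\<close> exceeds the supremum \<open>s x\<close> of \<open>t - b\<close>. The function \<open>\<phi>\<close> is
  \<open>2 * s\<close>: if \<open>s x > 0\<close>, then \<open>t \<ge> 2 * s x\<close> implies \<open>t > s x\<close>.
\<close>

lemma hep_imp_strom:
  assumes A: "closedin X A"
    and hep: "hep X A (subtopology (prod_topology I01 X) ({0} \<times> topspace X \<union> {0..1} \<times> A))"
  shows "\<exists>\<phi> H. strom_structure X A \<phi> H"
proof -
  let ?P = "prod_topology I01 X"
  let ?Z = "subtopology ?P ({0} \<times> topspace X \<union> {0..1} \<times> A)"
  have AX: "A \<subseteq> topspace X" using A by (rule closedin_subset)
  have f: "continuous_map X ?Z (\<lambda>x. (0, x))"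
    by (auto simp: continuous_map_in_subtopology continuous_map_paired)
  have "continuous_map (prod_topology I01 (subtopology X A)) ?Z (\<lambda>p. p)"
    unfolding continuous_map_in_subtopology
    using continuous_map_from_subtopology[OF continuous_map_id[of ?P], of "UNIV \<times> A"]
    by (auto simp: prod_topology_subtopology subtopology_subtopology id_def Times_Int_Times intro: continuous_map_from_subtopology)
  from continuous_map_curry[OF this]
  have h: "continuous_map (subtopology X A) (path_space ?Z) (\<lambda>a. \<lambda>t\<in>{0..1}. (t, a))" .
  obtain k where k: "continuous_map X (path_space ?Z) k" and k0: "\<And>x. x \<in> topspace X \<Longrightarrow> k x 0 = (0, x)"
    and kA: "\<And>a. a \<in> A \<Longrightarrow> k a = (\<lambda>t\<in>{0..1}. (t, a))"
    using hep[unfolded hep_def, rule_format, of "\<lambda>x. (0, x)" "\<lambda>a. \<lambda>t\<in>{0..1}. (t, a)"] f h AX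
    by (auto simp: subset_iff)
  have u: "continuous_map ?P ?Z (\<lambda>(t, x). k x t)"
    by (rule continuous_map_uncurry[OF k])
  then have uP: "continuous_map ?P ?P (\<lambda>p. k (snd p) (fst p))"
    by (simp add: continuous_map_in_subtopology case_prod_unfold)
  have kin: "k x t \<in> {0..1} \<times> topspace X \<and> (fst (k x t) = 0 \<or> snd (k x t) \<in> A)"
    if "x \<in> topspace X" "t \<in> {0..1}" for x t
  proof -
    have "(\<lambda>(t, x). k x t) (t, x) \<in> topspace ?Z"
      using that by (intro funcset_mem[OF continuous_map_funspace[OF u]]) auto
    then show ?thesis by (cases "k x t") auto
  qed
  have b: "continuous_map ?P euclideanreal (\<lambda>p. fst (k (snd p) (fst p)))"
    using continuous_map_compose[OF uP continuous_map_fst] by (simp add: o_def continuous_map_into_I01)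
  have H: "continuous_map ?P X (\<lambda>(t, x). snd (k x t))"
    using continuous_map_compose[OF uP continuous_map_snd] by (simp add: o_def case_prod_unfold)
  have t: "continuous_map ?P euclideanreal fst"
    using continuous_map_fst[of I01 X] by (simp add: continuous_map_into_I01)
  define g where "g = (\<lambda>p. fst p - fst (k (snd p) (fst p)))"
  have g: "continuous_map ?P euclideanreal g"
    unfolding g_def by (intro continuous_intros t b)
  define s where "s = (\<lambda>x. Sup ((\<lambda>t. g (t, x)) ` {0..1}))"
  have s: "continuous_map X euclideanreal s"
    and gs: "\<And>t x. t \<in> {0..1} \<Longrightarrow> x \<in> topspace X \<Longrightarrow> t - fst (k x t) \<le> s x"
    using continuous_map_Sup_I01[OF g] by (auto simp: s_def g_def)
  have s0: "0 \<le> s x" if "x \<in> topspace X" for x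
    using gs[of 0 x] that k0 by simp
  have sA: "s a = 0" if "a \<in> A" for a
  proof -
    have "(\<lambda>t. g (t, a)) ` {0..1} = {0}"
      using kA[OF that] by (auto simp: g_def image_iff intro!: exI[of _ 0])
    then show ?thesis by (simp add: s_def)
  qed
  have pos: "snd (k x t) \<in> A" if "x \<in> topspace X" "t \<in> {0..1}" "s x < t" for x t
    using gs[OF that(2,1)] kin[OF that(1,2)] that(3) by auto
  have zero: "x \<in> A" if x: "x \<in> topspace X" and s: "s x = 0" for x
  proof (rule ccontr)
    assume "x \<notin> A"
    \<comment> \<open>The path of \<open>x\<close> lies in the closed set \<open>A\<close> at all positive times, hence at time \<open>0\<close>.\<close>
    have c: "continuous_map I01 X (\<lambda>t. snd (k x t))"
      using continuous_map_compose[OF _ H, of I01 "\<lambda>t. (t, x)"] x by (simp add: continuous_map_paired o_def)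
    have "openin I01 {t \<in> topspace I01. snd (k x t) \<in> topspace X - A}"
      using A by (intro openin_continuous_map_preimage[OF c]) auto
    then obtain V where V: "open V" "{t \<in> {0..1}. snd (k x t) \<in> topspace X - A} = {0..1} \<inter> V"
      by (auto simp: openin_open)
    have "0 \<in> {t \<in> {0..1::real}. snd (k x t) \<in> topspace X - A}"
      using x k0 \<open>x \<notin> A\<close> by simp
    then have "0 \<in> V" using V by blast
    then obtain r where r: "r > 0" "ball 0 r \<subseteq> V"
      using V(1) open_contains_ball by blast
    let ?t = "min 1 (r / 2)"
    have "?t \<in> {0..1} \<inter> V" using r by (auto simp: subset_iff dist_real_def)
    then have "snd (k x ?t) \<notin> A" using V(2) by blast
    moreover have "snd (k x ?t) \<in> A" using r s by (intro pos[OF x]) auto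
    ultimately show False by simp
  qed
  have "strom_structure X A (\<lambda>x. 2 * s x) (\<lambda>t x. snd (k x t))"
    unfolding strom_structure_def
  proof (intro conjI ballI impI)
    show "continuous_map X euclideanreal (\<lambda>x. 2 * s x)"
      by (intro continuous_intros s)
    show "snd (k x t) \<in> A" if x: "x \<in> topspace X" and t: "t \<in> {0..1}" and le: "2 * s x \<le> t" for x t
    proof (cases "s x = 0")
      case True
      then have "x \<in> A" using zero x by blast
      then show ?thesis using kA t by simp
    next
      case False
      then show ?thesis using s0[OF x] le by (intro pos[OF x t]) auto
    qed
  qed (use AX s0 sA H k0 kA in auto)
  then show ?thesis by blast
qed

section \<open>Relative CW-complexes\<close>

lemma topspace_disc: "topspace (disc n) = {x. (\<forall>i\<ge>n. x i = 0) \<and> (\<Sum>i<n. x i ^ 2) \<le> 1}"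
  by (auto simp: disc_def topspace_Euclidean_space)

lemma topspace_disc_boundary:
  "topspace (disc_boundary n) = {x. (\<forall>i\<ge>n. x i = 0) \<and> (\<Sum>i<n. x i ^ 2) = 1}"
  by (auto simp: disc_boundary_def topspace_Euclidean_space)

lemma disc_boundary_subtopology:
  "disc_boundary n = subtopology (disc n) (topspace (disc_boundary n))"
proof -
  have "topspace (disc_boundary n) = topspace (Euclidean_space n) \<inter> {x. (\<Sum>i<n. x i ^ 2) = 1}"
    by (auto simp: topspace_disc_boundary topspace_Euclidean_space)
  then have "subtopology (disc n) (topspace (disc_boundary n)) = subtopology (Euclidean_space n)
      (topspace (Euclidean_space n) \<inter> ({x. (\<Sum>i<n. x i ^ 2) \<le> 1} \<inter> {x. (\<Sum>i<n. x i ^ 2) = 1}))"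
    by (simp add: disc_def subtopology_subtopology Int_ac)
  also have "{x. (\<Sum>i<n. x i ^ 2) \<le> 1} \<inter> {x. (\<Sum>i<n. x i ^ 2) = 1} = {x. (\<Sum>i<n. x i ^ 2) = (1::real)}"
    by auto
  finally have eq: "subtopology (disc n) (topspace (disc_boundary n)) = subtopology (Euclidean_space n)
      (topspace (Euclidean_space n) \<inter> {x. (\<Sum>i<n. x i ^ 2) = 1})" .
  show ?thesis
    unfolding eq subtopology_restrict by (rule disc_boundary_def)
qed

lemma continuous_map_disc_coordinate: "continuous_map (disc n) euclideanreal (\<lambda>x. x i)"
  unfolding disc_def Euclidean_space_def
  by (intro continuous_map_from_subtopology continuous_map_product_coordinates) simp

text \<open>
  Points are pushed outwards along rays: at time \<open>t\<close> a point of norm \<open>r\<close> is divided by the maximum of \<open>r\<close>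
  and \<open>1 - t/2\<close>, so it arrives on the sphere at time \<open>2 * (1 - r)\<close>. The denominator is at least \<open>1/2\<close>.
\<close>

lemma disc_strom:
  "\<exists>\<phi> H. strom_structure (disc n) (topspace (disc_boundary n)) \<phi> H"
proof -
  define r where "r = (\<lambda>x :: nat \<Rightarrow> real. sqrt (\<Sum>i<n. x i ^ 2))"
  let ?H = "\<lambda>t x. (\<lambda>i. x i / max (r x) (1 - t / 2))"
  let ?P = "prod_topology I01 (disc n)"
  have rc: "continuous_map (disc n) euclideanreal r"
  proof -
    have "continuous_map (disc n) euclideanreal (sqrt \<circ> (\<lambda>x. \<Sum>i<n. x i ^ 2))"
      by (rule continuous_map_compose[where X' = euclideanreal])
        (auto intro!: continuous_intros continuous_map_disc_coordinate continuous_on_real_sqrt)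
    then show ?thesis by (simp add: r_def o_def)
  qed
  have r01: "0 \<le> r x" "r x \<le> 1" if "x \<in> topspace (disc n)" for x
    using that by (auto simp: r_def topspace_disc sum_nonneg)
  have r1: "r x = 1 \<longleftrightarrow> (\<Sum>i<n. x i ^ 2) = 1" for x
    by (simp add: r_def)
  have rsum: "(\<Sum>i<n. x i ^ 2) = r x ^ 2" for x
    by (simp add: r_def sum_nonneg)
  have sumH: "(\<Sum>i<n. (x i / d) ^ 2) = (r x / d) ^ 2" for x d
    by (simp add: rsum power_divide flip: sum_divide_distrib)
  have H: "continuous_map ?P (disc n) (\<lambda>(t, x). ?H t x)"
  proof -
    have x: "continuous_map ?P euclideanreal (\<lambda>p. snd p i)" for i
      using continuous_map_compose[OF continuous_map_snd continuous_map_disc_coordinate, of I01] by (simp add: o_def)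
    have rp: "continuous_map ?P euclideanreal (\<lambda>p. r (snd p))"
      using continuous_map_compose[OF continuous_map_snd rc, of I01] by (simp add: o_def)
    have t: "continuous_map ?P euclideanreal fst"
      using continuous_map_fst[of I01 "disc n"] by (simp add: continuous_map_into_I01)
    have pos: "max (r (snd p)) (1 - fst p / 2) > 0" if "p \<in> topspace ?P" for p
      using that by auto
    have "continuous_map ?P euclideanreal (\<lambda>p. snd p i / max (r (snd p)) (1 - fst p / 2))" for i
      by (intro continuous_intros x rp t) (use pos in fastforce)+
    then have "continuous_map ?P (powertop_real UNIV) (\<lambda>p. ?H (fst p) (snd p))"
      by (simp add: continuous_map_componentwise_UNIV)
    moreover have "(\<Sum>i<n. (?H (fst p) (snd p) i) ^ 2) \<le> 1" if "p \<in> topspace ?P" for p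
    proof -
      have "0 \<le> r (snd p) / max (r (snd p)) (1 - fst p / 2)" "r (snd p) / max (r (snd p)) (1 - fst p / 2) \<le> 1"
        using pos[OF that] that r01 by (auto simp: field_simps)
      then show ?thesis
        unfolding sumH by (simp add: power_le_one)
    qed
    ultimately show ?thesis
      by (auto simp: disc_def Euclidean_space_def continuous_map_in_subtopology case_prod_unfold)
  qed
  have "strom_structure (disc n) (topspace (disc_boundary n)) (\<lambda>x. 2 * (1 - r x)) ?H"
    unfolding strom_structure_def
  proof (intro conjI ballI impI)
    show "topspace (disc_boundary n) \<subseteq> topspace (disc n)"
      by (auto simp: topspace_disc topspace_disc_boundary)
    show "continuous_map (disc n) euclideanreal (\<lambda>x. 2 * (1 - r x))"
      by (intro continuous_intros rc)
    show "0 \<le> 2 * (1 - r x)" if "x \<in> topspace (disc n)" for x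
      using r01[OF that] by simp
    show "?H 0 x = x" if "x \<in> topspace (disc n)" for x
      using r01[OF that] by (simp add: max_absorb2)
    show "2 * (1 - r a) = 0" if "a \<in> topspace (disc_boundary n)" for a
      using that by (simp add: topspace_disc_boundary r1)
    show "?H t a = a" if "a \<in> topspace (disc_boundary n)" "t \<in> {0..1}" for a t
    proof -
      have "r a = 1" using that by (simp add: topspace_disc_boundary r1)
      then show ?thesis using that by (simp add: max_absorb1)
    qed
    show "?H t x \<in> topspace (disc_boundary n)"
      if x: "x \<in> topspace (disc n)" and t: "t \<in> {0..1}" and le: "2 * (1 - r x) \<le> t" for x t
    proof -
      have m: "max (r x) (1 - t / 2) = r x" and "r x > 0" using t le by (auto simp: max_def)
      then have "(\<Sum>i<n. (?H t x i) ^ 2) = 1" unfolding sumH by simp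
      then show ?thesis using x by (auto simp: topspace_disc topspace_disc_boundary)
    qed
  qed (rule H)
  then show ?thesis by blast
qed

text \<open>
  The homotopy is extended over one skeleton after the other, cell by cell, and the union of the
  extensions is continuous by the weak topology. A skeleton is closed in the next one because it is
  the zero set of the function that is \<open>1 - |z|\<^sup>2\<close> on the cells.
\<close>

lemma relative_CW_complex_hep:
  fixes Z :: "'z topology"
  assumes "relative_CW_complex X A"
  shows "closedin X A" and "hep X A Z"
proof -
  obtain Sk \<Phi> where all: "Sk 0 = A \<and> (\<forall>n. Sk n \<subseteq> Sk (Suc n)) \<and> (\<Union>n. Sk n) = topspace X \<and>
       (\<forall>n. \<forall>\<phi> \<in> \<Phi> n. continuous_map (disc_boundary n) (subtopology X (Sk n)) \<phi>) \<and>
       (\<forall>n. homeomorphic_map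
              (pushout (sum_topology (\<lambda>_. disc_boundary n) (\<Phi> n))
                       (sum_topology (\<lambda>_. disc n) (\<Phi> n)) (subtopology X (Sk n))
                       (\<lambda>z. z) (\<lambda>(\<phi>, z). \<phi> z))
              (subtopology X (Sk (Suc n)))
              (case_sum (\<lambda>(\<phi>, z). \<phi> z) (\<lambda>x. x))) \<and>
       (\<forall>U \<subseteq> topspace X.
          openin X U \<longleftrightarrow> (\<forall>n. openin (subtopology X (Sk n)) (U \<inter> Sk n)))"
    using assms unfolding relative_CW_complex_def by (elim exE) (erule that)
  note Sk0 = all[THEN conjunct1] and all = all[THEN conjunct2]
  note mono = all[THEN conjunct1, THEN spec] and all = all[THEN conjunct2]
  note Un = all[THEN conjunct1] and all = all[THEN conjunct2]
  note att = all[THEN conjunct1, THEN spec, THEN bspec] and all = all[THEN conjunct2]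
  note hom = all[THEN conjunct1, THEN spec] and weak = all[THEN conjunct2, THEN spec, THEN mp]
  have SkX: "Sk n \<subseteq> topspace X" for n unfolding Un[symmetric] by blast
  have tsk: "topspace (subtopology X (Sk n)) = Sk n" for n
    using SkX[of n] by (simp add: Int_absorb1)
  have Sk_mono: "Sk n \<subseteq> Sk k" if "n \<le> k" for n k
    using that mono by (metis lift_Suc_mono_le)
  note lift = homeomorphic_pushout_lift[OF hom, simplified]
  have cell: "continuous_map (disc n) (subtopology X (Sk (Suc n))) \<phi>" if "\<phi> \<in> \<Phi> n" for n \<phi>
    using continuous_map_compose[OF continuous_map_component_injection[OF that] lift(2)[of n]]
    by (auto simp: o_def)
  have pts: "Sk (Suc n) = (\<lambda>(\<phi>, z). \<phi> z) ` (\<Phi> n \<times> topspace (disc n)) \<union> Sk n" for n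
    using lift(1)[of n] by (simp add: Int_absorb1 SkX)
  have clS: "closedin (subtopology X (Sk (Suc n))) (Sk n)" for n
  proof -
    have "\<exists>k. continuous_map (subtopology X (Sk (Suc n))) euclideanreal k \<and>
        (\<forall>y\<in>topspace (sum_topology (\<lambda>_. disc n) (\<Phi> n)). k ((\<lambda>(\<phi>, z). \<phi> z) y) = (\<lambda>(\<phi>, z). 1 - (\<Sum>i<n. z i ^ 2)) y) \<and>
        (\<forall>z\<in>topspace (subtopology X (Sk n)). k z = 0)"
    proof (rule homeomorphic_pushout_lift(4)[OF hom])
      show "continuous_map (sum_topology (\<lambda>_. disc n) (\<Phi> n)) euclideanreal (\<lambda>(\<phi>, z). 1 - (\<Sum>i<n. z i ^ 2))"
        by (rule continuous_map_from_sum) (auto intro!: continuous_intros continuous_map_disc_coordinate)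
    qed (auto simp: topspace_disc_boundary)
    then obtain k where k: "continuous_map (subtopology X (Sk (Suc n))) euclideanreal k"
      and k1': "\<forall>y\<in>topspace (sum_topology (\<lambda>_. disc n) (\<Phi> n)).
        k ((\<lambda>(\<phi>, z). \<phi> z) y) = (\<lambda>(\<phi>, z). 1 - (\<Sum>i<n. z i ^ 2)) y"
      and k2': "\<forall>z\<in>topspace (subtopology X (Sk n)). k z = 0"
      by (elim exE conjE) (erule (2) that)
    have k1: "k (\<phi> z) = 1 - (\<Sum>i<n. z i ^ 2)" if "\<phi> \<in> \<Phi> n" "z \<in> topspace (disc n)" for \<phi> z
      using bspec[OF k1', of "(\<phi>, z)"] that by simp
    have k2: "k z = 0" if "z \<in> Sk n" for z
      using k2' that SkX[of n] by auto
    have "Sk n = {x \<in> topspace (subtopology X (Sk (Suc n))). k x \<in> {0}}"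
    proof
      show "Sk n \<subseteq> {x \<in> topspace (subtopology X (Sk (Suc n))). k x \<in> {0}}"
        using k2 mono[of n] SkX[of n] by auto
      show "{x \<in> topspace (subtopology X (Sk (Suc n))). k x \<in> {0}} \<subseteq> Sk n"
      proof clarsimp
        fix x assume x: "x \<in> Sk (Suc n)" "k x = 0"
        show "x \<in> Sk n"
        proof (rule ccontr)
          assume "x \<notin> Sk n"
          then obtain \<phi> z where z: "\<phi> \<in> \<Phi> n" "z \<in> topspace (disc n)" "x = \<phi> z"
            using x(1) unfolding pts by auto
          then have "z \<in> topspace (disc_boundary n)"
            using k1[OF z(1,2)] x(2) by (auto simp: topspace_disc topspace_disc_boundary)
          then have "x \<in> Sk n"
            using continuous_map_funspace[OF att[OF z(1)]] z(3) by auto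
          then show False using \<open>x \<notin> Sk n\<close> by simp
        qed
      qed
    qed
    moreover have "closedin (subtopology X (Sk (Suc n))) {x \<in> topspace (subtopology X (Sk (Suc n))). k x \<in> {0}}"
      by (rule closedin_continuous_map_preimage[OF k]) simp
    ultimately show ?thesis by simp
  qed
  have AS: "A \<subseteq> Sk n" for n using Sk_mono[of 0 n] Sk0 by simp
  have clA: "closedin (subtopology X (Sk n)) A" for n
  proof (induction n)
    case 0
    show ?case using Sk0 SkX[of 0] by (metis closedin_topspace tsk)
  next
    case (Suc n)
    have "subtopology (subtopology X (Sk (Suc n))) (Sk n) = subtopology X (Sk n)"
      using mono by (simp add: subtopology_subtopology Int_absorb1)
    then show ?case using Suc clS closedin_trans_full by metis
  qed
  have "openin (subtopology X (Sk n)) ((topspace X - A) \<inter> Sk n)" for n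
  proof -
    have "(topspace X - A) \<inter> Sk n = topspace (subtopology X (Sk n)) - A" using SkX by auto
    then show ?thesis using clA by (metis openin_diff openin_topspace)
  qed
  then have "openin X (topspace X - A)" using weak[of "topspace X - A"] by blast
  then show "closedin X A" using AS[of 0] SkX[of 0] by (auto simp: closedin_def)
  show "hep X A Z"
    unfolding hep_def
  proof (intro allI impI, elim conjE)
    fix f :: "'a \<Rightarrow> 'z" and h
    assume f: "continuous_map X Z f" and h: "continuous_map (subtopology X A) (path_space Z) h"
      and h0: "\<forall>a\<in>topspace X \<inter> A. h a 0 = f a"
    let ?P = "\<lambda>n k. continuous_map (subtopology X (Sk n)) (path_space Z) k \<and> (\<forall>x\<in>Sk n. k x 0 = f x)
       \<and> (\<forall>a\<in>A. k a = h a)"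
    have "\<exists>K. \<forall>n. ?P n (K n) \<and> (\<forall>x\<in>Sk n. K (Suc n) x = K n x)"
    proof (rule dependent_nat_choice)
      show "\<exists>k. ?P 0 k" using h h0 Sk0 SkX[of 0] by (intro exI[of _ h]) auto
      fix k n assume k: "?P n k"
      have ex: "\<exists>l. continuous_map (disc n) (path_space Z) l \<and> (\<forall>z\<in>topspace (disc n). l z 0 = f (\<phi> z)) \<and>
             (\<forall>z\<in>topspace (disc n) \<inter> topspace (disc_boundary n). l z = k (\<phi> z))" if \<phi>: "\<phi> \<in> \<Phi> n" for \<phi>
      proof -
        have "hep (disc n) (topspace (disc_boundary n)) Z"
          using disc_strom strom_hep by blast
        moreover have "continuous_map (disc n) Z (f \<circ> \<phi>)"
          using cell[OF \<phi>] f by (intro continuous_map_compose) (auto simp: continuous_map_in_subtopology)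
        moreover have "continuous_map (disc_boundary n) (path_space Z) (k \<circ> \<phi>)"
          using att[OF \<phi>] k by (intro continuous_map_compose) auto
        moreover have "k (\<phi> z) 0 = f (\<phi> z)" if "z \<in> topspace (disc_boundary n)" for z
          using k continuous_map_funspace[OF att[OF \<phi>]] that by auto
        ultimately show ?thesis
          unfolding hep_def disc_boundary_subtopology[symmetric]
          by (elim allE[of _ "f \<circ> \<phi>"] allE[of _ "k \<circ> \<phi>"]) auto
      qed
      define L where "L = (\<lambda>\<phi>. SOME l. continuous_map (disc n) (path_space Z) l \<and>
             (\<forall>z\<in>topspace (disc n). l z 0 = f (\<phi> z)) \<and>
             (\<forall>z\<in>topspace (disc n) \<inter> topspace (disc_boundary n). l z = k (\<phi> z)))"
      have L: "continuous_map (disc n) (path_space Z) (L \<phi>) \<and>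
             (\<forall>z\<in>topspace (disc n). L \<phi> z 0 = f (\<phi> z)) \<and>
             (\<forall>z\<in>topspace (disc n) \<inter> topspace (disc_boundary n). L \<phi> z = k (\<phi> z))"
        if "\<phi> \<in> \<Phi> n" for \<phi>
        unfolding L_def by (rule someI_ex[OF ex[OF that]])
      have "\<exists>k'. continuous_map (subtopology X (Sk (Suc n))) (path_space Z) k' \<and>
        (\<forall>y\<in>topspace (sum_topology (\<lambda>_. disc n) (\<Phi> n)). k' ((\<lambda>(\<phi>, z). \<phi> z) y) = (\<lambda>(\<phi>, z). L \<phi> z) y) \<and>
        (\<forall>z\<in>topspace (subtopology X (Sk n)). k' z = k z)"
      proof (rule homeomorphic_pushout_lift(4)[OF hom])
        show "continuous_map (sum_topology (\<lambda>_. disc n) (\<Phi> n)) (path_space Z) (\<lambda>(\<phi>, z). L \<phi> z)"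
          by (rule continuous_map_from_sum) (simp add: L)
        show "continuous_map (subtopology X (Sk n)) (path_space Z) k" using k by blast
      qed (use L in \<open>auto simp: topspace_disc topspace_disc_boundary\<close>)
      then obtain k' where k': "continuous_map (subtopology X (Sk (Suc n))) (path_space Z) k'"
        and c1: "\<forall>y\<in>topspace (sum_topology (\<lambda>_. disc n) (\<Phi> n)).
          k' ((\<lambda>(\<phi>, z). \<phi> z) y) = (\<lambda>(\<phi>, z). L \<phi> z) y"
        and c2: "\<forall>z\<in>topspace (subtopology X (Sk n)). k' z = k z"
        by (elim exE conjE) (erule (2) that)
      have 1: "k' (\<phi> z) = L \<phi> z" if "\<phi> \<in> \<Phi> n" "z \<in> topspace (disc n)" for \<phi> z
        using bspec[OF c1, of "(\<phi>, z)"] that by simp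
      have 2: "k' z = k z" if "z \<in> Sk n" for z
        using c2 that SkX[of n] by auto
      have "k' x 0 = f x" if "x \<in> Sk (Suc n)" for x
        using that 1 2 L k unfolding pts by auto
      then show "\<exists>k'. ?P (Suc n) k' \<and> (\<forall>x\<in>Sk n. k' x = k x)"
        using k' 2 k AS[of n] by (intro exI[of _ k']) auto
    qed
    then obtain K where K: "\<And>n. ?P n (K n)" and KS: "\<And>n x. x \<in> Sk n \<Longrightarrow> K (Suc n) x = K n x"
      by blast
    have Kle: "K (n + d) x = K n x" if "x \<in> Sk n" for n d x
      by (induction d) (use that KS Sk_mono[of n] in \<open>auto simp: subset_iff\<close>)
    define k where "k = (\<lambda>x. K (LEAST n. x \<in> Sk n) x)"
    have kK: "k x = K n x" if "x \<in> Sk n" for n x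
    proof -
      have "x \<in> Sk (LEAST n. x \<in> Sk n)" "(LEAST n. x \<in> Sk n) \<le> n"
        using that by (auto intro: LeastI Least_le)
      then show ?thesis using Kle[of x "LEAST n. x \<in> Sk n" "n - (LEAST n. x \<in> Sk n)"] by (simp add: k_def)
    qed
    have kc: "continuous_map X (path_space Z) k"
      unfolding continuous_map_def
    proof (intro conjI allI impI)
      show "k \<in> topspace X \<rightarrow> topspace (path_space Z)"
      proof
        fix x assume "x \<in> topspace X"
        then obtain n where n: "x \<in> Sk n" using Un by blast
        have "K n x \<in> topspace (path_space Z)"
          using continuous_map_funspace[OF conjunct1[OF K]] n tsk by blast
        then show "k x \<in> topspace (path_space Z)" using kK[OF n] by simp
      qed
      fix U assume U: "openin (path_space Z) U"
      have "openin (subtopology X (Sk n)) ({x \<in> topspace X. k x \<in> U} \<inter> Sk n)" for n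
      proof -
        have "{x \<in> topspace X. k x \<in> U} \<inter> Sk n = {x \<in> topspace (subtopology X (Sk n)). K n x \<in> U}"
          using kK SkX by auto
        then show ?thesis using openin_continuous_map_preimage[OF conjunct1[OF K] U] by metis
      qed
      then show "openin X {x \<in> topspace X. k x \<in> U}" by (subst weak) auto
    qed
    have k0: "k x 0 = f x" if x: "x \<in> topspace X" for x
    proof -
      obtain n where n: "x \<in> Sk n" using x[folded Un] by blast
      show ?thesis unfolding kK[OF n] by (rule bspec[OF conjunct1[OF conjunct2[OF K[of n]]] n])
    qed
    have kA: "k a = h a" if "a \<in> topspace X \<inter> A" for a
    proof -
      have a: "a \<in> A" "a \<in> Sk 0" using that AS by blast+
      show ?thesis unfolding kK[OF a(2)] by (rule bspec[OF conjunct2[OF conjunct2[OF K[of 0]]] a(1)])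
    qed
    show "\<exists>k. continuous_map X (path_space Z) k \<and> (\<forall>x\<in>topspace X. k x 0 = f x) \<and>
             (\<forall>a\<in>topspace X \<inter> A. k a = h a)"
      by (intro exI[of _ k] conjI ballI kc k0 kA)
  qed
qed

lemma relative_CW_complex_strom:
  assumes "relative_CW_complex X A"
  shows "\<exists>\<phi> H. strom_structure X A \<phi> H"
  using relative_CW_complex_hep[OF assms] by (rule hep_imp_strom)

section \<open>Polyhedral products\<close>

declare One_nat_def [simp del]

locale weighted_polyhedral = pointed_polyhedral m X pt rho c
  for m :: nat and X :: "nat \<Rightarrow> 'a topology" and pt :: "nat \<Rightarrow> 'a"
    and rho :: "nat \<Rightarrow> nat \<Rightarrow> 'a \<Rightarrow> 'a" and c :: "nat set \<Rightarrow> nat \<Rightarrow> nat" +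
  assumes couple: "\<And>i. i \<in> {1..m} \<Longrightarrow> CW_power_couple (X i) {pt i} (pt i) (rho i)"
    and powers: "power_sequence m c"
begin

lemma pt_in: "i \<in> {1..m} \<Longrightarrow> pt i \<in> topspace (X i)"
  using couple by (auto simp: CW_power_couple_def power_couple_def)

lemma rho_continuous: "i \<in> {1..m} \<Longrightarrow> a \<ge> 1 \<Longrightarrow> continuous_map (X i) (X i) (rho i a)"
  using couple by (auto simp: CW_power_couple_def power_couple_def)

lemma rho_in: "i \<in> {1..m} \<Longrightarrow> a \<ge> 1 \<Longrightarrow> x \<in> topspace (X i) \<Longrightarrow> rho i a x \<in> topspace (X i)"
  using continuous_map_funspace[OF rho_continuous] by blast

lemma rho_pt [simp]: "i \<in> {1..m} \<Longrightarrow> a \<ge> 1 \<Longrightarrow> rho i a (pt i) = pt i"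
  using couple by (auto simp: CW_power_couple_def power_couple_def)

lemma rho_1: "i \<in> {1..m} \<Longrightarrow> x \<in> topspace (X i) \<Longrightarrow> rho i 1 x = x"
  using couple by (auto simp: CW_power_couple_def power_couple_def)

lemma rho_rho: "i \<in> {1..m} \<Longrightarrow> a \<ge> 1 \<Longrightarrow> b \<ge> 1 \<Longrightarrow> x \<in> topspace (X i) \<Longrightarrow> rho i a (rho i b x) = rho i (a * b) x"
  using couple by (auto simp: CW_power_couple_def power_couple_def)

lemma c_pos: "\<sigma> \<subseteq> {1..m} \<Longrightarrow> i \<in> {1..m} \<Longrightarrow> c \<sigma> i \<ge> 1"
  using powers unfolding power_sequence_def by blast

lemma c_dvd: "\<sigma> \<subseteq> {1..m} \<Longrightarrow> \<tau> \<subseteq> \<sigma> \<Longrightarrow> i \<in> {1..m} \<Longrightarrow> c \<tau> i dvd c \<sigma> i"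
  using powers unfolding power_sequence_def by blast

lemma c_div_pos:
  assumes "\<sigma> \<subseteq> {1..m}" "\<tau> \<subseteq> \<sigma>" "i \<in> {1..m}"
  shows "c \<sigma> i div c \<tau> i \<ge> 1"
proof -
  have "c \<tau> i \<le> c \<sigma> i" "c \<tau> i > 0"
    using c_pos[OF assms(1,3)] c_pos[OF subset_trans[OF assms(2,1)] assms(3)] c_dvd[OF assms]
    by (auto intro: dvd_imp_le)
  then show ?thesis by (simp add: One_nat_def Suc_le_eq div_greater_zero_iff)
qed

lemma pt_strom: "i \<in> {1..m} \<Longrightarrow> \<exists>\<phi> H. strom_structure (X i) {pt i} \<phi> H"
  using couple[of i] relative_CW_complex_strom[of "X i" "{pt i}"] by (simp add: CW_power_couple_def)

lemma pt_closed: "i \<in> {1..m} \<Longrightarrow> closedin (X i) {pt i}"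
  using pt_strom strom_closed by blast

lemma poly_set_iff:
  "x \<in> poly_set \<sigma> \<longleftrightarrow> x \<in> extensional {1..m} \<and> (\<forall>i\<in>{1..m}. x i \<in> topspace (X i) \<and> (i \<notin> \<sigma> \<longrightarrow> x i = pt i))"
  by (auto simp: poly_set_def cg_product_def PiE_iff)

lemma poly_set_mono: "\<tau> \<subseteq> \<sigma> \<Longrightarrow> poly_set \<tau> \<subseteq> poly_set \<sigma>"
  unfolding subset_iff poly_set_iff by blast

lemma poly_set_Int: "poly_set \<sigma> \<inter> poly_set \<tau> = poly_set (\<sigma> \<inter> \<tau>)"
  by (auto simp: poly_set_iff)

lemma base_point_in [simp]: "base_point \<in> poly_set \<sigma>"
  by (auto simp: poly_set_iff base_point_def pt_in)

lemma poly_set_empty: "x \<in> poly_set {} \<longleftrightarrow> x = base_point"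
  by (auto simp: poly_set_iff base_point_def pt_in extensional_def fun_eq_iff)

lemma poly_set_closed: "closedin (cg_product X {1..m}) (poly_set \<sigma>)"
proof -
  let ?P = "product_topology X {1..m}"
  have i: "closedin ?P {x \<in> topspace ?P. x i \<in> {pt i}}" if "i \<in> {1..m}" for i
    using closedin_continuous_map_preimage[OF continuous_map_product_coordinates[OF that, of X] pt_closed[OF that]] .
  have "closedin ?P (topspace ?P \<inter> (\<Inter>i\<in>{1..m} - \<sigma>. {x \<in> topspace ?P. x i \<in> {pt i}}))"
  proof (cases "{1..m} - \<sigma> = {}")
    case True
    show ?thesis unfolding True by (simp del: topspace_product_topology)
  next
    case False
    then show ?thesis
      by (intro closedin_Int closedin_topspace closedin_INT) (use i in auto)
  qed
  moreover have "topspace ?P \<inter> (\<Inter>i\<in>{1..m} - \<sigma>. {x \<in> topspace ?P. x i \<in> {pt i}}) = poly_set \<sigma>"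
    by (auto simp: poly_set_def cg_product_def)
  ultimately show ?thesis
    by (simp add: cg_product_def closedin_kification_finer)
qed

text \<open>
  A closed subspace of a compactly generated space is compactly generated.
\<close>

lemma face_poly_eq: "face_poly \<sigma> = subtopology (cg_product X {1..m}) (poly_set \<sigma>)"
proof -
  have "k_space (subtopology (cg_product X {1..m}) (poly_set \<sigma>))"
    by (rule k_space_closed_subtopology[OF _ poly_set_closed]) (simp add: cg_product_def)
  then show ?thesis
    by (simp add: face_poly_def cg_subspace_def kification_eq_self)
qed

lemma poly_set_subset: "poly_set \<sigma> \<subseteq> topspace (cg_product X {1..m})"
  by (auto simp: poly_set_def)

lemma topspace_face_poly [simp]: "topspace (face_poly \<sigma>) = poly_set \<sigma>"
  using poly_set_subset by (auto simp: face_poly_eq)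

lemma topspace_poly: "topspace (poly J) = (\<Union>\<sigma>\<in>J. poly_set \<sigma>)"
  using poly_set_subset by (auto simp: poly_def cg_subspace_def)

lemma k_space_face_poly: "k_space (face_poly \<sigma>)"
  by (simp add: face_poly_def cg_subspace_def)

lemma face_poly_subtopology: "\<tau> \<subseteq> \<sigma> \<Longrightarrow> subtopology (face_poly \<sigma>) (poly_set \<tau>) = face_poly \<tau>"
  using poly_set_mono[of \<tau> \<sigma>] by (simp add: face_poly_eq subtopology_subtopology Int_absorb1)

lemma closedin_face_poly: "\<tau> \<subseteq> \<sigma> \<Longrightarrow> closedin (face_poly \<sigma>) (poly_set \<tau>)"
  using poly_set_mono[of \<tau> \<sigma>] poly_set_closed[of \<tau>]
  by (simp add: face_poly_eq closedin_closed_subtopology[OF poly_set_closed])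

lemma continuous_map_face_poly_coordinate:
  "i \<in> {1..m} \<Longrightarrow> continuous_map (face_poly \<sigma>) (X i) (\<lambda>x. x i)"
  unfolding face_poly_eq cg_product_def
  by (intro continuous_map_from_subtopology continuous_map_from_kification continuous_map_product_coordinates)

text \<open>
  For a compactly generated source the refined topology of the product imposes no further condition.
\<close>

lemma continuous_map_into_face_poly:
  assumes "k_space Y" "\<And>i. i \<in> {1..m} \<Longrightarrow> continuous_map Y (X i) (\<lambda>y. f y i)"
    and "\<And>y. y \<in> topspace Y \<Longrightarrow> f y \<in> poly_set \<sigma>"
  shows "continuous_map Y (face_poly \<sigma>) f"
  using assms unfolding face_poly_eq cg_product_def
  by (auto simp: continuous_map_in_subtopology continuous_map_into_kification continuous_map_componentwise poly_set_iff)

lemma cmap_in: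
  assumes "\<sigma> \<subseteq> {1..m}" "\<tau> \<subseteq> \<sigma>" "x \<in> poly_set \<mu>"
  shows "cmap \<sigma> \<tau> x \<in> poly_set \<mu>"
  using assms c_div_pos[OF assms(1,2)] by (auto simp: poly_set_iff cmap_def rho_in)

lemma cmap_cmap:
  assumes "\<sigma> \<subseteq> {1..m}" "\<tau> \<subseteq> \<sigma>" "\<mu> \<subseteq> \<tau>" "x \<in> poly_set \<nu>"
  shows "cmap \<tau> \<mu> (cmap \<sigma> \<tau> x) = cmap \<sigma> \<mu> x"
proof
  fix i
  show "cmap \<tau> \<mu> (cmap \<sigma> \<tau> x) i = cmap \<sigma> \<mu> x i"
  proof (cases "i \<in> {1..m}")
    case True
    have t: "\<tau> \<subseteq> {1..m}" using assms by blast
    have "(c \<tau> i div c \<mu> i) * (c \<sigma> i div c \<tau> i) = c \<sigma> i div c \<mu> i"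
      using c_dvd[OF assms(1,2) True] c_dvd[OF t assms(3) True] c_pos[OF t True] c_pos[of \<mu> i] assms t True
      by (auto elim!: dvdE)
    then show ?thesis
      using True assms(4) rho_rho[OF True c_div_pos[OF t assms(3) True] c_div_pos[OF assms(1,2) True], of "x i"]
      by (simp add: cmap_def poly_set_iff)
  qed (auto simp: cmap_def)
qed

lemma cmap_self:
  assumes "\<sigma> \<subseteq> {1..m}" "x \<in> poly_set \<nu>"
  shows "cmap \<sigma> \<sigma> x = x"
proof
  fix i
  show "cmap \<sigma> \<sigma> x i = x i"
  proof (cases "i \<in> {1..m}")
    case True
    have "c \<sigma> i div c \<sigma> i = 1"
      using c_pos[OF assms(1) True] by simp
    then show ?thesis
      using True assms(2) rho_1[OF True, of "x i"] by (simp add: cmap_def poly_set_iff)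
  qed (use assms(2) in \<open>auto simp: cmap_def poly_set_iff extensional_def\<close>)
qed

lemma cmap_continuous:
  assumes "\<sigma> \<subseteq> {1..m}" "\<tau> \<subseteq> \<sigma>"
  shows "continuous_map (face_poly \<mu>) (face_poly \<mu>) (cmap \<sigma> \<tau>)"
proof (rule continuous_map_into_face_poly[OF k_space_face_poly])
  fix i assume i: "i \<in> {1..m}"
  have "continuous_map (face_poly \<mu>) (X i) (rho i (c \<sigma> i div c \<tau> i) \<circ> (\<lambda>x. x i))"
    by (rule continuous_map_compose[OF continuous_map_face_poly_coordinate[OF i] rho_continuous[OF i c_div_pos[OF assms i]]])
  then show "continuous_map (face_poly \<mu>) (X i) (\<lambda>x. cmap \<sigma> \<tau> x i)"
    using i by (simp add: cmap_def o_def)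
qed (simp add: cmap_in assms)

lemma proj_in: "x \<in> poly_set \<delta> \<Longrightarrow> proj \<tau> x \<in> poly_set (\<delta> \<inter> \<tau>)"
  by (auto simp: poly_set_iff proj_def pt_in)

lemma proj_continuous: "continuous_map (face_poly \<delta>) (face_poly (\<delta> \<inter> \<tau>)) (proj \<tau>)"
proof (rule continuous_map_into_face_poly[OF k_space_face_poly])
  fix i assume i: "i \<in> {1..m}"
  show "continuous_map (face_poly \<delta>) (X i) (\<lambda>x. proj \<tau> x i)"
    using i continuous_map_face_poly_coordinate[OF i] pt_in[OF i] by (cases "i \<in> \<tau>") (simp_all add: proj_def)
qed (simp add: proj_in)

lemma cmap_proj:
  assumes "\<sigma> \<subseteq> {1..m}" "\<tau> \<subseteq> \<sigma>"
  shows "cmap \<sigma> \<tau> (proj \<mu> x) = proj \<mu> (cmap \<sigma> \<tau> x)"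
  using c_div_pos[OF assms] by (auto simp: cmap_def proj_def fun_eq_iff)

lemma proj_self: "x \<in> poly_set \<tau> \<Longrightarrow> proj \<tau> x = x"
  by (auto simp: poly_set_iff proj_def extensional_def fun_eq_iff)

lemma base_point_fixed: "\<sigma> \<subseteq> {1..m} \<Longrightarrow> \<tau> \<subseteq> \<sigma> \<Longrightarrow> cmap \<sigma> \<tau> base_point = base_point"
  using cmap_in[of \<sigma> \<tau> base_point "{}"] by (simp add: poly_set_empty)

lemma proj_base_point: "proj \<tau> base_point = base_point"
  by (auto simp: proj_def base_point_def fun_eq_iff)


section \<open>Weighted polyhedral products as colimits of polyhedral products\<close>

definition face_rel :: "nat set set \<Rightarrow> ((nat set \<times> (nat \<Rightarrow> 'a)) \<times> (nat set \<times> (nat \<Rightarrow> 'a))) set" where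
  "face_rel K = {((\<sigma>, x), (\<tau>, cmap \<sigma> \<tau> x)) | \<sigma> \<tau> x. \<sigma> \<in> K \<and> \<tau> \<subseteq> \<sigma> \<and> x \<in> poly_set \<tau>}"

definition face_equiv :: "nat set set \<Rightarrow> ((nat set \<times> (nat \<Rightarrow> 'a)) \<times> (nat set \<times> (nat \<Rightarrow> 'a))) set" where
  "face_equiv K = (face_rel K \<union> (face_rel K)\<inverse>)\<^sup>*"

lemma face_equiv_class: "(a, b) \<in> face_equiv K \<Longrightarrow> face_equiv K `` {a} = face_equiv K `` {b}"
  unfolding face_equiv_def using sym_closure_sym[of a b "face_rel K"] by (auto intro: rtrancl_trans)

lemma face_equiv_mono: "J \<subseteq> K \<Longrightarrow> face_equiv J \<subseteq> face_equiv K"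
  unfolding face_equiv_def by (intro rtrancl_mono) (auto simp: face_rel_def)

lemma face_equivI: "\<sigma> \<in> K \<Longrightarrow> \<tau> \<subseteq> \<sigma> \<Longrightarrow> x \<in> poly_set \<tau> \<Longrightarrow> ((\<sigma>, x), (\<tau>, cmap \<sigma> \<tau> x)) \<in> face_equiv K"
  by (auto simp: face_equiv_def face_rel_def)

text \<open>
  Compatible families are the cocones on the diagram that glues \<open>x \<in> X\<^sup>\<tau> \<subseteq> X\<^sup>\<sigma>\<close> to \<open>c\<^bsup>\<sigma>/\<tau>\<^esup> x \<in> X\<^sup>\<tau>\<close>, the
  relation \<open>face_rel\<close>.
\<close>

definition compatible :: "nat set set \<Rightarrow> (nat set \<Rightarrow> (nat \<Rightarrow> 'a) \<Rightarrow> 'z) \<Rightarrow> bool" where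
  "compatible K f \<longleftrightarrow> (\<forall>\<sigma>\<in>K. \<forall>\<tau>\<subseteq>\<sigma>. \<forall>x\<in>poly_set \<tau>. f \<sigma> x = f \<tau> (cmap \<sigma> \<tau> x))"

text \<open>
  \<open>Q\<close> with the maps \<open>g\<close> is the colimit of this diagram. The last condition, that \<open>g\<close> identifies only the points
  which the diagram identifies, is what allows every compatible family to descend to \<open>Q\<close>.
\<close>

definition weighted_colimit ::
  "nat set set \<Rightarrow> 'q topology \<Rightarrow> (nat set \<Rightarrow> (nat \<Rightarrow> 'a) \<Rightarrow> 'q) \<Rightarrow> bool" where
  "weighted_colimit K Q g \<longleftrightarrow>
     (\<forall>\<sigma>\<in>K. continuous_map (face_poly \<sigma>) Q (g \<sigma>)) \<and>
     topspace Q = (\<Union>\<sigma>\<in>K. g \<sigma> ` poly_set \<sigma>) \<and>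
     (\<forall>U\<subseteq>topspace Q. (\<forall>\<sigma>\<in>K. openin (face_poly \<sigma>) {x \<in> poly_set \<sigma>. g \<sigma> x \<in> U}) \<longrightarrow> openin Q U) \<and>
     compatible K g \<and>
     (\<forall>\<sigma>\<in>K. \<forall>\<tau>\<in>K. \<forall>x\<in>poly_set \<sigma>. \<forall>y\<in>poly_set \<tau>.
        g \<sigma> x = g \<tau> y \<longrightarrow> ((\<sigma>, x), (\<tau>, y)) \<in> face_equiv K)"

lemma weighted_colimitD:
  assumes "weighted_colimit K Q g"
  shows "\<And>\<sigma>. \<sigma> \<in> K \<Longrightarrow> continuous_map (face_poly \<sigma>) Q (g \<sigma>)"
    and "topspace Q = (\<Union>\<sigma>\<in>K. g \<sigma> ` poly_set \<sigma>)"
    and "\<And>U. \<lbrakk>U \<subseteq> topspace Q; \<And>\<sigma>. \<sigma> \<in> K \<Longrightarrow> openin (face_poly \<sigma>) {x \<in> poly_set \<sigma>. g \<sigma> x \<in> U}\<rbrakk> \<Longrightarrow> openin Q U"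
    and "\<And>\<sigma> \<tau> x. \<lbrakk>\<sigma> \<in> K; \<tau> \<subseteq> \<sigma>; x \<in> poly_set \<tau>\<rbrakk> \<Longrightarrow> g \<sigma> x = g \<tau> (cmap \<sigma> \<tau> x)"
    and "\<And>\<sigma> \<tau> x y. \<lbrakk>\<sigma> \<in> K; \<tau> \<in> K; x \<in> poly_set \<sigma>; y \<in> poly_set \<tau>; g \<sigma> x = g \<tau> y\<rbrakk>
      \<Longrightarrow> ((\<sigma>, x), (\<tau>, y)) \<in> face_equiv K"
proof -
  note Q = assms[unfolded weighted_colimit_def compatible_def]
  show "continuous_map (face_poly \<sigma>) Q (g \<sigma>)" if "\<sigma> \<in> K" for \<sigma>
    by (rule bspec[OF conjunct1[OF Q] that])
  note Q = Q[THEN conjunct2]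
  show "topspace Q = (\<Union>\<sigma>\<in>K. g \<sigma> ` poly_set \<sigma>)" by (rule conjunct1[OF Q])
  note Q = Q[THEN conjunct2]
  show "openin Q U" if "U \<subseteq> topspace Q" "\<And>\<sigma>. \<sigma> \<in> K \<Longrightarrow> openin (face_poly \<sigma>) {x \<in> poly_set \<sigma>. g \<sigma> x \<in> U}" for U
    by (rule conjunct1[OF Q, rule_format]) (use that in simp_all)
  note Q = Q[THEN conjunct2]
  show "g \<sigma> x = g \<tau> (cmap \<sigma> \<tau> x)" if "\<sigma> \<in> K" "\<tau> \<subseteq> \<sigma>" "x \<in> poly_set \<tau>" for \<sigma> \<tau> x
    by (rule conjunct1[OF Q, rule_format, OF that])
  show "((\<sigma>, x), (\<tau>, y)) \<in> face_equiv K" if "\<sigma> \<in> K" "\<tau> \<in> K" "x \<in> poly_set \<sigma>" "y \<in> poly_set \<tau>" "g \<sigma> x = g \<tau> y" for \<sigma> \<tau> x y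
    by (rule conjunct2[OF Q, rule_format, OF that])
qed

lemma compatible_kernel:
  assumes "compatible K f" "((\<sigma>, x), (\<tau>, y)) \<in> face_equiv K"
  shows "f \<sigma> x = f \<tau> y"
proof -
  have "(\<lambda>(\<sigma>, x). f \<sigma> x) (\<sigma>, x) = (\<lambda>(\<sigma>, x). f \<sigma> x) (\<tau>, y)"
    by (rule rtrancl_respects[of "face_rel K"])
      (use assms in \<open>auto simp: compatible_def face_rel_def face_equiv_def\<close>)
  then show ?thesis by simp
qed

lemma weighted_colimit_point_lift:
  assumes Q: "weighted_colimit K Q g" and f: "compatible K f"
  shows "\<exists>k. \<forall>\<sigma>\<in>K. \<forall>x\<in>poly_set \<sigma>. k (g \<sigma> x) = f \<sigma> x"
proof -
  define k where "k = (\<lambda>q. SOME z. \<exists>\<sigma>\<in>K. \<exists>x\<in>poly_set \<sigma>. q = g \<sigma> x \<and> z = f \<sigma> x)"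
  have "k (g \<sigma> x) = f \<sigma> x" if x: "\<sigma> \<in> K" "x \<in> poly_set \<sigma>" for \<sigma> x
  proof -
    have "\<exists>z. \<exists>\<tau>\<in>K. \<exists>y\<in>poly_set \<tau>. g \<sigma> x = g \<tau> y \<and> z = f \<tau> y" using x by blast
    from someI_ex[OF this] obtain \<tau> y where y: "\<tau> \<in> K" "y \<in> poly_set \<tau>" "g \<sigma> x = g \<tau> y" "k (g \<sigma> x) = f \<tau> y"
      unfolding k_def by blast
    then have "((\<sigma>, x), (\<tau>, y)) \<in> face_equiv K"
      using Q x unfolding weighted_colimit_def by blast
    then show ?thesis using compatible_kernel[OF f] y(4) by simp
  qed
  then show ?thesis by blast
qed

lemma weighted_colimit_continuous:
  assumes Q: "weighted_colimit K Q g"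
    and f: "\<And>\<sigma>. \<sigma> \<in> K \<Longrightarrow> continuous_map (face_poly \<sigma>) Z (\<lambda>x. k (g \<sigma> x))"
  shows "continuous_map Q Z k"
proof -
  have top: "topspace Q = (\<Union>\<sigma>\<in>K. g \<sigma> ` poly_set \<sigma>)"
    and op: "\<And>U. U \<subseteq> topspace Q \<Longrightarrow> (\<And>\<sigma>. \<sigma> \<in> K \<Longrightarrow> openin (face_poly \<sigma>) {x \<in> poly_set \<sigma>. g \<sigma> x \<in> U}) \<Longrightarrow> openin Q U"
    using Q unfolding weighted_colimit_def by blast+
  show ?thesis
    unfolding continuous_map_def
  proof (intro conjI allI impI)
    show "k \<in> topspace Q \<rightarrow> topspace Z"
    proof
      fix q assume "q \<in> topspace Q"
      then obtain \<sigma> x where "\<sigma> \<in> K" "x \<in> poly_set \<sigma>" "q = g \<sigma> x" using top by blast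
      then show "k q \<in> topspace Z"
        using funcset_mem[OF continuous_map_funspace[OF f]] by simp
    qed
    fix U assume U: "openin Z U"
    show "openin Q {q \<in> topspace Q. k q \<in> U}"
    proof (rule op)
      fix \<sigma> assume \<sigma>: "\<sigma> \<in> K"
      have "{x \<in> poly_set \<sigma>. g \<sigma> x \<in> {q \<in> topspace Q. k q \<in> U}} = {x \<in> topspace (face_poly \<sigma>). k (g \<sigma> x) \<in> U}"
        using \<sigma> top by auto
      then show "openin (face_poly \<sigma>) {x \<in> poly_set \<sigma>. g \<sigma> x \<in> {q \<in> topspace Q. k q \<in> U}}"
        using openin_continuous_map_preimage[OF f[OF \<sigma>] U] by simp
    qed auto
  qed
qed

lemma weighted_colimit_lift:
  assumes Q: "weighted_colimit K Q g" and f: "compatible K f"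
    and cont: "\<And>\<sigma>. \<sigma> \<in> K \<Longrightarrow> continuous_map (face_poly \<sigma>) Z (f \<sigma>)"
  shows "\<exists>k. continuous_map Q Z k \<and> (\<forall>\<sigma>\<in>K. \<forall>x\<in>poly_set \<sigma>. k (g \<sigma> x) = f \<sigma> x)"
proof -
  obtain k where k: "\<forall>\<sigma>\<in>K. \<forall>x\<in>poly_set \<sigma>. k (g \<sigma> x) = f \<sigma> x"
    using weighted_colimit_point_lift[OF Q f] by blast
  have "continuous_map Q Z k"
    by (rule weighted_colimit_continuous[OF Q], rule continuous_map_eq[OF cont]) (use k in auto)
  then show ?thesis using k by blast
qed

end

lemma sum_topology_cong:
  assumes "\<And>i. i \<in> I \<Longrightarrow> X i = Y i"
  shows "sum_topology X I = sum_topology Y I"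
proof -
  have "openin (sum_topology X I) U = openin (sum_topology Y I) U" for U
  proof -
    have "Sigma I (topspace \<circ> X) = Sigma I (topspace \<circ> Y)"
      by (rule Sigma_cong) (simp_all add: assms)
    then show ?thesis unfolding openin_sum_topology by (simp add: assms)
  qed
  then show ?thesis by (simp add: topology_eq)
qed

lemma colim_rel_cong:
  assumes "\<And>i. i \<in> J \<Longrightarrow> W i = W' i"
    and "\<And>\<tau> \<tau>' w. \<tau> \<in> J \<Longrightarrow> \<tau>' \<in> J \<Longrightarrow> f \<tau> \<tau>' w = f' \<tau> \<tau>' w"
  shows "colim_rel J W f = colim_rel J W' f'"
  unfolding colim_rel_def using assms by (intro Collect_cong ex_cong1) auto

lemma pushout_rel_cong:
  assumes "\<And>b. b \<in> topspace B \<Longrightarrow> g b = g' b"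
  shows "pushout_rel B f g = pushout_rel B f g'"
  unfolding pushout_rel_def using assms by (intro Collect_cong ex_cong1) auto

context weighted_polyhedral
begin

declare wdata.simps [simp del]

text \<open>
  The recursive definition only sees the spaces and maps of the proper faces through the function that
  carries the recursion. The following constants express the same data through \<open>W\<close>, \<open>eta\<close> and \<open>iota\<close>.
\<close>

definition eta_bd :: "nat set \<Rightarrow> (nat \<Rightarrow> 'a) \<Rightarrow> nat set \<times> 'a wpoint" where
  "eta_bd \<sigma> x = (let \<tau> = (SOME \<tau>. \<tau> \<in> bd \<sigma> \<and> x \<in> poly_set \<tau>) in inK (bd \<sigma>) \<tau> (eta \<tau> (cmap \<sigma> \<tau> x)))"

definition to_pushout :: "nat set \<Rightarrow> (nat \<Rightarrow> 'a) + (nat set \<times> 'a wpoint) \<Rightarrow> (nat \<Rightarrow> 'a) + (nat set \<times> 'a wpoint)" where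
  "to_pushout \<sigma> = cls (pushout_rel (poly (bd \<sigma>)) (\<lambda>x. x) (eta_bd \<sigma>))"

lemma W_empty: "W {} = final_topology (Wpoint \<circ> Inl) (face_poly {})"
  and eta_empty: "eta {} = Wpoint \<circ> Inl"
  and iota_empty: "iota \<tau> {} w = w"
  unfolding W_def eta_def iota_def by (subst wdata.simps; simp add: wstep_def)+

context
  fixes \<sigma> :: "nat set" assumes \<sigma>: "\<sigma> \<noteq> {}" "finite \<sigma>"
begin

private definition "F \<equiv> (\<lambda>\<tau>. if finite \<sigma> \<and> \<tau> \<subset> \<sigma> then wdata \<tau> else undefined)"

private lemma F: "\<tau> \<in> bd \<sigma> \<Longrightarrow> F \<tau> = wdata \<tau>"
  using \<sigma> by (simp add: F_def bd_def)

private lemma rel_eq: "colim_rel (bd \<sigma>) (\<lambda>\<tau>. fst (F \<tau>)) (\<lambda>\<tau> \<tau>'. snd (snd (F \<tau>')) \<tau>) = colim_rel (bd \<sigma>) W iota"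
  by (rule colim_rel_cong) (simp_all add: F W_def iota_def)

private lemma colim_eq: "colim (bd \<sigma>) (\<lambda>\<tau>. fst (F \<tau>)) (\<lambda>\<tau> \<tau>'. snd (snd (F \<tau>')) \<tau>) = WK (bd \<sigma>)"
proof -
  have "sum_topology (\<lambda>\<tau>. fst (F \<tau>)) (bd \<sigma>) = sum_topology W (bd \<sigma>)"
    by (rule sum_topology_cong) (simp add: F W_def)
  then show ?thesis
    by (simp add: WK_def colim_def rel_eq)
qed

private definition "eta_bd' \<equiv> (\<lambda>x. let \<tau> = (SOME \<tau>. \<tau> \<in> bd \<sigma> \<and> x \<in> poly_set \<tau>)
   in cls (colim_rel (bd \<sigma>) W iota) (\<tau>, fst (snd (F \<tau>)) (cmap \<sigma> \<tau> x)))"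

private lemma eta_bd'_eq:
  assumes "x \<in> topspace (poly (bd \<sigma>))"
  shows "eta_bd' x = eta_bd \<sigma> x"
proof -
  let ?\<tau> = "SOME \<tau>. \<tau> \<in> bd \<sigma> \<and> x \<in> poly_set \<tau>"
  have "\<exists>\<tau>. \<tau> \<in> bd \<sigma> \<and> x \<in> poly_set \<tau>" using assms by (auto simp: topspace_poly)
  then have "?\<tau> \<in> bd \<sigma> \<and> x \<in> poly_set ?\<tau>" by (rule someI_ex)
  then show ?thesis by (simp add: eta_bd'_def eta_bd_def inK_def F eta_def Let_def)
qed

private lemma wdata_eq: "wdata \<sigma> =
  (final_topology Wpoint (pushout (poly (bd \<sigma>)) (face_poly \<sigma>) (WK (bd \<sigma>)) (\<lambda>x. x) (eta_bd \<sigma>)),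
   \<lambda>x. Wpoint (to_pushout \<sigma> (Inl x)),
   \<lambda>\<tau> w. if \<tau> = \<sigma> then w else Wpoint (to_pushout \<sigma> (Inr (cls (colim_rel (bd \<sigma>) W iota) (\<tau>, w)))))"
proof -
  have r: "pushout_rel (poly (bd \<sigma>)) (\<lambda>x. x) eta_bd' = pushout_rel (poly (bd \<sigma>)) (\<lambda>x. x) (eta_bd \<sigma>)"
    by (rule pushout_rel_cong) (rule eta_bd'_eq)
  have "wdata \<sigma> = wstep \<sigma> F"
    unfolding F_def by (rule wdata.simps)
  also have "\<dots> = (final_topology Wpoint (pushout (poly (bd \<sigma>)) (face_poly \<sigma>) (WK (bd \<sigma>)) (\<lambda>x. x) eta_bd'),
   \<lambda>x. Wpoint (cls (pushout_rel (poly (bd \<sigma>)) (\<lambda>x. x) eta_bd') (Inl x)),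
   \<lambda>\<tau> w. if \<tau> = \<sigma> then w else Wpoint (cls (pushout_rel (poly (bd \<sigma>)) (\<lambda>x. x) eta_bd') (Inr (cls (colim_rel (bd \<sigma>) W iota) (\<tau>, w)))))"
    using \<sigma>(1) unfolding wstep_def Let_def eta_bd'_def colim_eq rel_eq by simp
  finally show ?thesis
    by (simp add: to_pushout_def r pushout_def cong: if_cong)
qed

lemma W_nonempty: "W \<sigma> = final_topology Wpoint (pushout (poly (bd \<sigma>)) (face_poly \<sigma>) (WK (bd \<sigma>)) (\<lambda>x. x) (eta_bd \<sigma>))"
  and eta_nonempty: "eta \<sigma> x = Wpoint (to_pushout \<sigma> (Inl x))"
  and iota_proper: "\<tau> \<noteq> \<sigma> \<Longrightarrow> iota \<tau> \<sigma> w = Wpoint (to_pushout \<sigma> (Inr (inK (bd \<sigma>) \<tau> w)))"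
  and iota_self': "iota \<sigma> \<sigma> w = w"
  by (simp_all add: W_def eta_def iota_def wdata_eq inK_def)

end

lemma iota_self: "finite \<sigma> \<Longrightarrow> iota \<sigma> \<sigma> w = w"
  using iota_empty iota_self' by (cases "\<sigma> = {}") auto

text \<open>
  The induction hypothesis on a face: the colimit description of \<open>W \<sigma>\<close>, together with functoriality
  of the structure maps, which is what makes the colimit over a larger complex meaningful.
\<close>

definition face_ok :: "nat set \<Rightarrow> bool" where
  "face_ok \<sigma> \<longleftrightarrow>
     weighted_colimit (Pow \<sigma>) (W \<sigma>) (\<lambda>\<tau> x. iota \<tau> \<sigma> (eta \<tau> x)) \<and>
     (\<forall>\<tau>\<subseteq>\<sigma>. continuous_map (W \<tau>) (W \<sigma>) (iota \<tau> \<sigma>)) \<and>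
     (\<forall>\<tau>\<subseteq>\<sigma>. \<forall>\<mu>\<subseteq>\<tau>. \<forall>w\<in>topspace (W \<mu>). iota \<tau> \<sigma> (iota \<mu> \<tau> w) = iota \<mu> \<sigma> w)"

lemma face_okD:
  assumes "face_ok \<sigma>"
  shows "weighted_colimit (Pow \<sigma>) (W \<sigma>) (\<lambda>\<tau> x. iota \<tau> \<sigma> (eta \<tau> x))"
    and "\<And>\<tau>. \<tau> \<subseteq> \<sigma> \<Longrightarrow> continuous_map (W \<tau>) (W \<sigma>) (iota \<tau> \<sigma>)"
    and "\<And>\<tau> \<mu> w. \<lbrakk>\<tau> \<subseteq> \<sigma>; \<mu> \<subseteq> \<tau>; w \<in> topspace (W \<mu>)\<rbrakk> \<Longrightarrow> iota \<tau> \<sigma> (iota \<mu> \<tau> w) = iota \<mu> \<sigma> w"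
  using assms[unfolded face_ok_def] by simp_all

lemma face_ok_eta_in:
  assumes "face_ok \<sigma>" "finite \<sigma>"
  shows "x \<in> poly_set \<sigma> \<Longrightarrow> eta \<sigma> x \<in> topspace (W \<sigma>)"
    and "continuous_map (face_poly \<sigma>) (W \<sigma>) (eta \<sigma>)"
proof -
  have "continuous_map (face_poly \<sigma>) (W \<sigma>) (\<lambda>x. iota \<sigma> \<sigma> (eta \<sigma> x))"
    by (rule weighted_colimitD(1)[OF face_okD(1)[OF assms(1)]]) simp
  then show c: "continuous_map (face_poly \<sigma>) (W \<sigma>) (eta \<sigma>)"
    using assms(2) by (simp add: iota_self)
  show "x \<in> poly_set \<sigma> \<Longrightarrow> eta \<sigma> x \<in> topspace (W \<sigma>)"
    using funcset_mem[OF continuous_map_funspace[OF c]] by simp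
qed

lemma face_ok_eta:
  assumes "face_ok \<sigma>" "finite \<sigma>" "\<tau> \<subseteq> \<sigma>" "x \<in> poly_set \<tau>"
  shows "eta \<sigma> x = iota \<tau> \<sigma> (eta \<tau> (cmap \<sigma> \<tau> x))"
proof -
  have "iota \<sigma> \<sigma> (eta \<sigma> x) = iota \<tau> \<sigma> (eta \<tau> (cmap \<sigma> \<tau> x))"
    using weighted_colimitD(4)[OF face_okD(1)[OF assms(1)], of \<sigma> \<tau> x] assms(3,4) by simp
  then show ?thesis using assms(2) by (simp add: iota_self)
qed

context
  fixes J :: "nat set set"
  assumes J: "\<And>\<sigma>. \<sigma> \<in> J \<Longrightarrow> \<sigma> \<subseteq> {1..m}" "\<And>\<sigma> \<tau>. \<sigma> \<in> J \<Longrightarrow> \<tau> \<subseteq> \<sigma> \<Longrightarrow> \<tau> \<in> J"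
    and ok: "\<And>\<sigma>. \<sigma> \<in> J \<Longrightarrow> face_ok \<sigma>"
begin

private lemma fin: "\<sigma> \<in> J \<Longrightarrow> finite \<sigma>"
  using J(1) finite_subset by blast

private lemma q: "quotient_map (sum_topology W J) (WK J) (cls (colim_rel J W iota))"
  by (simp add: WK_def colim_def quotient_map_quot)

lemma inK_iota: "\<sigma> \<in> J \<Longrightarrow> \<tau> \<subseteq> \<sigma> \<Longrightarrow> w \<in> topspace (W \<tau>) \<Longrightarrow> inK J \<sigma> (iota \<tau> \<sigma> w) = inK J \<tau> w"
  unfolding inK_def by (rule cls_eqI[symmetric]) (use J(2) in \<open>auto simp: colim_rel_def\<close>)

lemma inK_continuous: "\<sigma> \<in> J \<Longrightarrow> continuous_map (W \<sigma>) (WK J) (inK J \<sigma>)"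
  using continuous_map_compose[OF continuous_map_component_injection quotient_imp_continuous_map[OF q]]
  by (auto simp: o_def inK_def[abs_def])

lemma W_points: "\<sigma> \<in> J \<Longrightarrow> topspace (W \<sigma>) = (\<Union>\<tau>\<in>Pow \<sigma>. (\<lambda>x. iota \<tau> \<sigma> (eta \<tau> x)) ` poly_set \<tau>)"
  by (rule weighted_colimitD(2)[OF face_okD(1)[OF ok]])

lemma eta_in_W: "\<sigma> \<in> J \<Longrightarrow> x \<in> poly_set \<sigma> \<Longrightarrow> eta \<sigma> x \<in> topspace (W \<sigma>)"
  using face_ok_eta_in(1)[OF ok fin] by blast

lemma inK_iota_eta:
  "\<sigma> \<in> J \<Longrightarrow> \<tau> \<subseteq> \<sigma> \<Longrightarrow> x \<in> poly_set \<tau> \<Longrightarrow> inK J \<sigma> (iota \<tau> \<sigma> (eta \<tau> x)) = inK J \<tau> (eta \<tau> x)"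
  using inK_iota eta_in_W J(2) by blast

text \<open>
  Every point of \<open>W \<sigma>\<close> comes from a product over a face of \<open>\<sigma>\<close>, so openness and identifications in the
  colimit can be tested on products. To see that no further points are identified, assign to a point of
  \<open>W \<tau>\<close> the class of any point of a product that represents it; this assignment is well defined by the
  colimit description of \<open>W \<tau>\<close>, it respects the structure maps, and so it separates points of the
  colimit with different classes.
\<close>

lemma weighted_colimit_WK: "weighted_colimit J (WK J) (\<lambda>\<sigma> x. inK J \<sigma> (eta \<sigma> x))"
  unfolding weighted_colimit_def
proof (intro conjI ballI allI impI)
  show "continuous_map (face_poly \<sigma>) (WK J) (\<lambda>x. inK J \<sigma> (eta \<sigma> x))" if "\<sigma> \<in> J" for \<sigma>
    using continuous_map_compose[OF face_ok_eta_in(2)[OF ok[OF that] fin[OF that]] inK_continuous[OF that]]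
    by (simp add: o_def)
  have "topspace (WK J) = (\<Union>\<sigma>\<in>J. inK J \<sigma> ` topspace (W \<sigma>))"
    unfolding quotient_imp_surjective_map[OF q, symmetric] by (auto simp: inK_def)
  also have "\<dots> = (\<Union>\<sigma>\<in>J. (\<lambda>x. inK J \<sigma> (eta \<sigma> x)) ` poly_set \<sigma>)" (is "?L = ?R")
  proof
    show "?R \<subseteq> ?L" using eta_in_W by blast
    show "?L \<subseteq> ?R"
    proof
      fix z assume "z \<in> ?L"
      then obtain \<sigma> w where z: "z = inK J \<sigma> w" and \<sigma>: "\<sigma> \<in> J" and "w \<in> topspace (W \<sigma>)"
        by blast
      then obtain \<tau> x where \<tau>: "\<tau> \<subseteq> \<sigma>" "x \<in> poly_set \<tau>" "w = iota \<tau> \<sigma> (eta \<tau> x)"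
        using W_points by auto
      then have "inK J \<sigma> w = inK J \<tau> (eta \<tau> x)" "\<tau> \<in> J" using inK_iota_eta \<sigma> J(2) by auto
      then show "z \<in> ?R" using \<tau> z by blast
    qed
  qed
  finally show top: "topspace (WK J) = (\<Union>\<sigma>\<in>J. (\<lambda>x. inK J \<sigma> (eta \<sigma> x)) ` poly_set \<sigma>)" .
  show "openin (WK J) U" if U: "U \<subseteq> topspace (WK J)"
    and op: "\<forall>\<sigma>\<in>J. openin (face_poly \<sigma>) {x \<in> poly_set \<sigma>. inK J \<sigma> (eta \<sigma> x) \<in> U}" for U
  proof -
    have "openin (W \<sigma>) {w \<in> topspace (W \<sigma>). inK J \<sigma> w \<in> U}" if \<sigma>: "\<sigma> \<in> J" for \<sigma>
    proof -
      have crit: "\<And>V. V \<subseteq> topspace (W \<sigma>) \<Longrightarrow> (\<And>\<tau>. \<tau> \<subseteq> \<sigma> \<Longrightarrow> openin (face_poly \<tau>) {x \<in> poly_set \<tau>. iota \<tau> \<sigma> (eta \<tau> x) \<in> V})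
          \<Longrightarrow> openin (W \<sigma>) V"
        by (rule weighted_colimitD(3)[OF face_okD(1)[OF ok[OF \<sigma>]]]) simp_all
      show ?thesis
      proof (rule crit)
        fix \<tau> assume \<tau>: "\<tau> \<subseteq> \<sigma>"
        have "iota \<tau> \<sigma> (eta \<tau> x) \<in> topspace (W \<sigma>)" if "x \<in> poly_set \<tau>" for x
          unfolding W_points[OF \<sigma>] using \<tau> that by blast
        then have "{x \<in> poly_set \<tau>. iota \<tau> \<sigma> (eta \<tau> x) \<in> {w \<in> topspace (W \<sigma>). inK J \<sigma> w \<in> U}}
            = {x \<in> poly_set \<tau>. inK J \<tau> (eta \<tau> x) \<in> U}"
          using inK_iota_eta[OF \<sigma> \<tau>] by auto
        then show "openin (face_poly \<tau>) {x \<in> poly_set \<tau>. iota \<tau> \<sigma> (eta \<tau> x) \<in> {w \<in> topspace (W \<sigma>). inK J \<sigma> w \<in> U}}"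
          using op J(2)[OF \<sigma> \<tau>] by simp
      qed auto
    qed
    then have "openin (sum_topology W J) {p \<in> topspace (sum_topology W J). cls (colim_rel J W iota) p \<in> U}"
      by (auto simp: openin_sum_topology inK_def elim: back_subst[of "openin (W _)"])
    then show ?thesis using q U unfolding quotient_map_def by blast
  qed
  show "compatible J (\<lambda>\<sigma> x. inK J \<sigma> (eta \<sigma> x))"
    unfolding compatible_def
  proof (intro ballI allI impI)
    fix \<sigma> \<tau> x assume \<sigma>: "\<sigma> \<in> J" and \<tau>: "\<tau> \<subseteq> \<sigma>" and x: "x \<in> poly_set \<tau>"
    show "inK J \<sigma> (eta \<sigma> x) = inK J \<tau> (eta \<tau> (cmap \<sigma> \<tau> x))"
      using face_ok_eta[OF ok[OF \<sigma>] fin[OF \<sigma>] \<tau> x] inK_iota_eta[OF \<sigma> \<tau> cmap_in[OF J(1)[OF \<sigma>] \<tau> x]] by simp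
  qed
  fix \<sigma> \<tau> x y
  assume \<sigma>: "\<sigma> \<in> J" "\<tau> \<in> J" and xy: "x \<in> poly_set \<sigma>" "y \<in> poly_set \<tau>"
    and eq: "inK J \<sigma> (eta \<sigma> x) = inK J \<tau> (eta \<tau> y)"
  define N where "N = (\<lambda>(\<tau>, w). {b. \<exists>\<mu>\<subseteq>\<tau>. \<exists>x\<in>poly_set \<mu>. w = iota \<mu> \<tau> (eta \<mu> x) \<and> ((\<mu>, x), b) \<in> face_equiv J})"
  have N: "N (\<tau>, iota \<mu> \<tau> (eta \<mu> x)) = face_equiv J `` {(\<mu>, x)}" if \<tau>: "\<tau> \<in> J" and \<mu>: "\<mu> \<subseteq> \<tau>" "x \<in> poly_set \<mu>" for \<tau> \<mu> x
  proof -
    have "face_equiv J `` {(\<nu>, y)} = face_equiv J `` {(\<mu>, x)}"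
      if "\<nu> \<subseteq> \<tau>" "y \<in> poly_set \<nu>" "iota \<mu> \<tau> (eta \<mu> x) = iota \<nu> \<tau> (eta \<nu> y)" for \<nu> y
    proof -
      have "((\<nu>, y), (\<mu>, x)) \<in> face_equiv (Pow \<tau>)"
        by (rule weighted_colimitD(5)[OF face_okD(1)[OF ok[OF \<tau>]]]) (use \<mu> that in auto)
      then have "((\<nu>, y), (\<mu>, x)) \<in> face_equiv J"
        by (rule subsetD[OF face_equiv_mono, rotated]) (use J(2)[OF \<tau>] in blast)
      then show ?thesis by (rule face_equiv_class)
    qed
    then show ?thesis using \<mu> unfolding N_def by blast
  qed
  have Nr: "N a = N b" if "(a, b) \<in> colim_rel J W iota" for a b
  proof -
    obtain \<tau> \<tau>' w where a: "a = (\<tau>, w)" "b = (\<tau>', iota \<tau> \<tau>' w)" and \<tau>: "\<tau> \<in> J" "\<tau>' \<in> J" "\<tau> \<subseteq> \<tau>'" and w: "w \<in> topspace (W \<tau>)"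
      using \<open>(a, b) \<in> colim_rel J W iota\<close> unfolding colim_rel_def by blast
    obtain \<mu> x where \<mu>: "\<mu> \<subseteq> \<tau>" "x \<in> poly_set \<mu>" "w = iota \<mu> \<tau> (eta \<mu> x)"
      using w W_points[OF \<tau>(1)] by auto
    have "iota \<tau> \<tau>' w = iota \<mu> \<tau>' (eta \<mu> x)"
      unfolding \<mu>(3) by (rule face_okD(3)[OF ok[OF \<tau>(2)] \<tau>(3) \<mu>(1) eta_in_W[OF J(2)[OF \<tau>(1) \<mu>(1)] \<mu>(2)]])
    then show ?thesis using N[OF \<tau>(1) \<mu>(1,2)] N[of \<tau>' \<mu> x] \<mu> \<tau> a by auto
  qed
  have "N (\<sigma>, eta \<sigma> x) = N (\<tau>, eta \<tau> y)"
    using eq cls_respects[of "colim_rel J W iota" N, OF Nr] unfolding inK_def by metis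
  then have "face_equiv J `` {(\<sigma>, x)} = face_equiv J `` {(\<tau>, y)}"
    using N[OF \<sigma>(1) subset_refl xy(1)] N[OF \<sigma>(2) subset_refl xy(2)] iota_self fin \<sigma> by simp
  moreover have "(\<tau>, y) \<in> face_equiv J `` {(\<tau>, y)}" by (simp add: face_equiv_def)
  ultimately show "((\<sigma>, x), (\<tau>, y)) \<in> face_equiv J" by blast
qed

end

lemma face_ok_empty: "face_ok {}"
proof -
  have top: "topspace (W {}) = (Wpoint \<circ> Inl) ` poly_set {}"
    by (simp add: W_empty)
  have q: "quotient_map (face_poly {}) (W {}) (Wpoint \<circ> Inl)"
    unfolding W_empty by (rule quotient_map_final_topology)
  have "weighted_colimit (Pow {}) (W {}) (\<lambda>\<tau> x. iota \<tau> {} (eta \<tau> x))"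
    unfolding weighted_colimit_def
    using quotient_imp_continuous_map[OF q] q
    by (auto simp: iota_empty eta_empty top compatible_def cmap_self quotient_map_def face_equiv_def o_def)
  moreover have "iota {} {} = id" by (rule ext) (simp add: iota_empty)
  ultimately show ?thesis
    unfolding face_ok_def by (simp add: iota_empty)
qed

text \<open>
  Two proper faces whose products contain \<open>x\<close> are compared through their intersection.
\<close>

lemma eta_bd_eq:
  assumes \<sigma>: "\<sigma> \<subseteq> {1..m}" and ok: "\<And>\<tau>. \<tau> \<subset> \<sigma> \<Longrightarrow> face_ok \<tau>" and \<tau>: "\<tau> \<subset> \<sigma>" "x \<in> poly_set \<tau>"
  shows "eta_bd \<sigma> x = inK (bd \<sigma>) \<tau> (eta \<tau> (cmap \<sigma> \<tau> x))"
proof -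
  let ?\<tau> = "SOME \<tau>. \<tau> \<in> bd \<sigma> \<and> x \<in> poly_set \<tau>"
  have "\<exists>\<tau>. \<tau> \<in> bd \<sigma> \<and> x \<in> poly_set \<tau>" using \<tau> by (auto simp: bd_def)
  then have \<tau>': "?\<tau> \<in> bd \<sigma> \<and> x \<in> poly_set ?\<tau>" by (rule someI_ex)
  have J: "\<And>\<tau>. \<tau> \<in> bd \<sigma> \<Longrightarrow> \<tau> \<subseteq> {1..m}" "\<And>\<tau> \<mu>. \<tau> \<in> bd \<sigma> \<Longrightarrow> \<mu> \<subseteq> \<tau> \<Longrightarrow> \<mu> \<in> bd \<sigma>"
    "\<And>\<tau>. \<tau> \<in> bd \<sigma> \<Longrightarrow> face_ok \<tau>"
    using \<sigma> ok unfolding bd_def by blast+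
  note comp = weighted_colimitD(4)[OF weighted_colimit_WK[of "bd \<sigma>", OF J]]
  have red: "inK (bd \<sigma>) \<tau> (eta \<tau> (cmap \<sigma> \<tau> x)) = inK (bd \<sigma>) \<mu> (eta \<mu> (cmap \<sigma> \<mu> x))"
    if "\<tau> \<subset> \<sigma>" "\<mu> \<subseteq> \<tau>" "x \<in> poly_set \<mu>" for \<tau> \<mu>
  proof -
    have "cmap \<sigma> \<tau> x \<in> poly_set \<mu>" using cmap_in[OF \<sigma>] that by blast
    then have "inK (bd \<sigma>) \<tau> (eta \<tau> (cmap \<sigma> \<tau> x)) = inK (bd \<sigma>) \<mu> (eta \<mu> (cmap \<tau> \<mu> (cmap \<sigma> \<tau> x)))"
      using that by (intro comp) (auto simp: bd_def)
    then show ?thesis using cmap_cmap[OF \<sigma> _ that(2,3)] that(1) by auto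
  qed
  have x: "x \<in> poly_set (\<tau> \<inter> ?\<tau>)" using \<tau> \<tau>' poly_set_Int[of \<tau> ?\<tau>] by blast
  have "eta_bd \<sigma> x = inK (bd \<sigma>) ?\<tau> (eta ?\<tau> (cmap \<sigma> ?\<tau> x))"
    by (simp add: eta_bd_def Let_def)
  also have "\<dots> = inK (bd \<sigma>) (\<tau> \<inter> ?\<tau>) (eta (\<tau> \<inter> ?\<tau>) (cmap \<sigma> (\<tau> \<inter> ?\<tau>) x))"
    using \<tau>' by (intro red x) (auto simp: bd_def)
  also have "\<dots> = inK (bd \<sigma>) \<tau> (eta \<tau> (cmap \<sigma> \<tau> x))"
    using \<tau> by (intro red[symmetric] x) auto
  finally show ?thesis .
qed

text \<open>
  The pushout adds the product over \<open>\<sigma>\<close> to the colimit over the proper faces and glues the points of its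
  fat wedge as the diagram prescribes. That nothing else is identified is seen, as for
  \<open>weighted_colimit_WK\<close>, by assigning to each point its class.
\<close>

lemma face_ok_step:
  assumes \<sigma>: "\<sigma> \<subseteq> {1..m}" "\<sigma> \<noteq> {}" and ok: "\<And>\<tau>. \<tau> \<subset> \<sigma> \<Longrightarrow> face_ok \<tau>"
  shows "face_ok \<sigma>"
proof -
  have fin: "finite \<sigma>" using \<sigma>(1) finite_subset by blast
  have J: "\<And>\<tau>. \<tau> \<in> bd \<sigma> \<Longrightarrow> \<tau> \<subseteq> {1..m}" "\<And>\<tau> \<mu>. \<tau> \<in> bd \<sigma> \<Longrightarrow> \<mu> \<subseteq> \<tau> \<Longrightarrow> \<mu> \<in> bd \<sigma>"
    "\<And>\<tau>. \<tau> \<in> bd \<sigma> \<Longrightarrow> face_ok \<tau>"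
    using \<sigma> ok unfolding bd_def by blast+
  note wc = weighted_colimit_WK[of "bd \<sigma>", OF J]
  note eta_in = eta_in_W[of "bd \<sigma>", OF J]
  let ?C = "coprod (face_poly \<sigma>) (WK (bd \<sigma>))"
  let ?q = "\<lambda>z. Wpoint (to_pushout \<sigma> z)"
  have q: "quotient_map ?C (W \<sigma>) ?q"
    using quotient_map_compose[OF quotient_map_quot quotient_map_final_topology, of ?C]
    by (simp add: W_nonempty[OF \<sigma>(2) fin] pushout_def to_pushout_def o_def)
  note qc = quotient_imp_continuous_map[OF q]
  have eta: "eta \<sigma> x = ?q (Inl x)" for x by (rule eta_nonempty[OF \<sigma>(2) fin])
  have iota: "iota \<tau> \<sigma> w = ?q (Inr (inK (bd \<sigma>) \<tau> w))" if "\<tau> \<subset> \<sigma>" for \<tau> w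
    using iota_proper[OF \<sigma>(2) fin] that by blast
  note iself [simp] = iota_self[OF fin]
  have glue: "?q (Inl x) = ?q (Inr (inK (bd \<sigma>) \<tau> (eta \<tau> (cmap \<sigma> \<tau> x))))" if "\<tau> \<subset> \<sigma>" "x \<in> poly_set \<tau>" for \<tau> x
  proof -
    have "(Inl x, Inr (eta_bd \<sigma> x)) \<in> pushout_rel (poly (bd \<sigma>)) (\<lambda>x. x) (eta_bd \<sigma>)"
      using that by (auto simp: pushout_rel_def topspace_poly bd_def)
    from cls_eqI[OF this] show ?thesis
      by (simp add: to_pushout_def eta_bd_eq[OF \<sigma>(1) ok that])
  qed
  have eta_cont: "continuous_map (face_poly \<sigma>) (W \<sigma>) (eta \<sigma>)"
    using continuous_map_compose[OF continuous_map_Inl qc] by (simp add: o_def eta[abs_def])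
  have iota_cont: "continuous_map (W \<tau>) (W \<sigma>) (iota \<tau> \<sigma>)" if "\<tau> \<subseteq> \<sigma>" for \<tau>
  proof (cases "\<tau> = \<sigma>")
    case True
    have "iota \<sigma> \<sigma> = id" by (rule ext) simp
    with True show ?thesis by simp
  next
    case False
    then have \<tau>: "\<tau> \<subset> \<sigma>" using that by blast
    then have "\<tau> \<in> bd \<sigma>" by (simp add: bd_def)
    from inK_continuous[of "bd \<sigma>", OF J this]
    have "continuous_map (W \<tau>) (WK (bd \<sigma>)) (inK (bd \<sigma>) \<tau>)" .
    from continuous_map_compose[OF this continuous_map_compose[OF continuous_map_Inr qc]]
    show ?thesis by (simp add: o_def iota[OF \<tau>, abs_def])
  qed
  have funct: "iota \<tau> \<sigma> (iota \<mu> \<tau> w) = iota \<mu> \<sigma> w" if \<tau>: "\<tau> \<subseteq> \<sigma>" and \<mu>: "\<mu> \<subseteq> \<tau>" and w: "w \<in> topspace (W \<mu>)" for \<tau> \<mu> w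
  proof (cases "\<tau> = \<sigma>")
    case False
    then have \<tau>': "\<tau> \<subset> \<sigma>" "\<mu> \<subset> \<sigma>" using \<tau> \<mu> by auto
    then have "\<tau> \<in> bd \<sigma>" by (simp add: bd_def)
    from inK_iota[of "bd \<sigma>", OF J this \<mu> w]
    have "inK (bd \<sigma>) \<tau> (iota \<mu> \<tau> w) = inK (bd \<sigma>) \<mu> w" .
    then show ?thesis using \<tau>' by (simp add: iota)
  qed simp
  have g: "iota \<tau> \<sigma> (eta \<tau> x) = ?q (Inr (inK (bd \<sigma>) \<tau> (eta \<tau> x)))" if "\<tau> \<subset> \<sigma>" for \<tau> x
    using iota[OF that] .
  have WKtop: "topspace (WK (bd \<sigma>)) = (\<Union>\<tau>\<in>bd \<sigma>. (\<lambda>x. inK (bd \<sigma>) \<tau> (eta \<tau> x)) ` poly_set \<tau>)"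
    by (rule weighted_colimitD(2)[OF wc])
  have top: "topspace (W \<sigma>) = (\<Union>\<tau>\<in>Pow \<sigma>. (\<lambda>x. iota \<tau> \<sigma> (eta \<tau> x)) ` poly_set \<tau>)"
  proof -
    have "Pow \<sigma> = insert \<sigma> (bd \<sigma>)" by (auto simp: bd_def)
    moreover have "topspace (W \<sigma>) = ?q ` Inl ` poly_set \<sigma> \<union> ?q ` Inr ` topspace (WK (bd \<sigma>))"
      unfolding quotient_imp_surjective_map[OF q, symmetric] by (simp add: topspace_coprod image_Un)
    moreover have "?q ` Inr ` topspace (WK (bd \<sigma>)) = (\<Union>\<tau>\<in>bd \<sigma>. (\<lambda>x. iota \<tau> \<sigma> (eta \<tau> x)) ` poly_set \<tau>)"
      unfolding WKtop image_UN image_image by (rule SUP_cong[OF refl]) (simp add: bd_def g)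
    ultimately show ?thesis
      by (simp add: image_image eta)
  qed
  have "weighted_colimit (Pow \<sigma>) (W \<sigma>) (\<lambda>\<tau> x. iota \<tau> \<sigma> (eta \<tau> x))"
    unfolding weighted_colimit_def
  proof (intro conjI ballI allI impI top)
    show "continuous_map (face_poly \<tau>) (W \<sigma>) (\<lambda>x. iota \<tau> \<sigma> (eta \<tau> x))" if "\<tau> \<in> Pow \<sigma>" for \<tau>
    proof (cases "\<tau> = \<sigma>")
      case True
      then show ?thesis using eta_cont by simp
    next
      case False
      then have "\<tau> \<subset> \<sigma>" using that by auto
      then have "continuous_map (face_poly \<tau>) (W \<tau>) (eta \<tau>)"
        using ok face_ok_eta_in(2) finite_subset[OF _ fin] by blast
      then show ?thesis using continuous_map_compose[OF _ iota_cont] that by (auto simp: o_def)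
    qed
    show "openin (W \<sigma>) U" if U: "U \<subseteq> topspace (W \<sigma>)"
      and op: "\<forall>\<tau>\<in>Pow \<sigma>. openin (face_poly \<tau>) {x \<in> poly_set \<tau>. iota \<tau> \<sigma> (eta \<tau> x) \<in> U}" for U
    proof -
      have "openin (WK (bd \<sigma>)) {c \<in> topspace (WK (bd \<sigma>)). ?q (Inr c) \<in> U}"
      proof -
        have crit: "\<And>V. V \<subseteq> topspace (WK (bd \<sigma>)) \<Longrightarrow> (\<And>\<tau>. \<tau> \<in> bd \<sigma> \<Longrightarrow>
            openin (face_poly \<tau>) {x \<in> poly_set \<tau>. inK (bd \<sigma>) \<tau> (eta \<tau> x) \<in> V}) \<Longrightarrow> openin (WK (bd \<sigma>)) V"
          by (rule weighted_colimitD(3)[OF wc]) simp_all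
        show ?thesis
        proof (rule crit)
          fix \<tau> assume \<tau>: "\<tau> \<in> bd \<sigma>"
          have "{x \<in> poly_set \<tau>. inK (bd \<sigma>) \<tau> (eta \<tau> x) \<in> {c \<in> topspace (WK (bd \<sigma>)). ?q (Inr c) \<in> U}}
            = {x \<in> poly_set \<tau>. iota \<tau> \<sigma> (eta \<tau> x) \<in> U}"
            using \<tau> WKtop g by (auto simp: bd_def)
          then show "openin (face_poly \<tau>) {x \<in> poly_set \<tau>. inK (bd \<sigma>) \<tau> (eta \<tau> x) \<in> {c \<in> topspace (WK (bd \<sigma>)). ?q (Inr c) \<in> U}}"
            using op \<tau> by (auto simp: bd_def)
        qed auto
      qed
      moreover have "openin (face_poly \<sigma>) {x \<in> poly_set \<sigma>. ?q (Inl x) \<in> U}"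
        using bspec[OF op, of \<sigma>] by (simp add: eta)
      moreover have "Inl -` {z \<in> topspace ?C. ?q z \<in> U} = {x \<in> poly_set \<sigma>. ?q (Inl x) \<in> U}"
        "Inr -` {z \<in> topspace ?C. ?q z \<in> U} = {c \<in> topspace (WK (bd \<sigma>)). ?q (Inr c) \<in> U}"
        by (auto simp: topspace_coprod)
      ultimately have "openin ?C {z \<in> topspace ?C. ?q z \<in> U}"
        by (simp add: openin_coprod)
      then show ?thesis using q U unfolding quotient_map_def by blast
    qed
    show "compatible (Pow \<sigma>) (\<lambda>\<tau> x. iota \<tau> \<sigma> (eta \<tau> x))"
      unfolding compatible_def
    proof (intro ballI allI impI)
      fix \<tau> \<mu> x assume \<tau>: "\<tau> \<in> Pow \<sigma>" and \<mu>: "\<mu> \<subseteq> \<tau>" and x: "x \<in> poly_set \<mu>"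
      show "iota \<tau> \<sigma> (eta \<tau> x) = iota \<mu> \<sigma> (eta \<mu> (cmap \<tau> \<mu> x))"
      proof (cases "\<tau> = \<sigma>")
        case True
        show ?thesis
        proof (cases "\<mu> = \<sigma>")
          case True
          with \<open>\<tau> = \<sigma>\<close> show ?thesis using cmap_self[OF \<sigma>(1) x] by simp
        next
          case False
          with \<open>\<tau> = \<sigma>\<close> have "\<mu> \<subset> \<sigma>" using \<mu> by auto
          with \<open>\<tau> = \<sigma>\<close> show ?thesis using glue[OF _ x] by (simp add: eta g)
        qed
      next
        case False
        then have \<tau>': "\<tau> \<subset> \<sigma>" using \<tau> by auto
        then have ft: "finite \<tau>" "\<tau> \<subseteq> {1..m}" using fin \<sigma>(1) finite_subset by auto
        have "eta \<tau> x = iota \<mu> \<tau> (eta \<mu> (cmap \<tau> \<mu> x))"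
          by (rule face_ok_eta[OF ok[OF \<tau>'] ft(1) \<mu> x])
        moreover have "eta \<mu> (cmap \<tau> \<mu> x) \<in> topspace (W \<mu>)"
          using cmap_in[OF ft(2) \<mu> x] \<tau>' \<mu> by (intro eta_in) (auto simp: bd_def)
        ultimately show ?thesis using funct \<tau>' \<mu> by auto
      qed
    qed
    fix \<tau>1 \<tau>2 x y
    assume \<tau>1: "\<tau>1 \<in> Pow \<sigma>" "\<tau>2 \<in> Pow \<sigma>" and xy: "x \<in> poly_set \<tau>1" "y \<in> poly_set \<tau>2"
      and eq: "iota \<tau>1 \<sigma> (eta \<tau>1 x) = iota \<tau>2 \<sigma> (eta \<tau>2 y)"
    let ?E = "face_equiv (Pow \<sigma>)"
    define N where "N = case_sum (\<lambda>x. ?E `` {(\<sigma>, x)})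
      (\<lambda>c. {b. \<exists>\<tau>\<in>bd \<sigma>. \<exists>y\<in>poly_set \<tau>. c = inK (bd \<sigma>) \<tau> (eta \<tau> y) \<and> ((\<tau>, y), b) \<in> ?E})"
    have N: "N (Inr (inK (bd \<sigma>) \<tau> (eta \<tau> y))) = ?E `` {(\<tau>, y)}" if \<tau>: "\<tau> \<in> bd \<sigma>" "y \<in> poly_set \<tau>" for \<tau> y
    proof -
      have "?E `` {(\<nu>, z)} = ?E `` {(\<tau>, y)}"
        if "\<nu> \<in> bd \<sigma>" "z \<in> poly_set \<nu>" "inK (bd \<sigma>) \<tau> (eta \<tau> y) = inK (bd \<sigma>) \<nu> (eta \<nu> z)" for \<nu> z
      proof -
        have "((\<nu>, z), (\<tau>, y)) \<in> face_equiv (bd \<sigma>)"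
          by (rule weighted_colimitD(5)[OF wc that(1) \<tau>(1) that(2) \<tau>(2) that(3)[symmetric]])
        then have "((\<nu>, z), (\<tau>, y)) \<in> ?E"
          by (rule subsetD[OF face_equiv_mono, rotated]) (auto simp: bd_def)
        then show ?thesis by (rule face_equiv_class)
      qed
      then show ?thesis using \<tau> unfolding N_def sum.case by blast
    qed
    have Nr: "N a = N b" if ab: "(a, b) \<in> pushout_rel (poly (bd \<sigma>)) (\<lambda>x. x) (eta_bd \<sigma>)" for a b
    proof -
      obtain x where x: "x \<in> topspace (poly (bd \<sigma>))" "a = Inl x" "b = Inr (eta_bd \<sigma> x)"
        using ab unfolding pushout_rel_def by blast
      then obtain \<tau> where \<tau>: "\<tau> \<in> bd \<sigma>" "x \<in> poly_set \<tau>" by (auto simp: topspace_poly)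
      then have \<tau>': "\<tau> \<subset> \<sigma>" by (simp add: bd_def)
      have "N b = ?E `` {(\<tau>, cmap \<sigma> \<tau> x)}"
        using N[OF \<tau>(1)] cmap_in[OF \<sigma>(1) _ \<tau>(2)] \<tau>' eta_bd_eq[OF \<sigma>(1) ok \<tau>' \<tau>(2)] x(3) by auto
      moreover have "N a = ?E `` {(\<sigma>, x)}" by (simp add: N_def x)
      moreover have "((\<sigma>, x), (\<tau>, cmap \<sigma> \<tau> x)) \<in> ?E"
        using \<tau>' \<tau>(2) by (intro face_equivI) auto
      ultimately show ?thesis using face_equiv_class by blast
    qed
    have Nq: "N (to_pushout \<sigma> z) = N z" for z
      unfolding to_pushout_def by (rule cls_respects[of _ N]) (rule Nr)
    define L where "L = (\<lambda>\<tau> x. if \<tau> = \<sigma> then Inl x else Inr (inK (bd \<sigma>) \<tau> (eta \<tau> x)))"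
    have L: "iota \<tau> \<sigma> (eta \<tau> x) = ?q (L \<tau> x)" "N (L \<tau> x) = ?E `` {(\<tau>, x)}" if "\<tau> \<in> Pow \<sigma>" "x \<in> poly_set \<tau>" for \<tau> x
    proof -
      show "iota \<tau> \<sigma> (eta \<tau> x) = ?q (L \<tau> x)"
        using that by (cases "\<tau> = \<sigma>") (auto simp: L_def eta g)
      show "N (L \<tau> x) = ?E `` {(\<tau>, x)}"
      proof (cases "\<tau> = \<sigma>")
        case True
        then show ?thesis by (simp add: L_def N_def)
      next
        case False
        then have "\<tau> \<in> bd \<sigma>" using that by (auto simp: bd_def)
        then show ?thesis using False N that by (simp add: L_def)
      qed
    qed
    have "to_pushout \<sigma> (L \<tau>1 x) = to_pushout \<sigma> (L \<tau>2 y)"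
      using eq L(1) \<tau>1 xy by simp
    then have "N (L \<tau>1 x) = N (L \<tau>2 y)" by (metis Nq)
    then have "?E `` {(\<tau>1, x)} = ?E `` {(\<tau>2, y)}" using L(2) \<tau>1 xy by simp
    moreover have "(\<tau>2, y) \<in> ?E `` {(\<tau>2, y)}" by (simp add: face_equiv_def)
    ultimately show "((\<tau>1, x), (\<tau>2, y)) \<in> ?E" by blast
  qed
  then show ?thesis
    unfolding face_ok_def using iota_cont funct by blast
qed

lemma face_ok: "\<sigma> \<subseteq> {1..m} \<Longrightarrow> face_ok \<sigma>"
proof (induction "card \<sigma>" arbitrary: \<sigma> rule: less_induct)
  case less
  have "finite \<sigma>" using less.prems finite_subset by blast
  then have "face_ok \<tau>" if "\<tau> \<subset> \<sigma>" for \<tau>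
    using less.hyps[of \<tau>] that less.prems psubset_card_mono by blast
  then show ?case
    using face_ok_empty face_ok_step less.prems by (cases "\<sigma> = {}") auto
qed

end

section \<open>Projections and quotient maps\<close>

lemma collapse_map_eq_iff: "collapse_map S x = collapse_map S y \<longleftrightarrow> x = y \<or> x \<in> S \<and> y \<in> S"
proof
  assume "collapse_map S x = collapse_map S y"
  then have "(x, y) \<in> (S \<times> S \<union> (S \<times> S)\<inverse>)\<^sup>*" by (simp add: collapse_map_def cls_eq_iff)
  then show "x = y \<or> x \<in> S \<and> y \<in> S" by induction auto
next
  assume "x = y \<or> x \<in> S \<and> y \<in> S"
  then show "collapse_map S x = collapse_map S y"
    unfolding collapse_map_def by (auto intro: cls_eqI)
qed

lemma collapse_map_outside: "x \<notin> S \<Longrightarrow> collapse_map S x = x"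
  using cls_rel[of x "S \<times> S"] unfolding collapse_map_def by (metis collapse_map_def collapse_map_eq_iff cls_eq_iff)

lemma collapse_map_respects: "(\<And>x y. x \<in> S \<Longrightarrow> y \<in> S \<Longrightarrow> f x = f y) \<Longrightarrow> f (collapse_map S x) = f x"
  unfolding collapse_map_def by (rule cls_respects) auto

lemma collapse_map_idem [simp]: "collapse_map S (collapse_map S x) = collapse_map S x"
  by (rule collapse_map_respects[of S "collapse_map S"]) (simp add: collapse_map_eq_iff)

lemma quotient_map_collapse: "quotient_map Y (collapse Y S) (collapse_map S)"
  unfolding collapse_def collapse_map_def by (rule quotient_map_quot)

lemma topspace_collapse: "topspace (collapse Y S) = collapse_map S ` topspace Y"
  by (rule quotient_imp_surjective_map[OF quotient_map_collapse, symmetric])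

lemma continuous_map_collapseI:
  "continuous_map Y Z f \<Longrightarrow> (\<And>x y. x \<in> S \<Longrightarrow> y \<in> S \<Longrightarrow> f x = f y) \<Longrightarrow> continuous_map (collapse Y S) Z f"
  unfolding collapse_def by (rule continuous_map_quotI) auto

context weighted_polyhedral
begin

lemma finite_face: "\<sigma> \<subseteq> {1..m} \<Longrightarrow> finite \<sigma>"
  using finite_subset by blast

lemmas W_colimit = face_okD(1)[OF face_ok]
lemmas iota_continuous = face_okD(2)[OF face_ok]
lemmas iota_iota = face_okD(3)[OF face_ok]
lemmas eta_face = face_ok_eta[OF face_ok finite_face]
lemmas eta_in = face_ok_eta_in(1)[OF face_ok finite_face]

lemma iota_in: "\<sigma> \<subseteq> {1..m} \<Longrightarrow> \<tau> \<subseteq> \<sigma> \<Longrightarrow> w \<in> topspace (W \<tau>) \<Longrightarrow> iota \<tau> \<sigma> w \<in> topspace (W \<sigma>)"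
  using funcset_mem[OF continuous_map_funspace[OF iota_continuous]] by blast

lemma W_point:
  assumes "\<sigma> \<subseteq> {1..m}" "w \<in> topspace (W \<sigma>)"
  obtains \<tau> x where "\<tau> \<subseteq> \<sigma>" "x \<in> poly_set \<tau>" "w = iota \<tau> \<sigma> (eta \<tau> x)"
  using weighted_colimitD(2)[OF W_colimit[OF assms(1)]] assms(2) by auto

text \<open>
  The two conditions prescribe the map on the product over every face of \<open>\<delta>\<close>. The
  prescribed values are compatible because projections commute with the power maps.
\<close>

lemma projection_family_exists:
  assumes \<tau>: "\<tau> \<subseteq> {1..m}"
  shows "\<exists>P. projection_family \<tau> P"
proof -
  define h where "h = (\<lambda>\<delta> \<mu> x. iota (\<mu> \<inter> \<tau>) (\<delta> \<inter> \<tau>) (eta (\<mu> \<inter> \<tau>) (cmap \<mu> (\<mu> \<inter> \<tau>) (proj \<tau> x))))"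
  have inn: "eta (\<mu> \<inter> \<tau>) (cmap \<mu> (\<mu> \<inter> \<tau>) (proj \<tau> x)) \<in> topspace (W (\<mu> \<inter> \<tau>))"
    if "\<mu> \<subseteq> {1..m}" "x \<in> poly_set \<mu>" for \<mu> x
    using that by (intro eta_in cmap_in proj_in) auto
  have comp: "compatible (Pow \<delta>) (h \<delta>)" if \<delta>: "\<delta> \<subseteq> {1..m}" for \<delta>
    unfolding compatible_def
  proof (intro ballI allI impI)
    fix \<mu> \<nu> x assume "\<mu> \<in> Pow \<delta>" and \<nu>: "\<nu> \<subseteq> \<mu>" and x: "x \<in> poly_set \<nu>"
    then have \<mu>: "\<mu> \<subseteq> \<delta>" "\<mu> \<subseteq> {1..m}" "\<nu> \<subseteq> {1..m}" using \<delta> by auto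
    have z: "cmap \<mu> (\<mu> \<inter> \<tau>) (proj \<tau> x) \<in> poly_set (\<nu> \<inter> \<tau>)"
      by (rule cmap_in[OF \<mu>(2) _ proj_in[OF x]]) simp
    have "eta (\<mu> \<inter> \<tau>) (cmap \<mu> (\<mu> \<inter> \<tau>) (proj \<tau> x)) =
        iota (\<nu> \<inter> \<tau>) (\<mu> \<inter> \<tau>) (eta (\<nu> \<inter> \<tau>) (cmap (\<mu> \<inter> \<tau>) (\<nu> \<inter> \<tau>) (cmap \<mu> (\<mu> \<inter> \<tau>) (proj \<tau> x))))"
      by (rule eta_face[OF _ _ _ z]) (use \<mu> \<nu> in auto)
    also have "cmap (\<mu> \<inter> \<tau>) (\<nu> \<inter> \<tau>) (cmap \<mu> (\<mu> \<inter> \<tau>) (proj \<tau> x)) = cmap \<mu> (\<nu> \<inter> \<tau>) (proj \<tau> x)"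
      by (rule cmap_cmap[OF \<mu>(2) _ _ proj_in[OF x]]) (use \<nu> in auto)
    also have "\<dots> = cmap \<nu> (\<nu> \<inter> \<tau>) (proj \<tau> (cmap \<mu> \<nu> x))"
      using cmap_cmap[OF \<mu>(2) \<nu> _ proj_in[OF x], of "\<nu> \<inter> \<tau>" \<tau>] by (simp add: cmap_proj[OF \<mu>(2) \<nu>])
    finally have "h \<delta> \<mu> x = iota (\<mu> \<inter> \<tau>) (\<delta> \<inter> \<tau>) (iota (\<nu> \<inter> \<tau>) (\<mu> \<inter> \<tau>) (eta (\<nu> \<inter> \<tau>) (cmap \<nu> (\<nu> \<inter> \<tau>) (proj \<tau> (cmap \<mu> \<nu> x)))))"
      by (simp add: h_def)
    also have "\<dots> = h \<delta> \<nu> (cmap \<mu> \<nu> x)"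
      unfolding h_def
      by (rule iota_iota[OF _ _ _ inn[OF \<mu>(3) cmap_in[OF \<mu>(2) \<nu> x]]]) (use \<mu> \<nu> \<delta> in auto)
    finally show "h \<delta> \<mu> x = h \<delta> \<nu> (cmap \<mu> \<nu> x)" .
  qed
  have ex: "\<exists>k. \<forall>\<mu>\<in>Pow \<delta>. \<forall>x\<in>poly_set \<mu>. k (iota \<mu> \<delta> (eta \<mu> x)) = h \<delta> \<mu> x" if "\<delta> \<subseteq> {1..m}" for \<delta>
    by (rule weighted_colimit_point_lift[OF W_colimit[OF that] comp[OF that]])
  define P where "P = (\<lambda>\<delta>. SOME k. \<forall>\<mu>\<in>Pow \<delta>. \<forall>x\<in>poly_set \<mu>. k (iota \<mu> \<delta> (eta \<mu> x)) = h \<delta> \<mu> x)"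
  have P: "P \<delta> (iota \<mu> \<delta> (eta \<mu> x)) = h \<delta> \<mu> x" if "\<delta> \<subseteq> {1..m}" "\<mu> \<subseteq> \<delta>" "x \<in> poly_set \<mu>" for \<delta> \<mu> x
    using someI_ex[OF ex[OF that(1)]] that(2,3) unfolding P_def by simp
  have "projection_family \<tau> P"
    unfolding projection_family_def
  proof (intro allI impI conjI ballI)
    fix \<delta> x assume \<delta>: "\<delta> \<subseteq> {1..m}" and x: "x \<in> poly_set \<delta>"
    have "finite (\<delta> \<inter> \<tau>)" using finite_face[OF \<delta>] by simp
    then show "P \<delta> (eta \<delta> x) = eta (\<delta> \<inter> \<tau>) (cmap \<delta> (\<delta> \<inter> \<tau>) (proj \<tau> x))"
      using P[OF \<delta> subset_refl x] by (simp add: iota_self finite_face[OF \<delta>] h_def)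
  next
    fix \<delta> \<mu> w assume \<delta>: "\<delta> \<subseteq> {1..m}" and "\<mu> \<subset> \<delta>" and w: "w \<in> topspace (W \<mu>)"
    then have \<mu>: "\<mu> \<subseteq> \<delta>" "\<mu> \<subseteq> {1..m}" by auto
    obtain \<nu> x where \<nu>: "\<nu> \<subseteq> \<mu>" "x \<in> poly_set \<nu>" "w = iota \<nu> \<mu> (eta \<nu> x)"
      using W_point[OF \<mu>(2) w] by blast
    have \<nu>': "\<nu> \<subseteq> {1..m}" "\<nu> \<subseteq> \<delta>" using \<nu> \<mu> by auto
    have "P \<delta> (iota \<mu> \<delta> w) = P \<delta> (iota \<nu> \<delta> (eta \<nu> x))"
      unfolding \<nu>(3) by (subst iota_iota[OF \<delta> \<mu>(1) \<nu>(1) eta_in[OF \<nu>'(1) \<nu>'(1) \<nu>(2)]]) simp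
    also have "\<dots> = h \<delta> \<nu> x" by (rule P[OF \<delta> \<nu>'(2) \<nu>(2)])
    also have "\<dots> = iota (\<mu> \<inter> \<tau>) (\<delta> \<inter> \<tau>) (h \<mu> \<nu> x)"
      unfolding h_def
      by (rule iota_iota[symmetric, OF _ _ _ inn[OF \<nu>'(1) \<nu>(2)]]) (use \<mu> \<nu> \<delta> in auto)
    also have "h \<mu> \<nu> x = P \<mu> w"
      using P[OF \<mu>(2) \<nu>(1,2)] \<nu>(3) by simp
    finally show "P \<delta> (iota \<mu> \<delta> w) = iota (\<mu> \<inter> \<tau>) (\<delta> \<inter> \<tau>) (P \<mu> w)" .
  qed
  then show ?thesis by blast
qed

context
  fixes \<tau> assumes \<tau>: "\<tau> \<subseteq> {1..m}"
begin

lemma p_family: "projection_family \<tau> (p \<tau>)"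
  unfolding p_def by (rule someI_ex[of "projection_family \<tau>", OF projection_family_exists[OF \<tau>]])

lemma p_eta: "\<delta> \<subseteq> {1..m} \<Longrightarrow> x \<in> poly_set \<delta> \<Longrightarrow> p \<tau> \<delta> (eta \<delta> x) = eta (\<delta> \<inter> \<tau>) (cmap \<delta> (\<delta> \<inter> \<tau>) (proj \<tau> x))"
  using p_family unfolding projection_family_def by simp

lemma p_iota:
  assumes "\<delta> \<subseteq> {1..m}" "\<mu> \<subseteq> \<delta>" "w \<in> topspace (W \<mu>)"
  shows "p \<tau> \<delta> (iota \<mu> \<delta> w) = iota (\<mu> \<inter> \<tau>) (\<delta> \<inter> \<tau>) (p \<tau> \<mu> w)"
proof (cases "\<mu> = \<delta>")
  case True
  have "finite \<delta>" "finite (\<delta> \<inter> \<tau>)" using finite_face[OF assms(1)] by auto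
  then show ?thesis by (simp add: True iota_self)
next
  case False
  then show ?thesis using p_family assms unfolding projection_family_def by blast
qed

lemma p_in:
  assumes \<delta>: "\<delta> \<subseteq> {1..m}" and w: "w \<in> topspace (W \<delta>)"
  shows "p \<tau> \<delta> w \<in> topspace (W (\<delta> \<inter> \<tau>))"
proof -
  obtain \<nu> x where \<nu>: "\<nu> \<subseteq> \<delta>" "x \<in> poly_set \<nu>" "w = iota \<nu> \<delta> (eta \<nu> x)"
    using W_point[OF \<delta> w] by blast
  have \<nu>': "\<nu> \<subseteq> {1..m}" using \<nu> \<delta> by auto
  have "p \<tau> \<delta> w = iota (\<nu> \<inter> \<tau>) (\<delta> \<inter> \<tau>) (eta (\<nu> \<inter> \<tau>) (cmap \<nu> (\<nu> \<inter> \<tau>) (proj \<tau> x)))"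
    unfolding \<nu>(3) by (simp add: p_iota[OF \<delta> \<nu>(1) eta_in[OF \<nu>' \<nu>' \<nu>(2)]] p_eta[OF \<nu>' \<nu>(2)])
  moreover have "eta (\<nu> \<inter> \<tau>) (cmap \<nu> (\<nu> \<inter> \<tau>) (proj \<tau> x)) \<in> topspace (W (\<nu> \<inter> \<tau>))"
    using \<nu>' \<nu>(2) by (intro eta_in cmap_in proj_in) auto
  ultimately show ?thesis
    using iota_in[of "\<delta> \<inter> \<tau>" "\<nu> \<inter> \<tau>"] \<delta> \<nu>(1) by auto
qed

lemma fat_wedge_iff: "x \<in> fat_wedge \<tau> \<longleftrightarrow> (\<exists>\<mu>. \<mu> \<subset> \<tau> \<and> x \<in> poly_set \<mu>)"
  by (auto simp: fat_wedge_def topspace_poly bd_def)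

text \<open>
  The function that remembers a point of the product over \<open>\<tau>\<close> outside the fat wedge and sends
  everything else to \<open>None\<close> is compatible. It descends to \<open>W \<tau>\<close> and separates these points from each other
  and from the boundary.
\<close>

lemma eta_kernel:
  assumes z: "z \<in> poly_set \<tau>" and \<mu>: "\<mu> \<subseteq> \<tau>" "y \<in> poly_set \<mu>" and eq: "eta \<tau> z = iota \<mu> \<tau> (eta \<mu> y)"
  shows "z \<in> fat_wedge \<tau> \<or> \<mu> = \<tau> \<and> z = y"
proof -
  let ?f = "\<lambda>\<sigma> x. if \<sigma> = \<tau> \<and> x \<notin> fat_wedge \<tau> then Some x else None"
  have comp: "compatible (Pow \<tau>) ?f"
    unfolding compatible_def
  proof (intro ballI allI impI)
    fix \<sigma> \<nu> x assume \<sigma>: "\<sigma> \<in> Pow \<tau>" and \<nu>: "\<nu> \<subseteq> \<sigma>" and x: "x \<in> poly_set \<nu>"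
    show "?f \<sigma> x = ?f \<nu> (cmap \<sigma> \<nu> x)"
    proof (cases "\<nu> = \<tau>")
      case True
      then have "\<sigma> = \<tau>" using \<sigma> \<nu> by auto
      then show ?thesis using True cmap_self[OF \<tau> x] by simp
    next
      case False
      then have "x \<in> fat_wedge \<tau>" using \<sigma> \<nu> x unfolding fat_wedge_iff by blast
      then show ?thesis using False by simp
    qed
  qed
  have "iota \<tau> \<tau> (eta \<tau> z) = iota \<mu> \<tau> (eta \<mu> y)" using eq by (simp add: iota_self finite_face[OF \<tau>])
  then have "((\<tau>, z), (\<mu>, y)) \<in> face_equiv (Pow \<tau>)"
    using weighted_colimitD(5)[OF W_colimit[OF \<tau>], of \<tau> \<mu> z y] z \<mu> by simp
  from compatible_kernel[OF comp this] show ?thesis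
    by (auto split: if_splits)
qed

lemma W_bd_iff:
  assumes z: "z \<in> poly_set \<tau>"
  shows "eta \<tau> z \<in> W_bd \<tau> \<longleftrightarrow> z \<in> fat_wedge \<tau>"
proof
  assume "z \<in> fat_wedge \<tau>"
  then obtain \<mu> where \<mu>: "\<mu> \<subset> \<tau>" "z \<in> poly_set \<mu>" unfolding fat_wedge_iff by blast
  then have \<mu>': "\<mu> \<subseteq> \<tau>" "\<mu> \<subseteq> {1..m}" using \<tau> by auto
  have "eta \<tau> z = iota \<mu> \<tau> (eta \<mu> (cmap \<tau> \<mu> z))"
    by (rule eta_face[OF \<tau> \<tau> \<mu>'(1) \<mu>(2)])
  moreover have "eta \<mu> (cmap \<tau> \<mu> z) \<in> topspace (W \<mu>)"
    by (rule eta_in[OF \<mu>'(2) \<mu>'(2) cmap_in[OF \<tau> \<mu>'(1) \<mu>(2)]])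
  ultimately show "eta \<tau> z \<in> W_bd \<tau>"
    using \<mu>(1) unfolding W_bd_def bd_def by blast
next
  assume "eta \<tau> z \<in> W_bd \<tau>"
  then obtain \<mu> w where \<mu>: "\<mu> \<subset> \<tau>" "w \<in> topspace (W \<mu>)" "eta \<tau> z = iota \<mu> \<tau> w"
    by (auto simp: W_bd_def bd_def)
  have \<mu>': "\<mu> \<subseteq> {1..m}" using \<mu> \<tau> by auto
  obtain \<nu> x where \<nu>: "\<nu> \<subseteq> \<mu>" "x \<in> poly_set \<nu>" "w = iota \<nu> \<mu> (eta \<nu> x)"
    using W_point[OF \<mu>' \<mu>(2)] by blast
  have "\<nu> \<subseteq> {1..m}" using \<nu> \<mu>' by auto
  then have "eta \<tau> z = iota \<nu> \<tau> (eta \<nu> x)"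
    using \<mu> \<nu> iota_iota[OF \<tau> _ \<nu>(1) eta_in[of \<nu>]] by auto
  then show "z \<in> fat_wedge \<tau>"
    using eta_kernel[OF z _ \<nu>(2)] \<nu>(1) \<mu>(1) by auto
qed

lemma topspace_smash: "topspace (fst (smash \<tau>)) = collapse_map (fat_wedge \<tau>) ` poly_set \<tau>"
  by (simp add: smash_def topspace_collapse)

lemma fat_wedge_subset: "fat_wedge \<tau> \<subseteq> poly_set \<tau>"
  using poly_set_mono unfolding fat_wedge_iff[abs_def] subset_iff by blast

text \<open>
  By \<open>eta_kernel\<close> the map induced by \<open>eta \<tau>\<close> on the quotient by the fat wedge is injective, so the inverse
  in the definition of \<open>qc\<close> recovers the class of \<open>x\<close>.
\<close>

lemma qc_eta:
  assumes x: "x \<in> poly_set \<tau>"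
  shows "qc \<tau> (eta \<tau> x) = collapse_map (fat_wedge \<tau>) x"
proof -
  have eb: "eta_bar \<tau> (collapse_map (fat_wedge \<tau>) x) = collapse_map (W_bd \<tau>) (eta \<tau> x)" if "x \<in> poly_set \<tau>" for x
    unfolding eta_bar_def
    by (rule collapse_map_respects[where f = "\<lambda>z. collapse_map (W_bd \<tau>) (eta \<tau> z)"])
      (use W_bd_iff fat_wedge_subset in \<open>auto simp: collapse_map_eq_iff\<close>)
  have "inj_on (eta_bar \<tau>) (topspace (fst (smash \<tau>)))"
  proof (rule inj_onI)
    fix a b assume a: "a \<in> topspace (fst (smash \<tau>))" and b: "b \<in> topspace (fst (smash \<tau>))" and eq: "eta_bar \<tau> a = eta_bar \<tau> b"
    obtain x y where x: "x \<in> poly_set \<tau>" "a = collapse_map (fat_wedge \<tau>) x"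
      and y: "y \<in> poly_set \<tau>" "b = collapse_map (fat_wedge \<tau>) y"
      using a b unfolding topspace_smash by blast
    have "eta \<tau> x = eta \<tau> y \<or> eta \<tau> x \<in> W_bd \<tau> \<and> eta \<tau> y \<in> W_bd \<tau>"
      using eq eb x y by (simp add: collapse_map_eq_iff)
    then have "x = y \<or> x \<in> fat_wedge \<tau> \<and> y \<in> fat_wedge \<tau>"
    proof
      assume eq: "eta \<tau> x = eta \<tau> y"
      then have "x \<in> fat_wedge \<tau> \<longleftrightarrow> y \<in> fat_wedge \<tau>" using W_bd_iff x y by metis
      then show ?thesis
        using eta_kernel[OF x(1) subset_refl y(1)] eq by (auto simp: iota_self finite_face[OF \<tau>])
    qed (use W_bd_iff x y in blast)
    then show "a = b" using x y by (simp add: collapse_map_eq_iff)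
  qed
  moreover have "collapse_map (fat_wedge \<tau>) x \<in> topspace (fst (smash \<tau>))"
    using x unfolding topspace_smash by blast
  ultimately show ?thesis
    unfolding qc_def eb[OF x, symmetric] by simp
qed

lemma base_in_fat_wedge: "\<tau> \<noteq> {} \<Longrightarrow> base_point \<in> fat_wedge \<tau>"
  unfolding fat_wedge_iff by (intro exI[of _ "{}"]) auto

lemma qc_bd:
  assumes "w \<in> W_bd \<tau>"
  shows "qc \<tau> w = collapse_map (fat_wedge \<tau>) base_point"
proof -
  have "\<tau> \<noteq> {}" using assms by (auto simp: W_bd_def bd_def)
  then have "eta \<tau> base_point \<in> W_bd \<tau>" using W_bd_iff[of base_point] base_in_fat_wedge by simp
  then have "collapse_map (W_bd \<tau>) w = collapse_map (W_bd \<tau>) (eta \<tau> base_point)"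
    using assms by (simp add: collapse_map_eq_iff)
  then have "qc \<tau> w = qc \<tau> (eta \<tau> base_point)"
    by (simp add: qc_def)
  then show ?thesis by (simp add: qc_eta)
qed

end

text \<open>
  The map \<open>f\<^sub>\<tau>\<close>, whose suspension is the component of \<open>e\<close> that belongs to \<open>\<tau>\<close>.
\<close>

definition face_map :: "nat set \<Rightarrow> nat set \<times> 'a wpoint \<Rightarrow> nat \<Rightarrow> 'a" where
  "face_map \<tau> z = qc \<tau> (pK \<tau> z)"

lemma pK_inK:
  assumes K: "simplicial_complex_on m K" and \<delta>: "\<delta> \<in> K" and \<tau>: "\<tau> \<subseteq> {1..m}"
  shows "pK \<tau> (inK K \<delta> w) = iota (\<delta> \<inter> \<tau>) \<tau> (p \<tau> \<delta> w)"
proof -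
  have "pK \<tau> a = pK \<tau> b" if ab: "(a, b) \<in> colim_rel K W iota" for a b
  proof -
    obtain \<mu> \<nu> w where a: "a = (\<mu>, w)" "b = (\<nu>, iota \<mu> \<nu> w)" and \<mu>: "\<mu> \<in> K" "\<nu> \<in> K" "\<mu> \<subseteq> \<nu>" and w: "w \<in> topspace (W \<mu>)"
      using ab unfolding colim_rel_def by blast
    have s: "\<mu> \<subseteq> {1..m}" "\<nu> \<subseteq> {1..m}" using K \<mu> unfolding simplicial_complex_on_def by blast+
    have "iota (\<nu> \<inter> \<tau>) \<tau> (iota (\<mu> \<inter> \<tau>) (\<nu> \<inter> \<tau>) (p \<tau> \<mu> w)) = iota (\<mu> \<inter> \<tau>) \<tau> (p \<tau> \<mu> w)"
      by (rule iota_iota[OF \<tau> _ _ p_in[OF \<tau> s(1) w]]) (use \<mu> in auto)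
    then show ?thesis by (simp add: a pK_def p_iota[OF \<tau> s(2) \<mu>(3) w])
  qed
  then have "pK \<tau> (cls (colim_rel K W iota) (\<delta>, w)) = pK \<tau> (\<delta>, w)"
    by (rule cls_respects)
  then show ?thesis by (simp add: inK_def pK_def)
qed

text \<open>
  On a face that does not contain \<open>\<tau>\<close> the projection has its values in the boundary, which is collapsed.
\<close>

lemma face_map_inK:
  assumes K: "simplicial_complex_on m K" and \<delta>: "\<delta> \<in> K" and \<tau>: "\<tau> \<subseteq> {1..m}" and x: "x \<in> poly_set \<delta>"
  shows "face_map \<tau> (inK K \<delta> (eta \<delta> x)) =
    collapse_map (fat_wedge \<tau>) (if \<tau> \<subseteq> \<delta> then cmap \<delta> \<tau> (proj \<tau> x) else base_point)"
proof -
  have d: "\<delta> \<subseteq> {1..m}" using K \<delta> unfolding simplicial_complex_on_def by blast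
  have f: "face_map \<tau> (inK K \<delta> (eta \<delta> x)) = qc \<tau> (iota (\<delta> \<inter> \<tau>) \<tau> (eta (\<delta> \<inter> \<tau>) (cmap \<delta> (\<delta> \<inter> \<tau>) (proj \<tau> x))))"
    unfolding face_map_def pK_inK[OF K \<delta> \<tau>] p_eta[OF \<tau> d x] by simp
  show ?thesis
  proof (cases "\<tau> \<subseteq> \<delta>")
    case True
    then have "\<delta> \<inter> \<tau> = \<tau>" by blast
    moreover have "cmap \<delta> \<tau> (proj \<tau> x) \<in> poly_set \<tau>"
      using cmap_in[OF d True proj_in[OF x, of \<tau>]] calculation by simp
    ultimately show ?thesis
      using True by (simp add: f qc_eta[OF \<tau>] iota_self finite_face[OF \<tau>])
  next
    case False
    then have "\<delta> \<inter> \<tau> \<subset> \<tau>" by blast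
    moreover have "eta (\<delta> \<inter> \<tau>) (cmap \<delta> (\<delta> \<inter> \<tau>) (proj \<tau> x)) \<in> topspace (W (\<delta> \<inter> \<tau>))"
      using d x by (intro eta_in cmap_in proj_in) auto
    ultimately have "iota (\<delta> \<inter> \<tau>) \<tau> (eta (\<delta> \<inter> \<tau>) (cmap \<delta> (\<delta> \<inter> \<tau>) (proj \<tau> x))) \<in> W_bd \<tau>"
      by (auto simp: W_bd_def bd_def)
    then show ?thesis using False by (simp add: f qc_bd[OF \<tau>])
  qed
qed

end

section \<open>Attaching one face at a time\<close>

lemma k_space_prod_I01: "k_space Y \<Longrightarrow> k_space (prod_topology I01 Y)"
  by (intro k_space_prod_topology_left compact_imp_locally_compact_space disjI1)
    (simp_all add: compact_space_subtopology Hausdorff_space_subtopology)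

lemma continuous_map_Min:
  fixes f :: "'i \<Rightarrow> 'x \<Rightarrow> real"
  assumes "finite I" "I \<noteq> {}" "\<And>i. i \<in> I \<Longrightarrow> continuous_map X euclideanreal (f i)"
  shows "continuous_map X euclideanreal (\<lambda>x. Min ((\<lambda>i. f i x) ` I))"
  using assms
proof (induction I rule: finite_ne_induct)
  case (insert i I)
  then have "(\<lambda>x. Min ((\<lambda>i. f i x) ` insert i I)) = (\<lambda>x. min (f i x) (Min ((\<lambda>i. f i x) ` I)))"
    by (simp add: Min_insert)
  then show ?case using insert by (simp add: continuous_map_real_min)
qed simp

context weighted_polyhedral
begin

lemma fat_wedge_coordinate:
  assumes "\<sigma> \<subseteq> {1..m}" "x \<in> poly_set \<sigma>"
  shows "x \<in> fat_wedge \<sigma> \<longleftrightarrow> (\<exists>i\<in>\<sigma>. x i = pt i)"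
proof
  assume "x \<in> fat_wedge \<sigma>"
  then obtain \<mu> where "\<mu> \<subset> \<sigma>" "x \<in> poly_set \<mu>" using fat_wedge_iff[OF assms(1)] by blast
  then show "\<exists>i\<in>\<sigma>. x i = pt i" using assms(1) by (auto simp: poly_set_iff)
next
  assume "\<exists>i\<in>\<sigma>. x i = pt i"
  then obtain i where "i \<in> \<sigma>" "x i = pt i" by blast
  then have "\<sigma> - {i} \<subset> \<sigma>" "x \<in> poly_set (\<sigma> - {i})" using assms(2) by (auto simp: poly_set_iff)
  then show "x \<in> fat_wedge \<sigma>" using fat_wedge_iff[OF assms(1)] by blast
qed

text \<open>
  Each coordinate is moved by its own Strom structure, but stops at the time when some other coordinate
  would reach the base point. If a coordinate starts at the base point, the others therefore
  do not move at all. On the other hand the coordinate with the smallest \<open>\<phi>\<close> is never stopped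
  before it arrives, so \<open>\<phi>\<close> of the product is the minimum.
\<close>

lemma fat_wedge_strom:
  assumes \<sigma>: "\<sigma> \<subseteq> {1..m}" "\<sigma> \<noteq> {}"
  shows "\<exists>\<phi> H. strom_structure (face_poly \<sigma>) (fat_wedge \<sigma>) \<phi> H"
proof -
  have "\<forall>i. \<exists>\<phi> H. i \<in> {1..m} \<longrightarrow> strom_structure (X i) {pt i} \<phi> H"
    using pt_strom by blast
  then obtain \<phi> H where S: "\<And>i. i \<in> {1..m} \<Longrightarrow> strom_structure (X i) {pt i} (\<phi> i) (H i)"
    by metis
  have fin: "finite \<sigma>" by (rule finite_face[OF \<sigma>(1)])
  have in_m: "i \<in> {1..m}" if "i \<in> \<sigma>" for i using that \<sigma>(1) by blast
  note St = S[unfolded strom_structure_def, OF in_m]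
  have \<phi>c: "continuous_map (X i) euclideanreal (\<phi> i)" if "i \<in> \<sigma>" for i using St[OF that] by blast
  have \<phi>0: "0 \<le> \<phi> i x" if "i \<in> \<sigma>" "x \<in> topspace (X i)" for i x using St[OF that(1)] that(2) by blast
  have Hc: "continuous_map (prod_topology I01 (X i)) (X i) (\<lambda>(t, x). H i t x)" if "i \<in> \<sigma>" for i
    using St[OF that] by blast
  have H0: "H i 0 x = x" if "i \<in> \<sigma>" "x \<in> topspace (X i)" for i x using St[OF that(1)] that(2) by blast
  have \<phi>pt: "\<phi> i (pt i) = 0" if "i \<in> \<sigma>" for i using St[OF that] by blast
  have Hpt: "H i t (pt i) = pt i" if "i \<in> \<sigma>" "t \<in> {0..1}" for i t using St[OF that(1)] that(2) by blast
  have HA: "H i t x = pt i" if "i \<in> \<sigma>" "x \<in> topspace (X i)" "t \<in> {0..1}" "\<phi> i x \<le> t" for i x t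
    using St[OF that(1)] that(2-4) by blast
  have coord: "x i \<in> topspace (X i)" if "x \<in> poly_set \<sigma>" "i \<in> \<sigma>" for x i
    using that in_m by (auto simp: poly_set_iff)
  define \<psi> where "\<psi> = (\<lambda>x. Min ((\<lambda>i. \<phi> i (x i)) ` \<sigma>))"
  \<comment> \<open>The time for which coordinate \<open>j\<close> is moved: no longer than the other coordinates allow.\<close>
  define s where "s = (\<lambda>j t x. Min (insert t ((\<lambda>i. \<phi> i (x i)) ` (\<sigma> - {j}))))"
  define D where "D = (\<lambda>t x. \<lambda>j\<in>{1..m}. if j \<in> \<sigma> then H j (s j t x) (x j) else pt j)"
  have s01: "0 \<le> s j t x \<and> s j t x \<le> 1" if "t \<in> {0..1}" "x \<in> poly_set \<sigma>" for j t x
  proof -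
    have "s j t x \<le> t" using fin by (simp add: s_def)
    moreover have "0 \<le> s j t x"
      unfolding s_def using fin that \<phi>0 coord by (subst Min_ge_iff) auto
    ultimately show ?thesis using that by auto
  qed
  have s_le: "s j t x \<le> \<phi> i (x i)" if "i \<in> \<sigma>" "i \<noteq> j" for i j t x
    unfolding s_def using fin that by (intro Min_le) auto
  let ?P = "prod_topology I01 (face_poly \<sigma>)"
  have xc: "continuous_map ?P (X i) (\<lambda>p. snd p i)" if "i \<in> \<sigma>" for i
    using continuous_map_compose[OF continuous_map_snd continuous_map_face_poly_coordinate[OF in_m[OF that]], of I01]
    by (simp add: o_def)
  have tc: "continuous_map ?P euclideanreal fst"
    using continuous_map_fst[of I01 "face_poly \<sigma>"] by (simp add: continuous_map_into_I01)
  have \<phi>x: "continuous_map ?P euclideanreal (\<lambda>p. \<phi> i (snd p i))" if "i \<in> \<sigma>" for i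
    using continuous_map_compose[OF xc[OF that] \<phi>c[OF that]] by (simp add: o_def)
  have sc: "continuous_map ?P euclideanreal (\<lambda>p. s j (fst p) (snd p))" for j
  proof -
    let ?f = "\<lambda>k p. case k of None \<Rightarrow> fst p | Some i \<Rightarrow> \<phi> i (snd p i)"
    have "continuous_map ?P euclideanreal (\<lambda>p. Min ((\<lambda>k. ?f k p) ` (insert None (Some ` (\<sigma> - {j})))))"
      using fin tc \<phi>x by (intro continuous_map_Min) auto
    then show ?thesis by (simp add: s_def image_image)
  qed
  have Dc: "continuous_map ?P (face_poly \<sigma>) (\<lambda>(t, x). D t x)"
  proof (rule continuous_map_into_face_poly)
    show "k_space ?P"
      by (rule k_space_prod_I01[OF k_space_face_poly])
    show "continuous_map ?P (X j) (\<lambda>p. (case p of (t, x) \<Rightarrow> D t x) j)" if j: "j \<in> {1..m}" for j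
    proof (cases "j \<in> \<sigma>")
      case True
      have "continuous_map ?P (prod_topology I01 (X j)) (\<lambda>p. (s j (fst p) (snd p), snd p j))"
        using sc[of j] xc[OF True] s01 by (auto simp: continuous_map_paired continuous_map_into_I01)
      from continuous_map_compose[OF this Hc[OF True]] show ?thesis
        using True j by (simp add: o_def D_def case_prod_unfold)
    next
      case False
      then show ?thesis using j pt_in[OF j] by (simp add: D_def case_prod_unfold)
    qed
    show "(case p of (t, x) \<Rightarrow> D t x) \<in> poly_set \<sigma>" if pP: "p \<in> topspace ?P" for p
    proof -
      obtain t x where p: "p = (t, x)" "t \<in> {0..1}" "x \<in> poly_set \<sigma>" using pP by auto
      have "H j (s j t x) (x j) \<in> topspace (X j)" if "j \<in> \<sigma>" for j
        using funcset_mem[OF continuous_map_funspace[OF Hc[OF that]], of "(s j t x, x j)"] s01[OF p(2,3)] coord[OF p(3) that]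
        by auto
      then show ?thesis using pt_in by (auto simp: p poly_set_iff D_def)
    qed
  qed
  have "strom_structure (face_poly \<sigma>) (fat_wedge \<sigma>) \<psi> D"
    unfolding strom_structure_def
  proof (intro conjI ballI impI)
    show "fat_wedge \<sigma> \<subseteq> topspace (face_poly \<sigma>)"
      using fat_wedge_subset[OF \<sigma>(1)] by simp
    show "continuous_map (face_poly \<sigma>) euclideanreal \<psi>"
      unfolding \<psi>_def
    proof (rule continuous_map_Min[OF fin \<sigma>(2)])
      show "continuous_map (face_poly \<sigma>) euclideanreal (\<lambda>x. \<phi> i (x i))" if "i \<in> \<sigma>" for i
        using continuous_map_compose[OF continuous_map_face_poly_coordinate[OF in_m[OF that]] \<phi>c[OF that]] by (simp add: o_def)
    qed
    show \<psi>0: "0 \<le> \<psi> x" if "x \<in> topspace (face_poly \<sigma>)" for x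
      using that fin \<sigma>(2) \<phi>0 coord by (simp add: \<psi>_def)
    show "continuous_map ?P (face_poly \<sigma>) (\<lambda>(t, x). D t x)" by (rule Dc)
    show "D 0 x = x" if x: "x \<in> topspace (face_poly \<sigma>)" for x
    proof
      fix j
      have x': "x \<in> poly_set \<sigma>" using x by simp
      have "s j 0 x = 0"
      proof (rule antisym)
        show "s j 0 x \<le> 0" using fin by (simp add: s_def)
        show "0 \<le> s j 0 x" using s01[OF _ x', of 0 j] by simp
      qed
      then show "D 0 x j = x j"
        using x' coord[OF x'] H0 by (auto simp: D_def poly_set_iff extensional_def)
    qed
    show "\<psi> a = 0" if a: "a \<in> fat_wedge \<sigma>" for a
    proof -
      have a': "a \<in> poly_set \<sigma>" using a fat_wedge_subset[OF \<sigma>(1)] by blast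
      obtain i where i: "i \<in> \<sigma>" "a i = pt i" using a fat_wedge_coordinate[OF \<sigma>(1) a'] by blast
      have "\<phi> i (a i) \<in> (\<lambda>i. \<phi> i (a i)) ` \<sigma>" using i(1) by blast
      then have "\<psi> a \<le> \<phi> i (a i)" unfolding \<psi>_def using fin by (intro Min_le) auto
      then show ?thesis using \<psi>0[of a] a' i \<phi>pt by simp
    qed
    show "D t a = a" if a: "a \<in> fat_wedge \<sigma>" and t: "t \<in> {0..1}" for a t
    proof
      fix j
      have a': "a \<in> poly_set \<sigma>" using a fat_wedge_subset[OF \<sigma>(1)] by blast
      obtain i where i: "i \<in> \<sigma>" "a i = pt i" using a fat_wedge_coordinate[OF \<sigma>(1) a'] by blast
      show "D t a j = a j"
      proof (cases "j \<in> \<sigma>")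
        case True
        have "H j (s j t a) (a j) = a j"
        proof (cases "j = i")
          case True
          then show ?thesis using i Hpt[OF i(1)] s01[OF t a'] by simp
        next
          case False
          then have "s j t a = 0" using s_le[OF i(1), of j t a] s01[OF t a', of j] i \<phi>pt by simp
          then show ?thesis using H0[OF True coord[OF a' True]] by simp
        qed
        then show ?thesis using True in_m by (simp add: D_def)
      next
        case False
        then show ?thesis using a' by (auto simp: D_def poly_set_iff extensional_def)
      qed
    qed
    show "D t x \<in> fat_wedge \<sigma>" if x: "x \<in> topspace (face_poly \<sigma>)" and t: "t \<in> {0..1}" and le: "\<psi> x \<le> t" for x t
    proof -
      have x': "x \<in> poly_set \<sigma>" using x by simp
      have "\<psi> x \<in> (\<lambda>i. \<phi> i (x i)) ` \<sigma>" unfolding \<psi>_def using fin \<sigma>(2) by (intro Min_in) auto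
      then obtain i where i: "i \<in> \<sigma>" "\<psi> x = \<phi> i (x i)" by blast
      have "\<psi> x \<le> \<phi> j (x j)" if "j \<in> \<sigma>" for j unfolding \<psi>_def using fin that by (intro Min_le) auto
      then have "\<phi> i (x i) \<le> s i t x"
        unfolding s_def using fin le i by (subst Min_ge_iff) auto
      then have "H i (s i t x) (x i) = pt i"
        using s01[OF t x', of i] by (intro HA[OF i(1) coord[OF x' i(1)]]) auto
      then have "D t x i = pt i" using i(1) in_m by (simp add: D_def)
      moreover have "D t x \<in> poly_set \<sigma>"
        using funcset_mem[OF continuous_map_funspace[OF Dc], of "(t, x)"] t x' by auto
      ultimately show ?thesis using fat_wedge_coordinate[OF \<sigma>(1)] i(1) by blast
    qed
  qed
  then show ?thesis by blast
qed

text \<open>The map induced by the inclusion of a subcomplex into \<open>K\<close>.\<close>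

definition incl :: "nat set set \<Rightarrow> nat set \<times> 'a wpoint \<Rightarrow> nat set \<times> 'a wpoint" where
  "incl K = (\<lambda>(\<delta>, w). inK K \<delta> w)"

lemma complex_face: "simplicial_complex_on m K \<Longrightarrow> \<sigma> \<in> K \<Longrightarrow> \<sigma> \<subseteq> {1..m}"
  and complex_down: "simplicial_complex_on m K \<Longrightarrow> \<sigma> \<in> K \<Longrightarrow> \<tau> \<subseteq> \<sigma> \<Longrightarrow> \<tau> \<in> K"
  and complex_empty: "simplicial_complex_on m K \<Longrightarrow> {} \<in> K"
  unfolding simplicial_complex_on_def by blast+

lemma WK_colimit:
  assumes "simplicial_complex_on m K"
  shows "weighted_colimit K (WK K) (\<lambda>\<sigma> x. inK K \<sigma> (eta \<sigma> x))"
  by (rule weighted_colimit_WK[OF complex_face[OF assms] complex_down[OF assms] face_ok[OF complex_face[OF assms]]])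

lemma WK_point:
  assumes "simplicial_complex_on m K" "z \<in> topspace (WK K)"
  obtains \<delta> x where "\<delta> \<in> K" "x \<in> poly_set \<delta>" "z = inK K \<delta> (eta \<delta> x)"
  using weighted_colimitD(2)[OF WK_colimit[OF assms(1)]] assms(2) by auto

lemma WK_in: "simplicial_complex_on m K \<Longrightarrow> \<delta> \<in> K \<Longrightarrow> x \<in> poly_set \<delta> \<Longrightarrow> inK K \<delta> (eta \<delta> x) \<in> topspace (WK K)"
  using weighted_colimitD(2)[OF WK_colimit] by blast

lemma WK_base_in: "simplicial_complex_on m K \<Longrightarrow> snd (pWK K) \<in> topspace (WK K)"
  unfolding pWK_def snd_conv by (rule WK_in[OF _ complex_empty]) auto

lemma incl_inK:
  assumes K: "simplicial_complex_on m K" and L: "simplicial_complex_on m L" "L \<subseteq> K"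
  shows "incl K (inK L \<delta> w) = inK K \<delta> w"
proof -
  have "incl K a = incl K b" if ab: "(a, b) \<in> colim_rel L W iota" for a b
  proof -
    obtain \<mu> \<nu> w where a: "a = (\<mu>, w)" "b = (\<nu>, iota \<mu> \<nu> w)" and \<mu>: "\<mu> \<in> L" "\<nu> \<in> L" "\<mu> \<subseteq> \<nu>" and w: "w \<in> topspace (W \<mu>)"
      using ab unfolding colim_rel_def by blast
    have "inK K \<nu> (iota \<mu> \<nu> w) = inK K \<mu> w"
      by (rule inK_iota[OF complex_face[OF K] complex_down[OF K] face_ok[OF complex_face[OF K]] subsetD[OF L(2) \<mu>(2)] \<mu>(3) w])
    then show ?thesis by (simp add: a incl_def)
  qed
  then have "incl K (cls (colim_rel L W iota) (\<delta>, w)) = incl K (\<delta>, w)"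
    by (rule cls_respects)
  then show ?thesis by (simp add: inK_def[of L] incl_def)
qed

lemma incl_continuous:
  assumes K: "simplicial_complex_on m K" and L: "simplicial_complex_on m L" "L \<subseteq> K"
  shows "continuous_map (WK L) (WK K) (incl K)"
proof (rule weighted_colimit_continuous[OF WK_colimit[OF L(1)]])
  fix \<sigma> assume \<sigma>: "\<sigma> \<in> L"
  have "continuous_map (face_poly \<sigma>) (WK K) (\<lambda>x. inK K \<sigma> (eta \<sigma> x))"
    by (rule weighted_colimitD(1)[OF WK_colimit[OF K] subsetD[OF L(2) \<sigma>]])
  then show "continuous_map (face_poly \<sigma>) (WK K) (\<lambda>x. incl K (inK L \<sigma> (eta \<sigma> x)))"
    by (simp add: incl_inK[OF K L])
qed

lemma incl_base:
  assumes K: "simplicial_complex_on m K" and L: "simplicial_complex_on m L" "L \<subseteq> K"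
  shows "incl K (snd (pWK L)) = snd (pWK K)"
  by (simp add: pWK_def incl_inK[OF K L])

lemma face_map_continuous:
  assumes K: "simplicial_complex_on m K" and \<tau>: "\<tau> \<subseteq> {1..m}"
  shows "continuous_map (WK K) (fst (smash \<tau>)) (face_map \<tau>)"
proof (rule weighted_colimit_continuous[OF WK_colimit[OF K]])
  fix \<delta> assume \<delta>: "\<delta> \<in> K"
  have d: "\<delta> \<subseteq> {1..m}" by (rule complex_face[OF K \<delta>])
  have q: "continuous_map (face_poly \<tau>) (fst (smash \<tau>)) (collapse_map (fat_wedge \<tau>))"
    by (simp add: smash_def quotient_imp_continuous_map[OF quotient_map_collapse])
  show "continuous_map (face_poly \<delta>) (fst (smash \<tau>)) (\<lambda>x. face_map \<tau> (inK K \<delta> (eta \<delta> x)))"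
  proof (cases "\<tau> \<subseteq> \<delta>")
    case True
    then have "\<delta> \<inter> \<tau> = \<tau>" by blast
    then have "continuous_map (face_poly \<delta>) (face_poly \<tau>) (proj \<tau>)" using proj_continuous[of \<delta> \<tau>] by simp
    from continuous_map_compose[OF continuous_map_compose[OF this cmap_continuous[OF d True]] q]
    show ?thesis
      by (rule continuous_map_eq) (simp add: face_map_inK[OF K \<delta> \<tau>] True)
  next
    case False
    have "collapse_map (fat_wedge \<tau>) base_point \<in> topspace (fst (smash \<tau>))"
      by (simp add: topspace_smash[OF \<tau>])
    then have "continuous_map (face_poly \<delta>) (fst (smash \<tau>)) (\<lambda>x. collapse_map (fat_wedge \<tau>) base_point)"
      by simp
    then show ?thesis
      by (rule continuous_map_eq) (simp add: face_map_inK[OF K \<delta> \<tau>] False)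
  qed
qed

lemma face_map_base:
  assumes K: "simplicial_complex_on m K" and \<tau>: "\<tau> \<subseteq> {1..m}"
  shows "face_map \<tau> (snd (pWK K)) = snd (smash \<tau>)"
  using face_map_inK[OF K complex_empty[OF K] \<tau> base_point_in] base_point_fixed[of "{}" "{}"]
  by (auto simp: pWK_def smash_def proj_base_point)

lemma face_map_pointed:
  assumes "simplicial_complex_on m K" "\<tau> \<subseteq> {1..m}"
  shows "pointed_map (pWK K) (smash \<tau>) (face_map \<tau>)"
  using face_map_continuous[OF assms] face_map_base[OF assms] by (simp add: pointed_map_def pWK_def)

lemma face_map_absent:
  assumes K: "simplicial_complex_on m K" and \<tau>: "\<tau> \<subseteq> {1..m}" "\<tau> \<notin> K" and z: "z \<in> topspace (WK K)"
  shows "face_map \<tau> z = snd (smash \<tau>)"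
proof -
  obtain \<delta> x where \<delta>: "\<delta> \<in> K" "x \<in> poly_set \<delta>" "z = inK K \<delta> (eta \<delta> x)" by (rule WK_point[OF K z])
  have "\<not> \<tau> \<subseteq> \<delta>" using complex_down[OF K \<delta>(1)] \<tau>(2) by blast
  then show ?thesis by (simp add: \<delta>(3) face_map_inK[OF K \<delta>(1) \<tau>(1) \<delta>(2)] smash_def)
qed

lemma face_map_incl:
  assumes K: "simplicial_complex_on m K" and L: "simplicial_complex_on m L" "L \<subseteq> K" and \<tau>: "\<tau> \<subseteq> {1..m}"
    and z: "z \<in> topspace (WK L)"
  shows "face_map \<tau> (incl K z) = face_map \<tau> z"
proof -
  obtain \<delta> x where \<delta>: "\<delta> \<in> L" "x \<in> poly_set \<delta>" "z = inK L \<delta> (eta \<delta> x)" by (rule WK_point[OF L(1) z])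
  then show ?thesis
    using face_map_inK[OF L(1) \<delta>(1) \<tau> \<delta>(2)] face_map_inK[OF K subsetD[OF L(2) \<delta>(1)] \<tau> \<delta>(2)]
    by (simp add: incl_inK[OF K L])
qed

lemma face_map_surj:
  assumes K: "simplicial_complex_on m K" and \<tau>: "\<tau> \<in> K" and a: "a \<in> topspace (fst (smash \<tau>))"
  obtains z where "z \<in> topspace (WK K)" "a = face_map \<tau> z"
proof -
  have t: "\<tau> \<subseteq> {1..m}" by (rule complex_face[OF K \<tau>])
  obtain x where x: "x \<in> poly_set \<tau>" "a = collapse_map (fat_wedge \<tau>) x"
    using a topspace_smash[OF t] by auto
  have "face_map \<tau> (inK K \<tau> (eta \<tau> x)) = a"
    using face_map_inK[OF K \<tau> t x(1)] x(2) by (simp add: proj_self[OF x(1)] cmap_self[OF t x(1)])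
  then show ?thesis using that WK_in[OF K \<tau> x(1)] by blast
qed

context
  fixes K :: "nat set set" and \<sigma> :: "nat set"
  assumes K: "simplicial_complex_on m K" and \<sigma>: "\<sigma> \<in> K" "\<sigma> \<noteq> {}"
    and maximal: "\<And>\<delta>. \<delta> \<in> K \<Longrightarrow> \<sigma> \<subseteq> \<delta> \<Longrightarrow> \<delta> = \<sigma>"
begin

lemma remove_facet: "simplicial_complex_on m (K - {\<sigma>})"
  unfolding simplicial_complex_on_def
proof (intro conjI ballI allI impI)
  show "{} \<in> K - {\<sigma>}" using complex_empty[OF K] \<sigma>(2) by blast
  show "\<delta> \<subseteq> {1..m}" if "\<delta> \<in> K - {\<sigma>}" for \<delta> using complex_face[OF K] that by blast
  show "\<tau> \<in> K - {\<sigma>}" if "\<delta> \<in> K - {\<sigma>}" "\<tau> \<subseteq> \<delta>" for \<delta> \<tau>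
    using complex_down[OF K, of \<delta> \<tau>] maximal[of \<delta>] that by auto
qed

private lemma K': "simplicial_complex_on m (K - {\<sigma>})" "K - {\<sigma>} \<subseteq> K"
  using remove_facet by auto

private lemma \<sigma>m: "\<sigma> \<subseteq> {1..m}" by (rule complex_face[OF K \<sigma>(1)])

private lemma proper_face: "\<mu> \<subset> \<sigma> \<Longrightarrow> \<mu> \<in> K - {\<sigma>}"
  using complex_down[OF K \<sigma>(1)] by blast

text \<open>
  The map from the fat wedge along which the product over the facet is attached; it is pasted together
  from the closed subproducts over the proper faces.
\<close>

lemma attaching_map:
  "\<exists>\<theta>. continuous_map (subtopology (face_poly \<sigma>) (fat_wedge \<sigma>)) (WK (K - {\<sigma>})) \<theta> \<and>
     (\<forall>\<mu> x. \<mu> \<subset> \<sigma> \<longrightarrow> x \<in> poly_set \<mu> \<longrightarrow> \<theta> x = inK (K - {\<sigma>}) \<mu> (eta \<mu> (cmap \<sigma> \<mu> x)))"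
proof -
  let ?F = "subtopology (face_poly \<sigma>) (fat_wedge \<sigma>)"
  let ?g = "\<lambda>\<mu> x. inK (K - {\<sigma>}) \<mu> (eta \<mu> (cmap \<sigma> \<mu> x))"
  note wc = WK_colimit[OF K'(1)]
  have top: "topspace ?F = fat_wedge \<sigma>" using fat_wedge_subset[OF \<sigma>m] by auto
  have red: "?g \<mu> x = ?g \<nu> x" if "\<mu> \<subset> \<sigma>" "\<nu> \<subseteq> \<mu>" "x \<in> poly_set \<nu>" for \<mu> \<nu> x
  proof -
    have "?g \<mu> x = inK (K - {\<sigma>}) \<nu> (eta \<nu> (cmap \<mu> \<nu> (cmap \<sigma> \<mu> x)))"
      using that by (intro weighted_colimitD(4)[OF wc] proper_face cmap_in[OF \<sigma>m]) auto
    then show ?thesis using cmap_cmap[OF \<sigma>m _ that(2,3)] that(1) by auto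
  qed
  have fin: "finite (bd \<sigma>)"
    by (rule finite_subset[of _ "Pow \<sigma>"]) (auto simp: bd_def finite_face[OF \<sigma>m])
  have un: "topspace ?F \<subseteq> (\<Union>\<mu>\<in>bd \<sigma>. poly_set \<mu>)"
    using top by (auto simp: fat_wedge_def topspace_poly)
  have clo: "closedin ?F (poly_set \<mu>)" if "\<mu> \<in> bd \<sigma>" for \<mu>
  proof -
    have "\<mu> \<subset> \<sigma>" using that by (simp add: bd_def)
    then have "poly_set \<mu> \<subseteq> fat_wedge \<sigma>" using fat_wedge_iff[OF \<sigma>m] by blast
    then show ?thesis
      using closedin_face_poly[of \<mu> \<sigma>] \<open>\<mu> \<subset> \<sigma>\<close> by (auto intro: closedin_subset_topspace)
  qed
  have cont: "continuous_map (subtopology ?F (poly_set \<mu>)) (WK (K - {\<sigma>})) (?g \<mu>)" if "\<mu> \<in> bd \<sigma>" for \<mu>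
  proof -
    have \<mu>: "\<mu> \<subset> \<sigma>" using that by (simp add: bd_def)
    then have "poly_set \<mu> \<subseteq> fat_wedge \<sigma>" using fat_wedge_iff[OF \<sigma>m] by blast
    then have "subtopology ?F (poly_set \<mu>) = face_poly \<mu>"
      using face_poly_subtopology[of \<mu> \<sigma>] \<mu> by (simp add: subtopology_subtopology Int_absorb1)
    moreover have "continuous_map (face_poly \<mu>) (WK (K - {\<sigma>})) ((\<lambda>x. inK (K - {\<sigma>}) \<mu> (eta \<mu> x)) \<circ> cmap \<sigma> \<mu>)"
      using \<mu> by (intro continuous_map_compose[OF cmap_continuous[OF \<sigma>m] weighted_colimitD(1)[OF wc proper_face]]) auto
    ultimately show ?thesis by (simp add: o_def)
  qed
  have agree: "?g \<mu> x = ?g \<nu> x" if "\<mu> \<in> bd \<sigma>" "\<nu> \<in> bd \<sigma>" "x \<in> topspace ?F \<inter> poly_set \<mu> \<inter> poly_set \<nu>" for \<mu> \<nu> x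
  proof -
    have "x \<in> poly_set (\<mu> \<inter> \<nu>)" using that(3) poly_set_Int by blast
    then show ?thesis using red[of \<mu> "\<mu> \<inter> \<nu>" x] red[of \<nu> "\<mu> \<inter> \<nu>" x] that(1,2) by (auto simp: bd_def)
  qed
  obtain \<theta> where \<theta>: "continuous_map ?F (WK (K - {\<sigma>})) \<theta>"
    "\<And>x \<mu>. \<mu> \<in> bd \<sigma> \<Longrightarrow> x \<in> topspace ?F \<inter> poly_set \<mu> \<Longrightarrow> \<theta> x = ?g \<mu> x"
    using pasting_lemma_exists_closed[where f = ?g, OF fin un clo cont agree] by blast
  have "\<theta> x = ?g \<mu> x" if "\<mu> \<subset> \<sigma>" "x \<in> poly_set \<mu>" for \<mu> x
    using \<theta>(2)[of \<mu> x] that fat_wedge_iff[OF \<sigma>m, of x] by (auto simp: bd_def top simp del: topspace_subtopology)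
  then show ?thesis using \<theta>(1) by blast
qed

text \<open>
  The homotopy is transported to the fat wedge along the attaching map, extended over the product over
  the facet, and the two homotopies form a compatible family.
\<close>

lemma WK_hep:
  fixes Z :: "'z topology"
  assumes f: "continuous_map (WK K) Z f" and h: "continuous_map (WK (K - {\<sigma>})) (path_space Z) h"
    and h0: "\<And>y. y \<in> topspace (WK (K - {\<sigma>})) \<Longrightarrow> h y 0 = f (incl K y)"
  shows "\<exists>k. continuous_map (WK K) (path_space Z) k \<and> (\<forall>y\<in>topspace (WK K). k y 0 = f y) \<and>
    (\<forall>y\<in>topspace (WK (K - {\<sigma>})). k (incl K y) = h y)"
proof -
  let ?g = "\<lambda>\<delta> x. inK K \<delta> (eta \<delta> x)" and ?g' = "\<lambda>\<delta> x. inK (K - {\<sigma>}) \<delta> (eta \<delta> x)"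
  note wc = WK_colimit[OF K] and wc' = WK_colimit[OF K'(1)]
  obtain \<theta> where \<theta>: "continuous_map (subtopology (face_poly \<sigma>) (fat_wedge \<sigma>)) (WK (K - {\<sigma>})) \<theta>"
    and \<theta>g: "\<And>\<mu> x. \<mu> \<subset> \<sigma> \<Longrightarrow> x \<in> poly_set \<mu> \<Longrightarrow> \<theta> x = ?g' \<mu> (cmap \<sigma> \<mu> x)"
    using attaching_map by blast
  have hep: "hep (face_poly \<sigma>) (fat_wedge \<sigma>) Z"
    using fat_wedge_strom[OF \<sigma>m \<sigma>(2)] strom_hep by blast
  have c1: "continuous_map (face_poly \<sigma>) Z (\<lambda>x. f (?g \<sigma> x))"
    using continuous_map_compose[OF weighted_colimitD(1)[OF wc \<sigma>(1)] f] by (simp add: o_def)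
  have c2: "continuous_map (subtopology (face_poly \<sigma>) (fat_wedge \<sigma>)) (path_space Z) (\<lambda>x. h (\<theta> x))"
    using continuous_map_compose[OF \<theta> h] by (simp add: o_def)
  have c3: "h (\<theta> x) 0 = f (?g \<sigma> x)" if x: "x \<in> topspace (face_poly \<sigma>) \<inter> fat_wedge \<sigma>" for x
  proof -
    obtain \<mu> where \<mu>: "\<mu> \<subset> \<sigma>" "x \<in> poly_set \<mu>" using x fat_wedge_iff[OF \<sigma>m] by blast
    have "\<theta> x \<in> topspace (WK (K - {\<sigma>}))"
      using \<mu> by (auto simp: \<theta>g[OF \<mu>] intro!: WK_in[OF K'(1) proper_face] cmap_in[OF \<sigma>m])
    then have "h (\<theta> x) 0 = f (?g \<mu> (cmap \<sigma> \<mu> x))"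
      using h0 by (simp add: \<theta>g[OF \<mu>] incl_inK[OF K K'])
    also have "?g \<mu> (cmap \<sigma> \<mu> x) = ?g \<sigma> x"
      using \<mu> by (intro weighted_colimitD(4)[OF wc \<sigma>(1), symmetric]) auto
    finally show ?thesis .
  qed
  have c3': "\<forall>x\<in>topspace (face_poly \<sigma>) \<inter> fat_wedge \<sigma>. h (\<theta> x) 0 = f (?g \<sigma> x)"
    by (rule ballI) (rule c3)
  obtain k\<sigma> where ks: "continuous_map (face_poly \<sigma>) (path_space Z) k\<sigma> \<and>
      (\<forall>x\<in>topspace (face_poly \<sigma>). k\<sigma> x 0 = f (?g \<sigma> x)) \<and>
      (\<forall>x\<in>topspace (face_poly \<sigma>) \<inter> fat_wedge \<sigma>. k\<sigma> x = h (\<theta> x))"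
    using hep[unfolded hep_def, THEN spec, THEN spec, THEN mp, OF conjI[OF c1 conjI[OF c2 c3']]]
    by (elim exE) (erule that)
  have k\<sigma>: "continuous_map (face_poly \<sigma>) (path_space Z) k\<sigma>" by (rule conjunct1[OF ks])
  have k\<sigma>0: "k\<sigma> x 0 = f (?g \<sigma> x)" if "x \<in> poly_set \<sigma>" for x
    using conjunct1[OF conjunct2[OF ks]] that by simp
  have k\<sigma>F: "k\<sigma> x = h (\<theta> x)" if "x \<in> fat_wedge \<sigma>" for x
    using conjunct2[OF conjunct2[OF ks]] that fat_wedge_subset[OF \<sigma>m] by auto
  define F where "F = (\<lambda>\<delta> x. if \<delta> = \<sigma> then k\<sigma> x else h (?g' \<delta> x))"
  have comp: "compatible K F"
    unfolding compatible_def
  proof (intro ballI allI impI)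
    fix \<delta> \<mu> x assume \<delta>: "\<delta> \<in> K" and \<mu>: "\<mu> \<subseteq> \<delta>" and x: "x \<in> poly_set \<mu>"
    consider "\<mu> = \<sigma>" | "\<delta> = \<sigma>" "\<mu> \<subset> \<sigma>" | "\<delta> \<noteq> \<sigma>" "\<mu> \<noteq> \<sigma>" using \<mu> by blast
    then show "F \<delta> x = F \<mu> (cmap \<delta> \<mu> x)"
    proof cases
      case 1
      then have "\<delta> = \<sigma>" using maximal[OF \<delta>] \<mu> by blast
      then show ?thesis using 1 cmap_self[OF \<sigma>m x] by simp
    next
      case 2
      then have "x \<in> fat_wedge \<sigma>" "\<mu> \<noteq> \<sigma>" using x fat_wedge_iff[OF \<sigma>m] by blast+
      then show ?thesis using 2 k\<sigma>F \<theta>g[OF _ x] by (simp add: F_def)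
    next
      case 3
      then have "?g' \<delta> x = ?g' \<mu> (cmap \<delta> \<mu> x)"
        using \<delta> \<mu> x by (intro weighted_colimitD(4)[OF wc']) auto
      then show ?thesis using 3 by (simp add: F_def)
    qed
  qed
  have "continuous_map (face_poly \<delta>) (path_space Z) (F \<delta>)" if \<delta>: "\<delta> \<in> K" for \<delta>
  proof (cases "\<delta> = \<sigma>")
    case True
    then have "F \<delta> = k\<sigma>" by (simp add: F_def fun_eq_iff)
    then show ?thesis using k\<sigma> True by simp
  next
    case False
    then have "F \<delta> = (\<lambda>x. h (?g' \<delta> x))" by (simp add: F_def fun_eq_iff)
    moreover have "\<delta> \<in> K - {\<sigma>}" using \<delta> False by simp
    ultimately show ?thesis
      using continuous_map_compose[OF weighted_colimitD(1)[OF wc'] h] by (simp add: o_def)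
  qed
  from weighted_colimit_lift[OF wc comp this] obtain k
    where k: "continuous_map (WK K) (path_space Z) k" "\<And>\<delta> x. \<delta> \<in> K \<Longrightarrow> x \<in> poly_set \<delta> \<Longrightarrow> k (?g \<delta> x) = F \<delta> x"
    by blast
  have kj: "k (incl K y) = h y" if y: "y \<in> topspace (WK (K - {\<sigma>}))" for y
  proof -
    obtain \<delta> x where \<delta>: "\<delta> \<in> K - {\<sigma>}" "x \<in> poly_set \<delta>" "y = ?g' \<delta> x" by (rule WK_point[OF K'(1) y])
    then show ?thesis using k(2)[of \<delta> x] by (simp add: incl_inK[OF K K'] F_def)
  qed
  have "k y 0 = f y" if y: "y \<in> topspace (WK K)" for y
  proof -
    obtain \<delta> x where \<delta>: "\<delta> \<in> K" "x \<in> poly_set \<delta>" "y = ?g \<delta> x" by (rule WK_point[OF K y])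
    show ?thesis
    proof (cases "\<delta> = \<sigma>")
      case True
      then show ?thesis using k(2)[OF \<delta>(1,2)] \<delta> k\<sigma>0 by (simp add: F_def)
    next
      case False
      then have "?g' \<delta> x \<in> topspace (WK (K - {\<sigma>}))" using \<delta> by (intro WK_in[OF K'(1)]) auto
      then show ?thesis using k(2)[OF \<delta>(1,2)] \<delta>(3) h0 False by (simp add: F_def incl_inK[OF K K'])
    qed
  qed
  then show ?thesis using k(1) kj by blast
qed

text \<open>
  A map that is constant over the smaller complex is determined by its values on the product over the
  facet, where it is constant on the fat wedge.
\<close>

lemma WK_descend:
  fixes Z :: "'z topology"
  assumes u: "continuous_map (WK K) Z u" and u0: "\<And>y. y \<in> topspace (WK (K - {\<sigma>})) \<Longrightarrow> u (incl K y) = z0"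
  shows "\<exists>b. pointed_map (smash \<sigma>) (Z, z0) b \<and> (\<forall>y\<in>topspace (WK K). u y = b (face_map \<sigma> y))"
proof -
  let ?g = "\<lambda>\<delta> x. inK K \<delta> (eta \<delta> x)"
  note wc = WK_colimit[OF K]
  define b where "b = (\<lambda>x. u (?g \<sigma> x))"
  have bc: "continuous_map (face_poly \<sigma>) Z b"
    using continuous_map_compose[OF weighted_colimitD(1)[OF wc \<sigma>(1)] u] by (simp add: b_def o_def)
  have ug: "u (?g \<delta> x) = z0" if "\<delta> \<in> K - {\<sigma>}" "x \<in> poly_set \<delta>" for \<delta> x
    using u0[OF WK_in[OF K'(1) that]] by (simp add: incl_inK[OF K K'])
  have bF: "b x = z0" if x: "x \<in> fat_wedge \<sigma>" for x
  proof -
    obtain \<mu> where \<mu>: "\<mu> \<subset> \<sigma>" "x \<in> poly_set \<mu>" using x fat_wedge_iff[OF \<sigma>m] by blast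
    have "?g \<sigma> x = ?g \<mu> (cmap \<sigma> \<mu> x)"
      using \<mu> by (intro weighted_colimitD(4)[OF wc \<sigma>(1)]) auto
    moreover have "?g \<mu> (cmap \<sigma> \<mu> x) \<in> u -` {z0}"
      using ug[OF proper_face[OF \<mu>(1)] cmap_in[OF \<sigma>m psubset_imp_subset[OF \<mu>(1)] \<mu>(2)]] by simp
    ultimately show ?thesis by (simp add: b_def)
  qed
  have bcol: "b (collapse_map (fat_wedge \<sigma>) x) = b x" for x
    by (rule collapse_map_respects[where f = b]) (simp add: bF)
  have base: "b (snd (smash \<sigma>)) = z0"
    using bF[OF base_in_fat_wedge[OF \<sigma>m \<sigma>(2)]] by (simp add: smash_def bcol)
  have "continuous_map (fst (smash \<sigma>)) Z b"
    unfolding smash_def fst_conv by (rule continuous_map_collapseI[OF bc]) (simp add: bF)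
  moreover have "u y = b (face_map \<sigma> y)" if y: "y \<in> topspace (WK K)" for y
  proof -
    obtain \<delta> x where \<delta>: "\<delta> \<in> K" "x \<in> poly_set \<delta>" "y = ?g \<delta> x" by (rule WK_point[OF K y])
    show ?thesis
    proof (cases "\<delta> = \<sigma>")
      case True
      then show ?thesis
        using \<delta> face_map_inK[OF K \<sigma>(1) \<sigma>m, of x] by (simp add: proj_self cmap_self[OF \<sigma>m] bcol) (simp add: b_def)
    next
      case False
      then have "\<not> \<sigma> \<subseteq> \<delta>" using maximal[OF \<delta>(1)] by blast
      then show ?thesis
        using \<delta> False ug face_map_inK[OF K \<delta>(1) \<sigma>m \<delta>(2)] base by (simp add: smash_def)
    qed
  qed
  ultimately show ?thesis using base by (intro exI[of _ b]) (simp add: pointed_map_def)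
qed

end

end

section \<open>Maps out of a weighted polyhedral product into a group up to homotopy\<close>

context h_group
begin

text \<open>
  Together with \<open>middle_trivial\<close> this solves \<open>u b v = y\<close> for the middle factor, which is trivial
  where \<open>y\<close> is already equal to \<open>u v\<close>.
\<close>

lemma solve_middle:
  assumes y0: "y0 \<in> topspace Y" and u: "pointed_map (Y, y0) (G, e) u" and v: "pointed_map (Y, y0) (G, e) v"
    and y: "pointed_map (Y, y0) (G, e) y"
  shows "pointed_homotopic (Y, y0) (G, e)
    (\<lambda>z. mul (mul (u z) (mul (mul (neg (u z)) (y z)) (neg (v z)))) (v z)) y"
proof -
  note nu = neg_map[OF u] and nv = neg_map[OF v]
  have "pointed_homotopic (Y, y0) (G, e) (\<lambda>z. mul (u z) (mul (mul (neg (u z)) (y z)) (neg (v z))))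
      (\<lambda>z. mul (mul (u z) (mul (neg (u z)) (y z))) (neg (v z)))"
    by (rule pointed_homotopic_sym[OF assoc[OF u mul_map[OF nu y] nv]])
  also have "pointed_homotopic (Y, y0) (G, e) \<dots> (\<lambda>z. mul (y z) (neg (v z)))"
    by (rule mul_cong[OF neg_mul_l'[OF y0 y u] pointed_homotopic_refl[OF nv] y0])
  finally show ?thesis
    using pointed_homotopic_trans[OF mul_cong[OF _ pointed_homotopic_refl[OF v] y0] mul_neg_r'[OF y0 y v]] by blast
qed

lemma middle_trivial:
  assumes y0: "y0 \<in> topspace Y" and u: "pointed_map (Y, y0) (G, e) u" and v: "pointed_map (Y, y0) (G, e) v"
    and y: "pointed_homotopic (Y, y0) (G, e) y (\<lambda>z. mul (mul (u z) e) (v z))"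
  shows "pointed_homotopic (Y, y0) (G, e) (\<lambda>z. mul (mul (neg (u z)) (y z)) (neg (v z))) (\<lambda>_. e)"
proof -
  note nu = neg_map[OF u] and nv = neg_map[OF v]
  have "pointed_homotopic (Y, y0) (G, e) y (\<lambda>z. mul (u z) (v z))"
    by (rule pointed_homotopic_trans[OF y mul_cong[OF unit_r[OF u] pointed_homotopic_refl[OF v] y0]])
  then have "pointed_homotopic (Y, y0) (G, e) (\<lambda>z. mul (neg (u z)) (y z)) v"
    by (rule pointed_homotopic_trans[OF mul_cong[OF pointed_homotopic_refl[OF nu] _ y0] neg_mul_l[OF y0 v u]])
  then show ?thesis
    by (rule pointed_homotopic_trans[OF mul_cong[OF _ pointed_homotopic_refl[OF nv] y0] inv_r[OF v]])
qed

lemma bracket_e: "bracket mul T (\<lambda>_. e) = e"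
  by (induction T) auto

definition pointwise :: "(real \<Rightarrow> 'g) \<Rightarrow> (real \<Rightarrow> 'g) \<Rightarrow> real \<Rightarrow> 'g" where
  "pointwise f g = (\<lambda>t\<in>{0..1}. mul (f t) (g t))"

lemma pointwise_continuous:
  assumes f: "continuous_map Y (path_space G) f" and g: "continuous_map Y (path_space G) g"
  shows "continuous_map Y (path_space G) (\<lambda>y. pointwise (f y) (g y))"
proof -
  have "continuous_map (prod_topology I01 Y) G ((\<lambda>(x, y). mul x y) \<circ> (\<lambda>p. (f (snd p) (fst p), g (snd p) (fst p))))"
    using continuous_map_uncurry[OF f] continuous_map_uncurry[OF g]
    by (intro continuous_map_compose[OF _ mul_cont]) (simp add: continuous_map_paired case_prod_unfold)
  from continuous_map_curry[OF this] show ?thesis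
    by (simp add: pointwise_def o_def)
qed

end

lemma loops_homotopy:
  assumes \<phi>: "pointed_homotopic (G, e) (G', e') \<phi> \<psi>" and e: "e \<in> topspace G"
  shows "pointed_homotopic (loops G e, const_path e) (loops G' e', const_path e')
    (\<lambda>f. \<lambda>t\<in>{0..1}. \<phi> (f t)) (\<lambda>f. \<lambda>t\<in>{0..1}. \<psi> (f t))"
proof -
  obtain H where H: "continuous_map G (path_space G') H" "\<And>x. H x 0 = \<phi> x" "\<And>x. H x 1 = \<psi> x"
    and He: "H e = (\<lambda>t\<in>{0..1}. e')"
    using pointed_homotopic_path[OF \<phi> e] by blast
  show ?thesis
  proof (rule loop_homotopyI[where k = "\<lambda>t s f. H (f t) s"])
    let ?Y = "prod_topology I01 (prod_topology I01 (loops G e))"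
    have f: "continuous_map ?Y (path_space G) (\<lambda>p. snd (snd p))"
      using continuous_map_compose[OF continuous_map_snd continuous_map_snd, of I01 I01 "loops G e"]
      by (simp add: continuous_map_loops_iff o_def)
    have s: "continuous_map ?Y I01 (\<lambda>p. fst (snd p))"
      using continuous_map_compose[OF continuous_map_snd continuous_map_fst, of I01 I01 "loops G e"]
      by (simp add: o_def)
    have "continuous_map ?Y (path_space G') (\<lambda>p. H (snd (snd p) (fst p)))"
      using continuous_map_compose[OF continuous_map_path_eval[OF f continuous_map_fst] H(1)] by (simp add: o_def)
    from continuous_map_path_eval[OF this s]
    show "continuous_map ?Y G' (\<lambda>(t, s, f). H (f t) s)" by (simp add: case_prod_unfold)
    show "const_path e \<in> topspace (loops G e)" using e by simp
    show "H (f 0) s = e' \<and> H (f 1) s = e'" if "s \<in> {0..1}" "f \<in> topspace (loops G e)" for s f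
      using that He by (simp add: topspace_loops)
    show "H (const_path e t) s = e'" if "t \<in> {0..1}" "s \<in> {0..1}" for t s
      using that He by simp
    show "(\<lambda>t\<in>{0..1}. \<phi> (f t)) = (\<lambda>t\<in>{0..1}. H (f t) 0)" for f by (simp add: H)
    show "(\<lambda>t\<in>{0..1}. \<psi> (f t)) = (\<lambda>t\<in>{0..1}. H (f t) 1)" for f by (simp add: H)
  qed
qed

lemma loops_map:
  assumes "pointed_map (G, e) (G', e') \<phi>" "e \<in> topspace G"
  shows "pointed_map (loops G e, const_path e) (loops G' e', const_path e') (\<lambda>f. \<lambda>t\<in>{0..1}. \<phi> (f t))"
  using pointed_homotopic_imp_maps[OF loops_homotopy[OF pointed_homotopic_refl[OF assms(1)] assms(2)]] by blast

context weighted_polyhedral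
begin

lemma finite_complex:
  assumes "simplicial_complex_on m K"
  shows "finite K"
  by (rule finite_subset[of _ "Pow {1..m}"]) (use complex_face[OF assms] in auto)

lemma complex_facet:
  assumes K: "simplicial_complex_on m K" and "K \<noteq> {{}}"
  obtains \<sigma> where "\<sigma> \<in> K" "\<sigma> \<noteq> {}" "\<And>\<delta>. \<delta> \<in> K \<Longrightarrow> \<sigma> \<subseteq> \<delta> \<Longrightarrow> \<delta> = \<sigma>"
proof -
  obtain a where a: "a \<in> K" "a \<noteq> {}" using assms complex_empty[OF K] by blast
  obtain \<sigma> where "\<sigma> \<in> K" "a \<subseteq> \<sigma>" "\<forall>b\<in>K. \<sigma> \<subseteq> b \<longrightarrow> \<sigma> = b"
    using finite_has_maximal2[OF finite_complex[OF K] a(1)] by blast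
  then show ?thesis using that a by blast
qed

lemma WK_point_complex:
  assumes "z \<in> topspace (WK {{}})"
  shows "z = snd (pWK {{}})"
proof -
  have K: "simplicial_complex_on m {{}}" by (simp add: simplicial_complex_on_def)
  obtain \<delta> x where "\<delta> \<in> {{}}" "x \<in> poly_set \<delta>" "z = inK {{}} \<delta> (eta \<delta> x)" by (rule WK_point[OF K assms])
  then show ?thesis by (simp add: pWK_def poly_set_empty)
qed

text \<open>
  Induction on the number of faces, for a fixed bracketing. Its leaves may include sets outside the
  complex: their factors are trivial because \<open>f\<^sub>\<tau>\<close> is constant for \<open>\<tau> \<notin> K\<close>. So the bracketing does not
  have to be changed when a facet is removed, wherever the facet occurs in it.
\<close>

lemma maps_from_WK_surj:
  fixes G :: "'g topology"
  assumes G: "h_group G e0 mul neg" and T: "distinct (leaves T)" "\<And>\<tau>. \<tau> \<in> set (leaves T) \<Longrightarrow> \<tau> \<subseteq> {1..m}"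
    and K: "simplicial_complex_on m K" "K \<subseteq> set (leaves T)" and y: "pointed_map (pWK K) (G, e0) y"
  shows "\<exists>a. (\<forall>\<tau>\<in>set (leaves T). pointed_map (smash \<tau>) (G, e0) (a \<tau>)) \<and>
    pointed_homotopic (pWK K) (G, e0) (\<lambda>z. bracket mul T (\<lambda>\<tau>. a \<tau> (face_map \<tau> z))) y"
  using K y
proof (induction "card K" arbitrary: K y rule: less_induct)
  case less
  interpret G: h_group G e0 mul neg by (rule G)
  note K = less.prems(1,2) and y = less.prems(3)
  define Y where "Y = WK K"
  define y0 where "y0 = snd (pWK K)"
  have P: "pWK K = (Y, y0)" by (simp add: Y_def y0_def pWK_def)
  have y0: "y0 \<in> topspace Y" unfolding Y_def y0_def by (rule WK_base_in[OF K(1)])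
  show ?case
  proof (cases "K = {{}}")
    case True
    have "pointed_homotopic (Y, y0) (G, e0) (\<lambda>z. bracket mul T (\<lambda>\<tau>. e0)) y"
    proof (rule pointed_homotopic_eq[OF _ y0])
      show "pointed_map (Y, y0) (G, e0) (\<lambda>z. bracket mul T (\<lambda>\<tau>. e0))"
        by (simp add: G.bracket_e G.const_map)
      show "bracket mul T (\<lambda>\<tau>. e0) = y z" if "z \<in> topspace Y" for z
        using WK_point_complex[of z] that y by (simp add: G.bracket_e Y_def True pointed_map_def)
    qed
    then show ?thesis
      by (intro exI[of _ "\<lambda>_ _. e0"]) (simp add: P G.const_map)
  next
    case False
    obtain \<sigma> where \<sigma>: "\<sigma> \<in> K" "\<sigma> \<noteq> {}" and maximal: "\<And>\<delta>. \<delta> \<in> K \<Longrightarrow> \<sigma> \<subseteq> \<delta> \<Longrightarrow> \<delta> = \<sigma>"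
      using complex_facet[OF K(1) False] by blast
    define L where "L = K - {\<sigma>}"
    have L: "simplicial_complex_on m L" "L \<subseteq> K"
      unfolding L_def using remove_facet[OF K(1) \<sigma> maximal] by auto
    define Y' where "Y' = WK L"
    define y0' where "y0' = snd (pWK L)"
    have P': "pWK L = (Y', y0')" by (simp add: Y'_def y0'_def pWK_def)
    have y0': "y0' \<in> topspace Y'" unfolding Y'_def y0'_def by (rule WK_base_in[OF L(1)])
    have j: "pointed_map (Y', y0') (Y, y0) (incl K)"
      using incl_continuous[OF K(1) L] incl_base[OF K(1) L] by (simp add: pointed_map_def Y'_def Y_def y0'_def y0_def)
    have y: "pointed_map (Y, y0) (G, e0) y" using y by (simp add: P)
    have yj: "pointed_map (Y', y0') (G, e0) (\<lambda>z. y (incl K z))"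
      using pointed_homotopic_imp_maps[OF pointed_homotopic_compose_right[OF pointed_homotopic_refl[OF y] j]] by blast
    have "card L < card K"
      unfolding L_def by (rule card_Diff1_less[OF finite_complex[OF K(1)] \<sigma>(1)])
    then obtain a0 where a0: "\<And>\<tau>. \<tau> \<in> set (leaves T) \<Longrightarrow> pointed_map (smash \<tau>) (G, e0) (a0 \<tau>)"
      and hom: "pointed_homotopic (Y', y0') (G, e0) (\<lambda>z. bracket mul T (\<lambda>\<tau>. a0 \<tau> (face_map \<tau> z))) (\<lambda>z. y (incl K z))"
      using less.hyps[of L "\<lambda>z. y (incl K z)"] L K(2) yj unfolding P' by blast
    define h where "h = (\<lambda>\<tau> z. a0 \<tau> (face_map \<tau> z))"
    have h: "pointed_map (Y, y0) (G, e0) (h \<tau>)" if "\<tau> \<in> set (leaves T)" for \<tau>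
      unfolding h_def using pointed_homotopic_imp_maps[OF pointed_homotopic_compose_right[OF
            pointed_homotopic_refl[OF a0[OF that]] face_map_pointed[OF K(1) T(2)[OF that], unfolded P]]] by blast
    have \<sigma>T: "\<sigma> \<in> set (leaves T)" using \<sigma>(1) K(2) by blast
    have "\<exists>u v. pointed_map (Y, y0) (G, e0) u \<and> pointed_map (Y, y0) (G, e0) v \<and>
      (\<forall>b. pointed_map (Y, y0) (G, e0) b \<longrightarrow> pointed_homotopic (Y, y0) (G, e0)
        (\<lambda>z. bracket mul T (\<lambda>j. if j = \<sigma> then b z else h j z)) (\<lambda>z. mul (mul (u z) (b z)) (v z)))"
      by (rule G.bracket_isolate[OF y0 T(1) \<sigma>T]) (rule h)
    then obtain u v where u: "pointed_map (Y, y0) (G, e0) u" and v: "pointed_map (Y, y0) (G, e0) v"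
      and uv: "\<And>b. pointed_map (Y, y0) (G, e0) b \<Longrightarrow> pointed_homotopic (Y, y0) (G, e0)
        (\<lambda>z. bracket mul T (\<lambda>j. if j = \<sigma> then b z else h j z)) (\<lambda>z. mul (mul (u z) (b z)) (v z))"
      by blast
    have u': "pointed_map (Y', y0') (G, e0) (\<lambda>z. u (incl K z))" and v': "pointed_map (Y', y0') (G, e0) (\<lambda>z. v (incl K z))"
      using pointed_homotopic_imp_maps[OF pointed_homotopic_compose_right[OF pointed_homotopic_refl[OF u] j]]
        pointed_homotopic_imp_maps[OF pointed_homotopic_compose_right[OF pointed_homotopic_refl[OF v] j]] by blast+
    have restr: "bracket mul T (\<lambda>\<tau>. a0 \<tau> (face_map \<tau> z)) =
        bracket mul T (\<lambda>j. if j = \<sigma> then e0 else h j (incl K z))" if z: "z \<in> topspace Y'" for z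
    proof (rule bracket_cong)
      fix \<tau> assume \<tau>: "\<tau> \<in> set (leaves T)"
      show "a0 \<tau> (face_map \<tau> z) = (if \<tau> = \<sigma> then e0 else h \<tau> (incl K z))"
      proof (cases "\<tau> = \<sigma>")
        case True
        then have "face_map \<tau> z = snd (smash \<tau>)"
          using face_map_absent[OF L(1) T(2)[OF \<tau>]] z by (simp add: L_def Y'_def)
        then show ?thesis using a0[OF \<tau>] True by (simp add: pointed_map_def)
      next
        case False
        then show ?thesis using face_map_incl[OF K(1) L T(2)[OF \<tau>]] z by (simp add: h_def Y'_def)
      qed
    qed
    have "pointed_homotopic (Y', y0') (G, e0) (\<lambda>z. y (incl K z)) (\<lambda>z. bracket mul T (\<lambda>\<tau>. a0 \<tau> (face_map \<tau> z)))"
      by (rule pointed_homotopic_sym[OF hom])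
    also have "pointed_homotopic (Y', y0') (G, e0) \<dots> (\<lambda>z. bracket mul T (\<lambda>j. if j = \<sigma> then e0 else h j (incl K z)))"
      using pointed_homotopic_imp_maps[OF hom] restr y0' by (intro pointed_homotopic_eq) auto
    also have "pointed_homotopic (Y', y0') (G, e0) \<dots> (\<lambda>z. mul (mul (u (incl K z)) e0) (v (incl K z)))"
      using pointed_homotopic_compose_right[OF uv[OF G.const_map] j] .
    finally have yuv: "pointed_homotopic (Y', y0') (G, e0) (\<lambda>z. y (incl K z)) (\<lambda>z. mul (mul (u (incl K z)) e0) (v (incl K z)))" .
    \<comment> \<open>The factor needed at \<open>\<sigma>\<close> is trivial over the subcomplex, hence homotopic to one that factors through \<open>f\<^sub>\<sigma>\<close>.\<close>
    define b where "b = (\<lambda>z. mul (mul (neg (u z)) (y z)) (neg (v z)))"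
    have b: "pointed_map (Y, y0) (G, e0) b"
      unfolding b_def by (intro G.mul_map G.neg_map u v y)
    have bj: "pointed_homotopic (Y', y0') (G, e0) (\<lambda>z. b (incl K z)) (\<lambda>_. e0)"
      unfolding b_def by (rule G.middle_trivial[OF y0' u' v' yuv])
    obtain H where H: "continuous_map Y' (path_space G) H" "\<And>z. H z 0 = b (incl K z)" "\<And>z. H z 1 = e0"
      "H y0' = (\<lambda>t\<in>{0..1}. e0)"
      using pointed_homotopic_path[OF bj y0'] by blast
    have "\<exists>k. continuous_map (WK K) (path_space G) k \<and> (\<forall>y\<in>topspace (WK K). k y 0 = b y) \<and>
        (\<forall>y\<in>topspace (WK (K - {\<sigma>})). k (incl K y) = H y)"
      by (rule WK_hep[OF K(1) \<sigma> maximal])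
        (use b H in \<open>simp_all add: pointed_map_def Y_def Y'_def L_def\<close>)
    then obtain k where k: "continuous_map Y (path_space G) k" "\<And>z. z \<in> topspace Y \<Longrightarrow> k z 0 = b z"
      "\<And>z. z \<in> topspace Y' \<Longrightarrow> k (incl K z) = H z"
      unfolding Y_def Y'_def L_def by blast
    have k1: "continuous_map (WK K) G (\<lambda>z. k z 1)"
      using continuous_map_path_eval[OF k(1)] by (simp add: Y_def)
    have "\<exists>b. pointed_map (smash \<sigma>) (G, e0) b \<and> (\<forall>z\<in>topspace (WK K). k z 1 = b (face_map \<sigma> z))"
      by (rule WK_descend[OF K(1) \<sigma> maximal k1]) (use k(3) H(3) in \<open>simp_all add: Y'_def L_def\<close>)
    then obtain a\<sigma> where a\<sigma>: "pointed_map (smash \<sigma>) (G, e0) a\<sigma>" "\<And>z. z \<in> topspace Y \<Longrightarrow> k z 1 = a\<sigma> (face_map \<sigma> z)"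
      unfolding Y_def by blast
    have bk: "pointed_homotopic (Y, y0) (G, e0) b (\<lambda>z. k z 1)"
    proof (rule pointed_homotopicI_paths[OF k(1) y0])
      have "k y0 = H y0'" using k(3)[OF y0'] j by (simp add: pointed_map_def)
      then show "k y0 t = e0" if "t \<in> {0..1}" for t using that H(4) by simp
    qed (use k in auto)
    have kp: "pointed_map (Y, y0) (G, e0) (\<lambda>z. k z 1)" using pointed_homotopic_imp_maps[OF bk] by blast
    let ?a = "a0(\<sigma> := a\<sigma>)"
    have eq: "bracket mul T (\<lambda>j. if j = \<sigma> then k z 1 else h j z) = bracket mul T (\<lambda>\<tau>. ?a \<tau> (face_map \<tau> z))"
      if "z \<in> topspace Y" for z
      using a\<sigma>(2)[OF that] by (intro bracket_cong) (auto simp: h_def)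
    have "pointed_homotopic (Y, y0) (G, e0) (\<lambda>z. bracket mul T (\<lambda>\<tau>. ?a \<tau> (face_map \<tau> z)))
        (\<lambda>z. bracket mul T (\<lambda>j. if j = \<sigma> then k z 1 else h j z))"
      using pointed_homotopic_imp_maps[OF uv[OF kp]] eq y0
      by (intro pointed_homotopic_sym[OF pointed_homotopic_eq]) auto
    also have "pointed_homotopic (Y, y0) (G, e0) \<dots> (\<lambda>z. mul (mul (u z) (k z 1)) (v z))"
      by (rule uv[OF kp])
    also have "pointed_homotopic (Y, y0) (G, e0) \<dots> (\<lambda>z. mul (mul (u z) (b z)) (v z))"
      by (rule G.mul_cong[OF G.mul_cong[OF pointed_homotopic_refl[OF u] pointed_homotopic_sym[OF bk] y0] pointed_homotopic_refl[OF v] y0])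
    also have "pointed_homotopic (Y, y0) (G, e0) \<dots> y"
      unfolding b_def by (rule G.solve_middle[OF y0 u v y])
    finally have fin: "pointed_homotopic (Y, y0) (G, e0) (\<lambda>z. bracket mul T (\<lambda>\<tau>. ?a \<tau> (face_map \<tau> z))) y" .
    have "\<forall>\<tau>\<in>set (leaves T). pointed_map (smash \<tau>) (G, e0) (?a \<tau>)" using a0 a\<sigma>(1) by auto
    then show ?thesis using fin unfolding P by blast
  qed
qed

end

text \<open>
  A deformation through loops is, in particular, a deformation through paths that start at \<open>e\<close>.
\<close>

lemma continuous_map_path_space_mono:
  assumes f: "continuous_map Y (path_space (subtopology Z S)) f" and "S \<subseteq> S'"
  shows "continuous_map Y (path_space (subtopology Z S')) f"
proof -
  have "continuous_map (prod_topology I01 Y) (subtopology Z S') (\<lambda>(t, y). f y t)"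
    using continuous_map_uncurry[OF f] assms(2) by (auto simp: continuous_map_in_subtopology Pi_iff)
  from continuous_map_curry[OF this] show ?thesis
  proof (rule continuous_map_eq)
    fix y assume "y \<in> topspace Y"
    then have "f y \<in> paths (subtopology Z S)" using continuous_map_funspace[OF f] by auto
    then show "(\<lambda>t\<in>{0..1}. (\<lambda>(t, y). f y t) (t, y)) = f y"
      by (simp add: paths_def extensional_restrict)
  qed
qed

context h_group
begin

lemma pointwise_map:
  assumes u: "pointed_map P (loops G e, const_path e) u" and v: "pointed_map P (loops G e, const_path e) v"
  shows "pointed_map P (loops G e, const_path e) (\<lambda>y. pointwise (u y) (v y))"
proof -
  have u': "continuous_map (fst P) (path_space G) u" "\<And>y. y \<in> topspace (fst P) \<Longrightarrow> u y 0 = e \<and> u y 1 = e" "u (snd P) = const_path e"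
    and v': "continuous_map (fst P) (path_space G) v" "\<And>y. y \<in> topspace (fst P) \<Longrightarrow> v y 0 = e \<and> v y 1 = e" "v (snd P) = const_path e"
    using u v by (auto simp: pointed_map_def continuous_map_loops_iff)
  have "pointwise (const_path e) (const_path e) = const_path e"
    by (auto simp: pointwise_def const_path_def fun_eq_iff)
  then show ?thesis
    using pointwise_continuous[OF u'(1) v'(1)] u' v'
    by (simp add: pointed_map_def continuous_map_loops_iff) (simp add: pointwise_def)
qed

lemma pointwise_cong:
  assumes u: "pointed_homotopic (Y, y0) (loops G e, const_path e) u u'"
    and v: "pointed_homotopic (Y, y0) (loops G e, const_path e) v v'" and y0: "y0 \<in> topspace Y"
  shows "pointed_homotopic (Y, y0) (loops G e, const_path e) (\<lambda>y. pointwise (u y) (v y)) (\<lambda>y. pointwise (u' y) (v' y))"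
proof -
  let ?L = "loops G e" and ?c = "const_path e"
  have "pointed_map (prod_topology ?L ?L, (?c, ?c)) (?L, ?c) (\<lambda>x. pointwise (fst x) (snd x))"
    by (rule pointwise_map) (simp_all add: pointed_map_def continuous_map_fst continuous_map_snd)
  from pointed_homotopic_compose_left[OF pointed_homotopic_pair[OF u v y0] this] show ?thesis by simp
qed

lemma pointwise_inverse:
  assumes u: "pointed_map P (loops G e, const_path e) u"
  shows "pointed_map P (loops G e, const_path e) (\<lambda>y. \<lambda>t\<in>{0..1}. neg (u y t))"
    and "pointed_homotopic P (loops G e, const_path e)
      (\<lambda>y. pointwise (u y) (\<lambda>t\<in>{0..1}. neg (u y t))) (\<lambda>_. const_path e)"
proof -
  have "pointed_map (G, e) (G, e) neg" by (simp add: pointed_map_def neg_cont)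
  from pointed_homotopic_imp_maps[OF pointed_homotopic_compose_right[OF
      pointed_homotopic_refl[OF loops_map[OF this e_in]] u]]
  show "pointed_map P (loops G e, const_path e) (\<lambda>y. \<lambda>t\<in>{0..1}. neg (u y t))" by blast
  have eq: "pointwise f (\<lambda>t\<in>{0..1}. neg (f t)) = (\<lambda>t\<in>{0..1}. mul (f t) (neg (f t)))" for f
    by (auto simp: pointwise_def fun_eq_iff)
  show "pointed_homotopic P (loops G e, const_path e)
      (\<lambda>y. pointwise (u y) (\<lambda>t\<in>{0..1}. neg (u y t))) (\<lambda>_. const_path e)"
    using pointed_homotopic_compose_right[OF loops_homotopy[OF h_inv_r e_in] u]
    by (simp add: eq const_path_def)
qed

end

context weighted_polyhedral
begin

lemma smash_base_in: "\<tau> \<subseteq> {1..m} \<Longrightarrow> snd (smash \<tau>) \<in> topspace (fst (smash \<tau>))"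
  using topspace_smash[of \<tau>] base_point_in[of \<tau>] by (auto simp: smash_def topspace_collapse)

text \<open>
  A null homotopy of \<open>d \<circ> f\<^sub>\<sigma>\<close> is a lift of \<open>d \<circ> f\<^sub>\<sigma>\<close> to the space of paths that start at the base point.
  If the lift is constant over the subcomplex, it descends to a null homotopy of \<open>d\<close>. In general it is a family
  of loops there, and is first divided by an extension of this family. The quotient is null homotopic,
  as a family of loops, over the subcomplex, and homotopy extension in the path space makes it constant there.
  While this homotopy runs, the end points of the paths are unchanged over the subcomplex, so they too
  define a homotopy of maps out of the smash product.
\<close>

lemma face_map_kernel:
  fixes G :: "'g topology"
  assumes G: "h_group G e0 mul neg" and T: "distinct (leaves T)" "\<And>\<tau>. \<tau> \<in> set (leaves T) \<Longrightarrow> \<tau> \<subseteq> {1..m}"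
    and K: "simplicial_complex_on m K" "K \<subseteq> set (leaves T)"
    and \<sigma>: "\<sigma> \<in> K" "\<sigma> \<noteq> {}" and maximal: "\<And>\<delta>. \<delta> \<in> K \<Longrightarrow> \<sigma> \<subseteq> \<delta> \<Longrightarrow> \<delta> = \<sigma>"
    and d: "pointed_map (smash \<sigma>) (G, e0) d"
    and null: "pointed_homotopic (pWK K) (G, e0) (\<lambda>z. d (face_map \<sigma> z)) (\<lambda>_. e0)"
  shows "pointed_homotopic (smash \<sigma>) (G, e0) d (\<lambda>_. e0)"
proof -
  interpret G: h_group G e0 mul neg by (rule G)
  interpret O: h_group "loops G e0" "const_path e0" concat_path rev_path
    by (rule loops_h_group) simp
  have \<sigma>m: "\<sigma> \<subseteq> {1..m}" by (rule complex_face[OF K(1) \<sigma>(1)])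
  define Y where "Y = WK K"
  define y0 where "y0 = snd (pWK K)"
  have P: "pWK K = (Y, y0)" by (simp add: Y_def y0_def pWK_def)
  have y0: "y0 \<in> topspace Y" unfolding Y_def y0_def by (rule WK_base_in[OF K(1)])
  define L where "L = K - {\<sigma>}"
  have L: "simplicial_complex_on m L" "L \<subseteq> K"
    unfolding L_def using remove_facet[OF K(1) \<sigma> maximal] by auto
  define Y' where "Y' = WK L"
  define y0' where "y0' = snd (pWK L)"
  have P': "pWK L = (Y', y0')" by (simp add: Y'_def y0'_def pWK_def)
  have y0': "y0' \<in> topspace Y'" unfolding Y'_def y0'_def by (rule WK_base_in[OF L(1)])
  have j: "pointed_map (Y', y0') (Y, y0) (incl K)"
    using incl_continuous[OF K(1) L] incl_base[OF K(1) L] by (simp add: pointed_map_def Y'_def Y_def y0'_def y0_def)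
  have jc: "continuous_map Y' Y (incl K)" and jb: "incl K y0' = y0" using j by (simp_all add: pointed_map_def)
  define S where "S = fst (smash \<sigma>)"
  define s0 where "s0 = snd (smash \<sigma>)"
  have PS: "smash \<sigma> = (S, s0)" by (simp add: S_def s0_def)
  have s0: "s0 \<in> topspace S" unfolding S_def s0_def by (rule smash_base_in[OF \<sigma>m])
  have fj: "face_map \<sigma> (incl K z) = s0" if "z \<in> topspace Y'" for z
    using face_map_incl[OF K(1) L \<sigma>m] face_map_absent[OF L(1) \<sigma>m] that by (simp add: L_def Y'_def s0_def)
  have d': "pointed_map (S, s0) (G, e0) d" using d by (simp add: PS)
  obtain H where H: "continuous_map Y (path_space G) H" "\<And>z. H z 0 = e0" "\<And>z. H z 1 = d (face_map \<sigma> z)"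
      "H y0 = (\<lambda>t\<in>{0..1}. e0)"
    using pointed_homotopic_path[OF pointed_homotopic_sym[OF null[unfolded P]] y0] by blast
  \<comment> \<open>Over the subcomplex the null homotopy is a family of loops, which extends over all of \<open>K\<close>.\<close>
  have lam: "pointed_map (Y', y0') (loops G e0, const_path e0) (\<lambda>z. H (incl K z))"
    using continuous_map_compose[OF jc H(1)] H d' fj jb
    by (simp add: pointed_map_def continuous_map_loops_iff o_def const_path_def)
  have "\<exists>a. (\<forall>\<tau>\<in>set (leaves T). pointed_map (smash \<tau>) (loops G e0, const_path e0) (a \<tau>)) \<and>
    pointed_homotopic (pWK L) (loops G e0, const_path e0) (\<lambda>z. bracket concat_path T (\<lambda>\<tau>. a \<tau> (face_map \<tau> z))) (\<lambda>z. H (incl K z))"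
    by (rule maps_from_WK_surj[OF O.h_group_axioms T L(1)]) (use L(2) K(2) lam P' in auto)
  then obtain a where a: "\<And>\<tau>. \<tau> \<in> set (leaves T) \<Longrightarrow> pointed_map (smash \<tau>) (loops G e0, const_path e0) (a \<tau>)"
    and ha: "pointed_homotopic (Y', y0') (loops G e0, const_path e0) (\<lambda>z. bracket concat_path T (\<lambda>\<tau>. a \<tau> (face_map \<tau> z))) (\<lambda>z. H (incl K z))"
    unfolding P' by blast
  define mu where "mu = (\<lambda>z. bracket concat_path T (\<lambda>\<tau>. a \<tau> (face_map \<tau> z)))"
  have mu: "pointed_map (Y, y0) (loops G e0, const_path e0) mu"
    unfolding mu_def
  proof (rule O.bracket_map[OF y0])
    fix \<tau> assume "\<tau> \<in> set (leaves T)"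
    then show "pointed_map (Y, y0) (loops G e0, const_path e0) (\<lambda>z. a \<tau> (face_map \<tau> z))"
      using pointed_homotopic_imp_maps[OF pointed_homotopic_compose_right[OF
            pointed_homotopic_refl[OF a] face_map_pointed[OF K(1) T(2), unfolded P]]] by blast
  qed
  have muj: "mu (incl K z) = bracket concat_path T (\<lambda>\<tau>. a \<tau> (face_map \<tau> z))" if "z \<in> topspace Y'" for z
    unfolding mu_def using face_map_incl[OF K(1) L T(2)] that by (intro bracket_cong) (simp add: Y'_def)
  have mujp: "pointed_map (Y', y0') (loops G e0, const_path e0) (\<lambda>z. mu (incl K z))"
    using pointed_homotopic_imp_maps[OF pointed_homotopic_compose_right[OF pointed_homotopic_refl[OF mu] j]] by blast
  have lm: "pointed_homotopic (Y', y0') (loops G e0, const_path e0) (\<lambda>z. H (incl K z)) (\<lambda>z. mu (incl K z))"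
    using pointed_homotopic_trans[OF pointed_homotopic_sym[OF ha] pointed_homotopic_sym[OF pointed_homotopic_eq[OF mujp y0' muj]]] .
  define nmu where "nmu = (\<lambda>z. \<lambda>t\<in>{0..1}. neg (mu z t))"
  have nmu: "pointed_map (Y, y0) (loops G e0, const_path e0) nmu"
    unfolding nmu_def by (rule G.pointwise_inverse(1)[OF mu])
  have nmuj: "pointed_map (Y', y0') (loops G e0, const_path e0) (\<lambda>z. nmu (incl K z))"
    using pointed_homotopic_imp_maps[OF pointed_homotopic_compose_right[OF pointed_homotopic_refl[OF nmu] j]] by blast
  \<comment> \<open>Dividing by the extension makes the null homotopy trivial, up to homotopy, over the subcomplex.\<close>
  define Hh where "Hh = (\<lambda>z. G.pointwise (H z) (nmu z))"
  have "pointed_homotopic (Y', y0') (loops G e0, const_path e0) (\<lambda>z. Hh (incl K z)) (\<lambda>z. G.pointwise (mu (incl K z)) (nmu (incl K z)))"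
    unfolding Hh_def by (rule G.pointwise_cong[OF lm pointed_homotopic_refl[OF nmuj] y0'])
  also have "pointed_homotopic (Y', y0') (loops G e0, const_path e0) \<dots> (\<lambda>_. const_path e0)"
    unfolding nmu_def by (rule G.pointwise_inverse(2)[OF mujp])
  finally have hn: "pointed_homotopic (Y', y0') (loops G e0, const_path e0) (\<lambda>z. Hh (incl K z)) (\<lambda>_. const_path e0)" .
  obtain h where h: "continuous_map Y' (path_space (loops G e0)) h" "\<And>z. h z 0 = Hh (incl K z)"
      "\<And>z. h z 1 = const_path e0" "h y0' = (\<lambda>t\<in>{0..1}. const_path e0)"
    using pointed_homotopic_path[OF hn y0'] by blast
  define Z where "Z = subtopology (path_space G) {f. f 0 = e0}"
  have hZ: "continuous_map Y' (path_space Z) h"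
    using continuous_map_path_space_mono[OF h(1)[unfolded loops_def], of "{f. f 0 = e0}"] by (auto simp: Z_def)
  have nmuc: "continuous_map Y (path_space G) nmu" "\<And>z. z \<in> topspace Y \<Longrightarrow> nmu z 0 = e0 \<and> nmu z 1 = e0"
    using nmu by (auto simp: pointed_map_def continuous_map_loops_iff)
  have HhZ: "continuous_map Y Z Hh"
    using G.pointwise_continuous[OF H(1) nmuc(1)] nmuc(2) H(2)
    by (auto simp: Z_def continuous_map_in_subtopology Hh_def G.pointwise_def)
  have "\<exists>k. continuous_map (WK K) (path_space Z) k \<and> (\<forall>y\<in>topspace (WK K). k y 0 = Hh y) \<and>
      (\<forall>y\<in>topspace (WK (K - {\<sigma>})). k (incl K y) = h y)"
    by (rule WK_hep[OF K(1) \<sigma> maximal]) (use HhZ hZ h(2) in \<open>simp_all add: Y_def Y'_def L_def\<close>)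
  then obtain k where k: "continuous_map Y (path_space Z) k" "\<And>z. z \<in> topspace Y \<Longrightarrow> k z 0 = Hh z"
    "\<And>z. z \<in> topspace Y' \<Longrightarrow> k (incl K z) = h z"
    unfolding Y_def Y'_def L_def by blast
  have kin: "k z s \<in> topspace Z" if "z \<in> topspace Y" "s \<in> {0..1}" for z s
    using funcset_mem[OF continuous_map_funspace[OF k(1)]] that path_in_topspace by fastforce
  have hin: "h z s \<in> topspace (loops G e0)" if "z \<in> topspace Y'" "s \<in> {0..1}" for z s
    using funcset_mem[OF continuous_map_funspace[OF h(1)]] that path_in_topspace by fastforce
  have ku: "continuous_map (prod_topology I01 Y) (path_space G) (\<lambda>(s, z). k z s)"
    using continuous_map_uncurry[OF k(1)] by (simp add: Z_def continuous_map_in_subtopology)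
  define E where "E = (\<lambda>z. \<lambda>s\<in>{0..1}. k z s 1)"
  have E: "continuous_map (WK K) (path_space G) E"
  proof -
    have "continuous_map (prod_topology I01 Y) G (\<lambda>p. (\<lambda>(s, z). k z s) p 1)"
      by (rule continuous_map_path_eval[OF ku]) simp
    from continuous_map_curry[OF this] show ?thesis by (simp add: E_def Y_def)
  qed
  have Ej: "E (incl K z) = const_path e0" if "z \<in> topspace (WK (K - {\<sigma>}))" for z
    using that hin k(3) by (auto simp: E_def const_path_def topspace_loops Y'_def L_def fun_eq_iff)
  obtain bE where bE: "pointed_map (smash \<sigma>) (path_space G, const_path e0) bE"
    "\<forall>z\<in>topspace (WK K). E z = bE (face_map \<sigma> z)"
    using WK_descend[OF K(1) \<sigma> maximal E Ej] by blast
  have kc1: "continuous_map (WK K) (path_space G) (\<lambda>z. k z 1)"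
    using continuous_map_path_eval[OF k(1), of "\<lambda>_. 1"] by (simp add: Y_def Z_def continuous_map_in_subtopology)
  have k1j: "k (incl K z) 1 = const_path e0" if "z \<in> topspace (WK (K - {\<sigma>}))" for z
    using that k(3) h(3) by (simp add: Y'_def L_def)
  obtain bL where bL: "pointed_map (smash \<sigma>) (path_space G, const_path e0) bL"
    "\<forall>z\<in>topspace (WK K). k z 1 = bL (face_map \<sigma> z)"
    using WK_descend[OF K(1) \<sigma> maximal kc1 k1j] by blast
  have val: "bE x 0 = mul (d x) e0 \<and> bE x 1 = bL x 1 \<and> bL x 0 = e0" if x: "x \<in> topspace S" for x
  proof -
    obtain z where z: "z \<in> topspace (WK K)" "x = face_map \<sigma> z"
      using face_map_surj[OF K(1) \<sigma>(1) x[unfolded S_def]] by blast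
    have zY: "z \<in> topspace Y" using z(1) by (simp add: Y_def)
    have bEx: "bE x = (\<lambda>s\<in>{0..1}. k z s 1)" using bspec[OF bE(2) z(1)] z(2) by (simp add: E_def)
    have "bE x 0 = k z 0 1" by (simp add: bEx)
    also have "\<dots> = mul (d x) e0" using k(2)[OF zY] nmuc(2)[OF zY] H(3) z(2) by (simp add: Hh_def G.pointwise_def)
    finally have 1: "bE x 0 = mul (d x) e0" .
    have "bE x 1 = k z 1 1" by (simp add: bEx)
    moreover have "bL x = k z 1" using bL(2) z by simp
    ultimately show ?thesis using 1 kin[OF zY, of 1] by (simp add: Z_def)
  qed
  have "pointed_homotopic (S, s0) (G, e0) d (\<lambda>x. mul (d x) e0)"
    by (rule pointed_homotopic_sym[OF G.unit_r[OF d']])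
  also have "pointed_homotopic (S, s0) (G, e0) \<dots> (\<lambda>x. bL x 1)"
    by (rule pointed_homotopicI_paths[of _ _ bE, OF _ s0])
      (use bE(1) val in \<open>auto simp: PS pointed_map_def\<close>)
  also have "pointed_homotopic (S, s0) (G, e0) \<dots> (\<lambda>_. e0)"
    by (rule pointed_homotopic_sym, rule pointed_homotopicI_paths[of _ _ bL, OF _ s0])
      (use bL(1) val in \<open>auto simp: PS pointed_map_def\<close>)
  finally show ?thesis unfolding PS .
qed

text \<open>
  The factors over the smaller complex agree by induction, hence so do the composites with \<open>f\<^sub>\<sigma>\<close> of the
  two factors at the facet after cancelling. Their quotient is then null homotopic by \<open>face_map_kernel\<close>.
\<close>

lemma maps_from_WK_inj:
  fixes G :: "'g topology"
  assumes G: "h_group G e0 mul neg" and T: "distinct (leaves T)" "\<And>\<tau>. \<tau> \<in> set (leaves T) \<Longrightarrow> \<tau> \<subseteq> {1..m}"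
    and K: "simplicial_complex_on m K" "K \<subseteq> set (leaves T)"
    and a: "\<And>\<tau>. \<tau> \<in> set (leaves T) \<Longrightarrow> pointed_map (smash \<tau>) (G, e0) (a \<tau>)"
    and a': "\<And>\<tau>. \<tau> \<in> set (leaves T) \<Longrightarrow> pointed_map (smash \<tau>) (G, e0) (a' \<tau>)"
    and hom: "pointed_homotopic (pWK K) (G, e0) (\<lambda>z. bracket mul T (\<lambda>\<tau>. a \<tau> (face_map \<tau> z)))
      (\<lambda>z. bracket mul T (\<lambda>\<tau>. a' \<tau> (face_map \<tau> z)))"
  shows "\<tau> \<in> K \<Longrightarrow> pointed_homotopic (smash \<tau>) (G, e0) (a \<tau>) (a' \<tau>)"
  using K hom
proof (induction "card K" arbitrary: K \<tau> rule: less_induct)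
  case less
  interpret G: h_group G e0 mul neg by (rule G)
  note \<tau> = less.prems(1) and K = less.prems(2,3) and hom = less.prems(4)
  define Y where "Y = WK K"
  define y0 where "y0 = snd (pWK K)"
  have P: "pWK K = (Y, y0)" by (simp add: Y_def y0_def pWK_def)
  have y0: "y0 \<in> topspace Y" unfolding Y_def y0_def by (rule WK_base_in[OF K(1)])
  show ?case
  proof (cases "K = {{}}")
    case True
    then have [simp]: "\<tau> = {}" using \<tau> by simp
    have e: "{} \<in> set (leaves T)" using K(2) True by blast
    have "a {} x = a' {} x" if "x \<in> topspace (fst (smash {}))" for x
    proof -
      have "x = snd (smash {})" using that topspace_smash[of "{}"] by (auto simp: poly_set_empty smash_def)
      then show ?thesis using a[OF e] a'[OF e] by (simp add: pointed_map_def)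
    qed
    then show ?thesis
      using pointed_homotopic_eq[of "fst (smash {})" "snd (smash {})" "(G, e0)" "a {}" "a' {}"] a[OF e] smash_base_in[of "{}"]
      by simp
  next
    case False
    obtain \<sigma> where \<sigma>: "\<sigma> \<in> K" "\<sigma> \<noteq> {}" and maximal: "\<And>\<delta>. \<delta> \<in> K \<Longrightarrow> \<sigma> \<subseteq> \<delta> \<Longrightarrow> \<delta> = \<sigma>"
      using complex_facet[OF K(1) False] by blast
    have \<sigma>m: "\<sigma> \<subseteq> {1..m}" by (rule complex_face[OF K(1) \<sigma>(1)])
    have \<sigma>T: "\<sigma> \<in> set (leaves T)" using \<sigma>(1) K(2) by blast
    define L where "L = K - {\<sigma>}"
    have L: "simplicial_complex_on m L" "L \<subseteq> K"
      unfolding L_def using remove_facet[OF K(1) \<sigma> maximal] by auto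
    define Y' where "Y' = WK L"
    define y0' where "y0' = snd (pWK L)"
    have P': "pWK L = (Y', y0')" by (simp add: Y'_def y0'_def pWK_def)
    have y0': "y0' \<in> topspace Y'" unfolding Y'_def y0'_def by (rule WK_base_in[OF L(1)])
    have j: "pointed_map (Y', y0') (Y, y0) (incl K)"
      using incl_continuous[OF K(1) L] incl_base[OF K(1) L] by (simp add: pointed_map_def Y'_def Y_def y0'_def y0_def)
    have fm: "pointed_map (Y', y0') (smash \<tau>) (face_map \<tau>)" if "\<tau> \<in> set (leaves T)" for \<tau>
      using face_map_pointed[OF L(1) T(2)[OF that]] by (simp add: P')
    have am: "pointed_map (Y', y0') (G, e0) (\<lambda>z. bracket mul T (\<lambda>\<tau>. b \<tau> (face_map \<tau> z)))"
      if b: "\<And>\<tau>. \<tau> \<in> set (leaves T) \<Longrightarrow> pointed_map (smash \<tau>) (G, e0) (b \<tau>)" for b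
    proof (rule G.bracket_map[OF y0'])
      fix \<tau> assume "\<tau> \<in> set (leaves T)"
      then show "pointed_map (Y', y0') (G, e0) (\<lambda>z. b \<tau> (face_map \<tau> z))"
        using pointed_homotopic_imp_maps[OF pointed_homotopic_compose_right[OF pointed_homotopic_refl[OF b] fm]] by blast
    qed
    have restr: "bracket mul T (\<lambda>\<tau>. b \<tau> (face_map \<tau> z)) = bracket mul T (\<lambda>\<tau>. b \<tau> (face_map \<tau> (incl K z)))"
      if "z \<in> topspace Y'" for b z
      using face_map_incl[OF K(1) L T(2)] that by (intro bracket_cong) (simp add: Y'_def)
    have ama: "pointed_map (Y', y0') (G, e0) (\<lambda>z. bracket mul T (\<lambda>\<tau>. a \<tau> (face_map \<tau> z)))"
      and ama': "pointed_map (Y', y0') (G, e0) (\<lambda>z. bracket mul T (\<lambda>\<tau>. a' \<tau> (face_map \<tau> z)))"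
      by (rule am, rule a, assumption) (rule am, rule a', assumption)
    have "pointed_homotopic (Y', y0') (G, e0) (\<lambda>z. bracket mul T (\<lambda>\<tau>. a \<tau> (face_map \<tau> z)))
        (\<lambda>z. bracket mul T (\<lambda>\<tau>. a \<tau> (face_map \<tau> (incl K z))))"
      by (rule pointed_homotopic_eq[OF ama y0']) (rule restr)
    also have "pointed_homotopic (Y', y0') (G, e0) \<dots> (\<lambda>z. bracket mul T (\<lambda>\<tau>. a' \<tau> (face_map \<tau> (incl K z))))"
      by (rule pointed_homotopic_compose_right[OF hom[unfolded P] j])
    also have "pointed_homotopic (Y', y0') (G, e0) \<dots> (\<lambda>z. bracket mul T (\<lambda>\<tau>. a' \<tau> (face_map \<tau> z)))"
      by (rule pointed_homotopic_sym, rule pointed_homotopic_eq[OF ama' y0']) (rule restr)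
    finally have homL: "pointed_homotopic (pWK L) (G, e0) (\<lambda>z. bracket mul T (\<lambda>\<tau>. a \<tau> (face_map \<tau> z)))
        (\<lambda>z. bracket mul T (\<lambda>\<tau>. a' \<tau> (face_map \<tau> z)))"
      unfolding P' .
    have "card L < card K"
      unfolding L_def by (rule card_Diff1_less[OF finite_complex[OF K(1)] \<sigma>(1)])
    then have IH: "pointed_homotopic (smash \<tau>) (G, e0) (a \<tau>) (a' \<tau>)" if "\<tau> \<in> L" for \<tau>
      using less.hyps[OF _ that L(1) _ homL] L(2) K(2) by blast
    define h where "h = (\<lambda>\<tau> z. a' \<tau> (face_map \<tau> z))"
    have fK: "pointed_map (Y, y0) (smash \<tau>) (face_map \<tau>)" if "\<tau> \<in> set (leaves T)" for \<tau>
      using face_map_pointed[OF K(1) T(2)[OF that]] by (simp add: P)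
    have h: "pointed_map (Y, y0) (G, e0) (h \<tau>)" if "\<tau> \<in> set (leaves T)" for \<tau>
      unfolding h_def using pointed_homotopic_imp_maps[OF pointed_homotopic_compose_right[OF
            pointed_homotopic_refl[OF a'[OF that]] fK[OF that]]] by blast
    have af: "pointed_map (Y, y0) (G, e0) (\<lambda>z. a \<tau> (face_map \<tau> z))" if "\<tau> \<in> set (leaves T)" for \<tau>
      using pointed_homotopic_imp_maps[OF pointed_homotopic_compose_right[OF
            pointed_homotopic_refl[OF a[OF that]] fK[OF that]]] by blast
    have "\<exists>u v. pointed_map (Y, y0) (G, e0) u \<and> pointed_map (Y, y0) (G, e0) v \<and>
      (\<forall>b. pointed_map (Y, y0) (G, e0) b \<longrightarrow> pointed_homotopic (Y, y0) (G, e0)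
        (\<lambda>z. bracket mul T (\<lambda>j. if j = \<sigma> then b z else h j z)) (\<lambda>z. mul (mul (u z) (b z)) (v z)))"
      by (rule G.bracket_isolate[OF y0 T(1) \<sigma>T]) (rule h)
    then obtain u v where u: "pointed_map (Y, y0) (G, e0) u" and v: "pointed_map (Y, y0) (G, e0) v"
      and uv: "\<And>b. pointed_map (Y, y0) (G, e0) b \<Longrightarrow> pointed_homotopic (Y, y0) (G, e0)
        (\<lambda>z. bracket mul T (\<lambda>j. if j = \<sigma> then b z else h j z)) (\<lambda>z. mul (mul (u z) (b z)) (v z))"
      by blast
    let ?b = "\<lambda>z. a \<sigma> (face_map \<sigma> z)" and ?b' = "\<lambda>z. a' \<sigma> (face_map \<sigma> z)"
    have b: "pointed_map (Y, y0) (G, e0) ?b" by (rule af[OF \<sigma>T])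
    have b': "pointed_map (Y, y0) (G, e0) ?b'" using h[OF \<sigma>T] by (simp add: h_def)
    have term_hom: "pointed_homotopic (Y, y0) (G, e0) (\<lambda>z. if j = \<sigma> then ?b z else h j z) (\<lambda>z. a j (face_map j z))"
      if jT: "j \<in> set (leaves T)" for j
    proof -
      consider "j = \<sigma>" | "j \<in> L" | "j \<notin> K" by (auto simp: L_def)
      then show ?thesis
      proof cases
        case 1
        then show ?thesis using pointed_homotopic_refl[OF b] by simp
      next
        case 2
        then have "j \<noteq> \<sigma>" by (simp add: L_def)
        then show ?thesis
          using pointed_homotopic_compose_right[OF pointed_homotopic_sym[OF IH[OF 2]] fK[OF jT]] by (simp add: h_def)
      next
        case 3
        then have "j \<noteq> \<sigma>" using \<sigma>(1) by blast
        moreover have "h j z = a j (face_map j z)" if "z \<in> topspace Y" for z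
          using face_map_absent[OF K(1) T(2)[OF jT] 3, of z] that a[OF jT] a'[OF jT] by (simp add: h_def pointed_map_def Y_def)
        ultimately show ?thesis using pointed_homotopic_eq[OF h[OF jT] y0] by simp
      qed
    qed
    have "pointed_homotopic (Y, y0) (G, e0) (\<lambda>z. mul (mul (u z) (?b z)) (v z))
        (\<lambda>z. bracket mul T (\<lambda>j. if j = \<sigma> then ?b z else h j z))"
      by (rule pointed_homotopic_sym[OF uv[OF b]])
    also have "pointed_homotopic (Y, y0) (G, e0) \<dots> (\<lambda>z. bracket mul T (\<lambda>\<tau>. a \<tau> (face_map \<tau> z)))"
      by (rule G.bracket_homotopic[OF y0]) (rule term_hom)
    also have "pointed_homotopic (Y, y0) (G, e0) \<dots> (\<lambda>z. bracket mul T (\<lambda>\<tau>. a' \<tau> (face_map \<tau> z)))"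
      by (rule hom[unfolded P])
    also have "(\<lambda>z. bracket mul T (\<lambda>\<tau>. a' \<tau> (face_map \<tau> z))) = (\<lambda>z. bracket mul T (\<lambda>j. if j = \<sigma> then ?b' z else h j z))"
      by (rule ext, rule bracket_cong) (simp add: h_def)
    also have "pointed_homotopic (Y, y0) (G, e0) \<dots> (\<lambda>z. mul (mul (u z) (?b' z)) (v z))"
      by (rule uv[OF b'])
    finally have bb: "pointed_homotopic (Y, y0) (G, e0) ?b ?b'"
      by (rule G.cancel[OF y0 u v b b'])
    let ?d = "\<lambda>x. mul (neg (a \<sigma> x)) (a' \<sigma> x)"
    have d: "pointed_map (smash \<sigma>) (G, e0) ?d"
      by (intro G.mul_map G.neg_map a a' \<sigma>T)
    have "pointed_homotopic (Y, y0) (G, e0) (\<lambda>z. ?d (face_map \<sigma> z)) (\<lambda>z. mul (neg (?b z)) (?b z))"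
      by (rule G.mul_cong[OF pointed_homotopic_refl[OF G.neg_map[OF b]] pointed_homotopic_sym[OF bb] y0])
    also have "pointed_homotopic (Y, y0) (G, e0) \<dots> (\<lambda>_. e0)"
      by (rule G.inv_l[OF b])
    finally have null: "pointed_homotopic (pWK K) (G, e0) (\<lambda>z. ?d (face_map \<sigma> z)) (\<lambda>_. e0)" unfolding P .
    have dn: "pointed_homotopic (smash \<sigma>) (G, e0) ?d (\<lambda>_. e0)"
      by (rule face_map_kernel[OF G T K \<sigma> maximal d null])
    have "pointed_homotopic (fst (smash \<sigma>), snd (smash \<sigma>)) (G, e0) (a \<sigma>) (a' \<sigma>)"
      by (rule G.homotopic_if_quotient_trivial[OF smash_base_in[OF \<sigma>m]]) (use dn a[OF \<sigma>T] a'[OF \<sigma>T] in simp_all)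
    then show ?thesis using IH \<tau> by (cases "\<tau> = \<sigma>") (auto simp: L_def)
  qed
qed

end

section \<open>Suspensions and wedges\<close>

lemma susp_in_eq_iff: "susp_in P q = susp_in P r \<longleftrightarrow> q = r \<or> q \<in> susp_base P \<and> r \<in> susp_base P"
  by (simp add: susp_in_def collapse_map_eq_iff)

lemma susp_in_idem [simp]: "susp_in P (susp_in P q) = susp_in P q"
  by (simp add: susp_in_def)

lemma susp_in_respects:
  assumes "\<And>y t. y \<in> topspace (fst P) \<Longrightarrow> t \<in> {0..1} \<Longrightarrow> t = 0 \<or> t = 1 \<or> y = snd P \<Longrightarrow> f (y, t) = z"
  shows "f (susp_in P q) = f q"
  unfolding susp_in_def by (rule collapse_map_respects) (use assms in \<open>auto simp: susp_base_def\<close>)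

lemma susp_in_product:
  assumes "y \<in> topspace (fst P)" "t \<in> {0..1}"
  shows "susp_in P (y, t) \<in> topspace (fst P) \<times> {0..1}"
proof (cases "(y, t) \<in> susp_base P")
  case True
  then have "susp_in P (y, t) \<in> susp_base P"
    using susp_in_idem[of P "(y, t)"] susp_in_eq_iff by metis
  then show ?thesis by (auto simp: susp_base_def)
next
  case False
  then have "susp_in P (y, t) = (y, t)"
    using collapse_map_outside by (simp add: susp_in_def)
  then show ?thesis using assms by simp
qed

lemma topspace_susp: "topspace (fst (susp P)) = susp_in P ` (topspace (fst P) \<times> {0..1})"
  by (simp add: susp_def topspace_collapse cg_times_def susp_in_def)

lemma susp_point:
  assumes "q \<in> topspace (fst (susp P))"
  shows "susp_in P q = q" and "fst q \<in> topspace (fst P)" and "snd q \<in> {0..1}"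
proof -
  obtain y t where q: "q = susp_in P (y, t)" "y \<in> topspace (fst P)" "t \<in> {0..1}"
    using assms by (auto simp: topspace_susp)
  then show "susp_in P q = q" by simp
  show "fst q \<in> topspace (fst P)" "snd q \<in> {0..1}"
    using susp_in_product[OF q(2,3)] q(1) by (simp_all add: mem_Times_iff)
qed

lemma susp_in_base:
  assumes "snd P \<in> topspace (fst P)" "y \<in> topspace (fst P)" "t \<in> {0..1}" "t = 0 \<or> t = 1 \<or> y = snd P"
  shows "susp_in P (y, t) = snd (susp P)"
  using assms by (simp add: susp_def susp_in_eq_iff susp_base_def)

lemma snd_susp: "snd (susp P) = susp_in P (snd P, 0)"
  by (simp add: susp_def)

lemma susp_base_in: "snd P \<in> topspace (fst P) \<Longrightarrow> snd (susp P) \<in> topspace (fst (susp P))"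
  by (auto simp: topspace_susp snd_susp)

lemma continuous_map_suspI:
  assumes f: "continuous_map (prod_topology (fst P) I01) Z f"
    and base: "\<And>y t. y \<in> topspace (fst P) \<Longrightarrow> t \<in> {0..1} \<Longrightarrow> t = 0 \<or> t = 1 \<or> y = snd P \<Longrightarrow> f (y, t) = z0"
  shows "continuous_map (fst (susp P)) Z f"
  unfolding susp_def fst_conv cg_times_def
  by (rule continuous_map_collapseI[OF continuous_map_from_kification[OF f]])
    (use base in \<open>auto simp: susp_base_def\<close>)

definition susp_unit :: "'p pointed \<Rightarrow> 'p \<Rightarrow> real \<Rightarrow> 'p \<times> real" where
  "susp_unit P y = (\<lambda>t\<in>{0..1}. susp_in P (y, t))"

lemma continuous_map_prod_swap: "continuous_map (prod_topology X Y) (prod_topology Y X) (\<lambda>p. (snd p, fst p))"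
  by (simp add: continuous_map_paired continuous_map_fst continuous_map_snd)

text \<open>
  The unit of the adjunction between suspensions and loop spaces. For a compactly generated space the
  product with the interval is already compactly generated.
\<close>

lemma susp_unit_map:
  assumes k: "k_space (fst P)" and b: "snd P \<in> topspace (fst P)"
  shows "pointed_map P (loops (fst (susp P)) (snd (susp P)), const_path (snd (susp P))) (susp_unit P)"
proof -
  have "k_space (prod_topology (fst P) I01)"
    by (rule k_space_prod_topology_right[OF k compact_imp_locally_compact_space])
      (simp_all add: compact_space_subtopology Hausdorff_space_subtopology)
  then have "cg_times (fst P) I01 = prod_topology (fst P) I01"
    by (simp add: cg_times_def kification_eq_self)
  then have "continuous_map (prod_topology (fst P) I01) (fst (susp P)) (susp_in P)"
    using quotient_imp_continuous_map[OF quotient_map_collapse[of "prod_topology (fst P) I01" "susp_base P"]]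
    by (simp add: susp_def susp_in_def)
  from continuous_map_curry[OF continuous_map_compose[OF continuous_map_prod_swap this]]
  have "continuous_map (fst P) (path_space (fst (susp P))) (susp_unit P)"
    by (simp add: susp_unit_def[abs_def])
  moreover have "susp_unit P y 0 = snd (susp P)" "susp_unit P y 1 = snd (susp P)" if "y \<in> topspace (fst P)" for y
    using susp_in_base[OF b that] by (simp_all add: susp_unit_def)
  moreover have "susp_unit P (snd P) = const_path (snd (susp P))"
    using susp_in_base[OF b b] by (auto simp: susp_unit_def const_path_def fun_eq_iff)
  ultimately show ?thesis by (simp add: pointed_map_def continuous_map_loops_iff)
qed

text \<open>
  The adjoint of a map into a loop space. It has a simple form because maps out of a quotient are
  evaluated on representatives.
\<close>

lemma susp_lift:
  assumes \<phi>: "pointed_map P (loops Z z0, const_path z0) \<phi>" and b: "snd P \<in> topspace (fst P)"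
  shows "pointed_map (susp P) (Z, z0) (\<lambda>(y, t). \<phi> y t)"
    and "(\<lambda>(y, t). \<phi> y t) (susp_in P q) = (\<lambda>(y, t). \<phi> y t) q"
proof -
  have c: "continuous_map (fst P) (path_space Z) \<phi>" and e: "\<And>y. y \<in> topspace (fst P) \<Longrightarrow> \<phi> y 0 = z0 \<and> \<phi> y 1 = z0"
    and p: "\<phi> (snd P) = const_path z0"
    using \<phi> by (auto simp: pointed_map_def continuous_map_loops_iff)
  have base: "(\<lambda>(y, t). \<phi> y t) (y, t) = z0"
    if "y \<in> topspace (fst P)" "t \<in> {0..1}" "t = 0 \<or> t = 1 \<or> y = snd P" for y t
    using that e p by auto
  show r: "(\<lambda>(y, t). \<phi> y t) (susp_in P q) = (\<lambda>(y, t). \<phi> y t) q" for q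
    by (rule susp_in_respects[where f = "\<lambda>(y, t). \<phi> y t"]) (rule base)
  have "continuous_map (prod_topology (fst P) I01) Z ((\<lambda>(t, y). \<phi> y t) \<circ> (\<lambda>p. (snd p, fst p)))"
    by (rule continuous_map_compose[OF continuous_map_prod_swap continuous_map_uncurry[OF c]])
  then have "continuous_map (prod_topology (fst P) I01) Z (\<lambda>(y, t). \<phi> y t)"
    by (simp add: o_def case_prod_unfold)
  then have "continuous_map (fst (susp P)) Z (\<lambda>(y, t). \<phi> y t)"
    by (rule continuous_map_suspI) (rule base)
  moreover have "(\<lambda>(y, t). \<phi> y t) (snd (susp P)) = z0"
    unfolding susp_def snd_conv r by (simp add: p)
  ultimately show "pointed_map (susp P) (Z, z0) (\<lambda>(y, t). \<phi> y t)" by (simp add: pointed_map_def)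
qed

lemma susp_lift_homotopic:
  assumes h: "pointed_homotopic P (loops Z z0, const_path z0) \<phi> \<psi>" and b: "snd P \<in> topspace (fst P)"
  shows "pointed_homotopic (susp P) (Z, z0) (\<lambda>(y, t). \<phi> y t) (\<lambda>(y, t). \<psi> y t)"
proof -
  obtain H where H: "continuous_map (fst P) (path_space (loops Z z0)) H" "\<And>y. H y 0 = \<phi> y" "\<And>y. H y 1 = \<psi> y"
      "H (snd P) = (\<lambda>t\<in>{0..1}. const_path z0)"
    using pointed_homotopic_path[of "fst P" "snd P" "loops Z z0" "const_path z0" \<phi> \<psi>] h b by auto
  let ?H = "\<lambda>(y, t). \<lambda>s\<in>{0..1}. H y s t"
  have Hin: "H y s \<in> topspace (loops Z z0)" if "y \<in> topspace (fst P)" "s \<in> {0..1}" for y s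
    using funcset_mem[OF continuous_map_funspace[OF H(1)]] that path_in_topspace by fastforce
  have base: "?H (y, t) = const_path z0"
    if "y \<in> topspace (fst P)" "t \<in> {0..1}" "t = 0 \<or> t = 1 \<or> y = snd P" for y t
    using that Hin[OF that(1)] H(4) by (auto simp: const_path_def topspace_loops fun_eq_iff)
  let ?Q = "prod_topology I01 (prod_topology (fst P) I01)"
  have y: "continuous_map ?Q (fst P) (\<lambda>p. fst (snd p))" and t: "continuous_map ?Q I01 (\<lambda>p. snd (snd p))"
    using continuous_map_compose[OF continuous_map_snd continuous_map_fst, of I01 "fst P" I01]
      continuous_map_compose[OF continuous_map_snd continuous_map_snd, of I01 "fst P" I01] by (simp_all add: o_def)
  have "continuous_map ?Q (path_space (loops Z z0)) (\<lambda>p. H (fst (snd p)))"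
    using continuous_map_compose[OF y H(1)] by (simp add: o_def)
  from continuous_map_path_eval[OF this continuous_map_fst]
  have "continuous_map ?Q (path_space Z) (\<lambda>p. H (fst (snd p)) (fst p))"
    by (simp add: continuous_map_loops_iff)
  from continuous_map_curry[OF continuous_map_path_eval[OF this t]]
  have "continuous_map (prod_topology (fst P) I01) (path_space Z) ?H"
    by (simp add: case_prod_unfold)
  then have Hc: "continuous_map (fst (susp P)) (path_space Z) ?H"
    by (rule continuous_map_suspI) (rule base)
  have r: "?H (susp_in P q) = ?H q" for q
    by (rule susp_in_respects[where f = ?H]) (rule base)
  have "?H (snd (susp P)) = const_path z0"
    unfolding susp_def snd_conv r using base[OF b, of 0] by simp
  then have "pointed_homotopic (fst (susp P), snd (susp P)) (Z, z0) (\<lambda>(y, t). \<phi> y t) (\<lambda>(y, t). \<psi> y t)"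
    by (intro pointed_homotopicI_paths[OF Hc susp_base_in[OF b]]) (auto simp: H case_prod_unfold)
  then show ?thesis by simp
qed

lemma susp_map_in:
  assumes f: "\<And>y. y \<in> topspace (fst P) \<Longrightarrow> f y \<in> topspace (fst Q)" and fb: "f (snd P) = snd Q"
    and b: "snd P \<in> topspace (fst P)"
  shows "susp_map Q f (susp_in P (y, t)) = susp_in Q (f y, t)" and "susp_map Q f (snd (susp P)) = snd (susp Q)"
proof -
  have Qb: "snd Q \<in> topspace (fst Q)" using f[OF b] fb by simp
  have r: "susp_map Q f (susp_in P q) = susp_map Q f q" for q
    by (rule susp_in_respects[where f = "susp_map Q f" and z = "snd (susp Q)"])
      (use f fb susp_in_base[OF Qb] in \<open>auto simp: susp_map_def\<close>)
  show "susp_map Q f (susp_in P (y, t)) = susp_in Q (f y, t)"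
    unfolding r by (simp add: susp_map_def)
  show "susp_map Q f (snd (susp P)) = snd (susp Q)"
    unfolding susp_def snd_conv r by (simp add: susp_map_def fb)
qed

lemma wedge_in_base: "j \<in> J \<Longrightarrow> wedge_in Z J (j, snd (Z j)) = snd (wedge Z J)"
proof -
  assume j: "j \<in> J"
  then have b: "(j, snd (Z j)) \<in> wedge_base Z J" by (auto simp: wedge_base_def)
  then have "(SOME q. q \<in> wedge_base Z J) \<in> wedge_base Z J" by (rule someI)
  with b show ?thesis by (simp add: wedge_def wedge_in_def collapse_map_eq_iff)
qed

lemma wedge_in_respects:
  assumes "\<And>j. j \<in> J \<Longrightarrow> f (j, snd (Z j)) = z"
  shows "f (wedge_in Z J q) = f q"
  unfolding wedge_in_def by (rule collapse_map_respects) (use assms in \<open>auto simp: wedge_base_def\<close>)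

lemma topspace_wedge: "topspace (fst (wedge Z J)) = wedge_in Z J ` (SIGMA j:J. topspace (fst (Z j)))"
  by (simp add: wedge_def topspace_collapse wedge_in_def o_def)

lemma wedge_in_idem [simp]: "wedge_in Z J (wedge_in Z J q) = wedge_in Z J q"
  by (simp add: wedge_in_def)

lemma wedge_point:
  assumes "q \<in> topspace (fst (wedge Z J))" and b: "\<And>j. j \<in> J \<Longrightarrow> snd (Z j) \<in> topspace (fst (Z j))"
  shows "wedge_in Z J q = q" and "fst q \<in> J" and "snd q \<in> topspace (fst (Z (fst q)))"
proof -
  obtain j y where q: "q = wedge_in Z J (j, y)" "j \<in> J" "y \<in> topspace (fst (Z j))"
    using assms(1) by (auto simp: topspace_wedge)
  then show "wedge_in Z J q = q" by simp
  have "q \<in> (SIGMA j:J. topspace (fst (Z j)))"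
  proof (cases "(j, y) \<in> wedge_base Z J")
    case True
    then have "q \<in> wedge_base Z J"
      using \<open>wedge_in Z J q = q\<close> q(1) collapse_map_eq_iff[of "wedge_base Z J" q "(j, y)"] by (auto simp: wedge_in_def)
    then show ?thesis using b by (auto simp: wedge_base_def)
  next
    case False
    then have "wedge_in Z J (j, y) = (j, y)"
      using collapse_map_outside[of "(j, y)" "wedge_base Z J"] by (simp add: wedge_in_def)
    then show ?thesis using q by simp
  qed
  then show "fst q \<in> J" "snd q \<in> topspace (fst (Z (fst q)))" by auto
qed

lemma wedge_in_map:
  assumes "j \<in> J"
  shows "pointed_map (Z j) (wedge Z J) (\<lambda>y. wedge_in Z J (j, y))"
proof -
  have "continuous_map (sum_topology (\<lambda>j. fst (Z j)) J) (fst (wedge Z J)) (wedge_in Z J)"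
    by (simp add: wedge_def wedge_in_def quotient_imp_continuous_map[OF quotient_map_collapse])
  from continuous_map_compose[OF continuous_map_component_injection[OF assms] this]
  show ?thesis using wedge_in_base[OF assms] by (simp add: pointed_map_def o_def)
qed

lemma wedge_base_point_in:
  assumes "j \<in> J" "snd (Z j) \<in> topspace (fst (Z j))"
  shows "snd (wedge Z J) \<in> topspace (fst (wedge Z J))"
  using funcset_mem[OF continuous_map_funspace] wedge_in_map[OF assms(1), of Z] assms(2)
  by (metis pointed_map_def)

lemma wedge_lift:
  assumes "\<And>j. j \<in> J \<Longrightarrow> pointed_map (Z j) Q (f j)" and "j \<in> J"
  shows "pointed_map (wedge Z J) Q (\<lambda>(j, y). f j y)"
    and "(\<lambda>(j, y). f j y) (wedge_in Z J q) = (\<lambda>(j, y). f j y) q"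
proof -
  show r: "(\<lambda>(j, y). f j y) (wedge_in Z J q) = (\<lambda>(j, y). f j y) q" for q
    by (rule wedge_in_respects[where f = "\<lambda>(j, y). f j y" and z = "snd Q"]) (use assms(1) in \<open>simp add: pointed_map_def\<close>)
  have "continuous_map (sum_topology (\<lambda>j. fst (Z j)) J) (fst Q) (\<lambda>(j, y). f j y)"
    by (rule continuous_map_from_sum) (use assms(1) in \<open>simp add: pointed_map_def\<close>)
  then have "continuous_map (fst (wedge Z J)) (fst Q) (\<lambda>(j, y). f j y)"
    unfolding wedge_def fst_conv
    by (rule continuous_map_collapseI) (use assms(1) in \<open>auto simp: wedge_base_def pointed_map_def\<close>)
  moreover have "(\<lambda>(j, y). f j y) (snd (wedge Z J)) = snd Q"
    unfolding wedge_in_base[OF assms(2), symmetric] r using assms by (simp add: pointed_map_def)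
  ultimately show "pointed_map (wedge Z J) Q (\<lambda>(j, y). f j y)" by (simp add: pointed_map_def)
qed

lemma wedge_lift_homotopic:
  assumes h: "\<And>j. j \<in> J \<Longrightarrow> pointed_homotopic (Z j) (Q, q0) (f j) (g j)" and j: "j \<in> J"
    and b: "\<And>j. j \<in> J \<Longrightarrow> snd (Z j) \<in> topspace (fst (Z j))"
  shows "pointed_homotopic (wedge Z J) (Q, q0) (\<lambda>(j, y). f j y) (\<lambda>(j, y). g j y)"
proof -
  have ex: "\<exists>H. continuous_map (fst (Z j)) (path_space Q) H \<and> (\<forall>y. H y 0 = f j y) \<and> (\<forall>y. H y 1 = g j y) \<and>
      H (snd (Z j)) = (\<lambda>t\<in>{0..1}. q0)" if "j \<in> J" for j
    using pointed_homotopic_path[of "fst (Z j)" "snd (Z j)" Q q0 "f j" "g j"] h[OF that] b[OF that] by simp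
  define H where "H = (\<lambda>j. SOME H. continuous_map (fst (Z j)) (path_space Q) H \<and> (\<forall>y. H y 0 = f j y) \<and> (\<forall>y. H y 1 = g j y) \<and>
      H (snd (Z j)) = (\<lambda>t\<in>{0..1}. q0))"
  have H: "continuous_map (fst (Z j)) (path_space Q) (H j) \<and> (\<forall>y. H j y 0 = f j y) \<and> (\<forall>y. H j y 1 = g j y) \<and>
      H j (snd (Z j)) = (\<lambda>t\<in>{0..1}. q0)" if "j \<in> J" for j
    unfolding H_def by (rule someI_ex[OF ex[OF that]])
  have Hm: "pointed_map (Z j) (path_space Q, \<lambda>t\<in>{0..1}. q0) (H j)" if "j \<in> J" for j
    using H[OF that] by (simp add: pointed_map_def)
  have l: "pointed_map (wedge Z J) (path_space Q, \<lambda>t\<in>{0..1}. q0) (\<lambda>(j, y). H j y)"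
    by (rule wedge_lift(1)[OF Hm j])
  have vin: "snd (wedge Z J) \<in> topspace (fst (wedge Z J))"
    by (rule wedge_base_point_in[where Z = Z, OF j b[OF j]])
  have "pointed_homotopic (fst (wedge Z J), snd (wedge Z J)) (Q, q0) (\<lambda>(j, y). f j y) (\<lambda>(j, y). g j y)"
  proof (rule pointed_homotopicI_paths[where h = "\<lambda>(j, y). H j y", OF _ vin])
    show "continuous_map (fst (wedge Z J)) (path_space Q) (\<lambda>(j, y). H j y)" using l by (simp add: pointed_map_def)
    show "(\<lambda>(j, y). H j y) (snd (wedge Z J)) t = q0" if "t \<in> {0..1}" for t
      using l that by (simp add: pointed_map_def)
    fix q assume "q \<in> topspace (fst (wedge Z J))"
    then have "fst q \<in> J" by (rule wedge_point(2)[OF _ b])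
    then show "(\<lambda>(j, y). H j y) q 0 = (\<lambda>(j, y). f j y) q" "(\<lambda>(j, y). H j y) q 1 = (\<lambda>(j, y). g j y) q"
      using H[of "fst q"] by (simp_all add: case_prod_unfold)
  qed
  then show ?thesis by simp
qed

lemma wedge_map_in:
  assumes "\<And>j. j \<in> J \<Longrightarrow> f j (snd (Z j)) = snd (Z' j)" "j \<in> J"
  shows "wedge_map Z' J f (wedge_in Z J (j, y)) = wedge_in Z' J (j, f j y)"
proof -
  have "wedge_map Z' J f (wedge_in Z J (j, y)) = wedge_map Z' J f (j, y)"
    by (rule wedge_in_respects[where f = "wedge_map Z' J f" and z = "snd (wedge Z' J)"])
      (simp add: wedge_map_def assms(1) wedge_in_base)
  then show ?thesis by (simp add: wedge_map_def)
qed

lemma bracket_concat_natural: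
  "t \<in> {0..1} \<Longrightarrow> \<phi> (bracket concat_path T f t) = bracket concat_path T (\<lambda>j. \<lambda>s\<in>{0..1}. \<phi> (f j s)) t"
  by (induction T arbitrary: t) (auto simp: concat_path_def)

lemma bracket_concat_const:
  assumes "\<And>j. j \<in> set (leaves T) \<Longrightarrow> f j = const_path v"
  shows "bracket concat_path T f = const_path v"
  using assms by (induction T) (auto simp: concat_path_def const_path_def fun_eq_iff)

lemma bracket_concat_ends:
  assumes "\<And>j. j \<in> set (leaves T) \<Longrightarrow> f j 0 = v \<and> f j 1 = v"
  shows "bracket concat_path T f 0 = v \<and> bracket concat_path T f 1 = v"
  using assms by (induction T) (auto simp: concat_path_def)

section \<open>Iterated comultiplications\<close>

text \<open>
  Comultiplying is adjoint to concatenating loops. The points that \<open>comult\<close> returns are chosen representatives: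
  where the two halves of the suspension meet, it may return the base point of either
  summand. This makes no difference, as both iterated comultiplications preserve base points.
\<close>

lemma iterated_comult_susp_in:
  assumes b: "snd P \<in> topspace (fst P)"
    and "set (leaves T) \<subseteq> J" "y \<in> topspace (fst P)" "t \<in> {0..1}"
  shows "iterated_comult P J T (susp_in P (y, t)) =
    bracket concat_path T (\<lambda>j. \<lambda>s\<in>{0..1}. wedge_in (\<lambda>_. susp P) J (j, susp_in P (y, s))) t"
  using assms(2-)
proof (induction T arbitrary: y t)
  case (Single j)
  then show ?case by simp
next
  case (Branch l r)
  let ?v = "snd (wedge (\<lambda>_. susp P) J)"
  let ?L = "\<lambda>y j. \<lambda>s\<in>{0..1}. wedge_in (\<lambda>_. susp P) J (j, susp_in P (y, s))"
  have lr: "set (leaves l) \<subseteq> J" "set (leaves r) \<subseteq> J" using Branch.prems(1) by auto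
  note IH = Branch.IH(1)[OF lr(1)] Branch.IH(2)[OF lr(2)]
  have Lend: "?L y j 0 = ?v \<and> ?L y j 1 = ?v" if "j \<in> J" "y \<in> topspace (fst P)" for j y
    using susp_in_base[OF b that(2)] wedge_in_base[OF that(1), of "\<lambda>_. susp P"] by simp
  have Lbase: "?L (snd P) j = const_path ?v" if "j \<in> J" for j
    using susp_in_base[OF b b] wedge_in_base[OF that, of "\<lambda>_. susp P"] by (auto simp: const_path_def fun_eq_iff)
  have ends: "bracket concat_path T (?L y) 0 = ?v \<and> bracket concat_path T (?L y) 1 = ?v"
    if "set (leaves T) \<subseteq> J" "y \<in> topspace (fst P)" for T y
    by (rule bracket_concat_ends) (use that Lend in blast)
  have base: "bracket concat_path T (?L (snd P)) = const_path ?v" if "set (leaves T) \<subseteq> J" for T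
    by (rule bracket_concat_const) (use that Lbase in blast)
  have l0: "iterated_comult P J l (snd (susp P)) = ?v" and r0: "iterated_comult P J r (snd (susp P)) = ?v"
  proof -
    have "iterated_comult P J l (susp_in P (snd P, 0)) = bracket concat_path l (?L (snd P)) 0"
      by (rule IH(1)[OF b]) simp
    then show "iterated_comult P J l (snd (susp P)) = ?v"
      using ends[OF lr(1) b] snd_susp by metis
    have "iterated_comult P J r (susp_in P (snd P, 0)) = bracket concat_path r (?L (snd P)) 0"
      by (rule IH(2)[OF b]) simp
    then show "iterated_comult P J r (snd (susp P)) = ?v"
      using ends[OF lr(2) b] snd_susp by metis
  qed
  let ?F = "\<lambda>(i, z). if i then iterated_comult P J r z else iterated_comult P J l z"
  have F: "?F (wedge_in (\<lambda>_. susp P) UNIV q) = ?F q" for q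
    by (rule wedge_in_respects[where f = ?F and z = ?v]) (use l0 r0 in auto)
  let ?D = "\<lambda>(y, t). ?F (comult P (y, t))"
  have D: "?D (y, t) = concat_path (bracket concat_path l (?L y)) (bracket concat_path r (?L y)) t"
    if "y \<in> topspace (fst P)" "t \<in> {0..1}" for y t
  proof (cases "t \<le> 1/2")
    case True
    then have "?D (y, t) = iterated_comult P J l (susp_in P (y, 2 * t))"
      using F[of "(False, susp_in P (y, 2 * t))"] by (simp add: comult_def)
    also have "\<dots> = bracket concat_path l (?L y) (2 * t)"
      using True that by (intro IH(1)) auto
    finally show ?thesis using True that by (simp add: concat_path_def)
  next
    case False
    then have "?D (y, t) = iterated_comult P J r (susp_in P (y, 2 * t - 1))"
      using F[of "(True, susp_in P (y, 2 * t - 1))"] by (simp add: comult_def)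
    also have "\<dots> = bracket concat_path r (?L y) (2 * t - 1)"
      using False that by (intro IH(2)) auto
    finally show ?thesis using False that by (simp add: concat_path_def)
  qed
  have Dbase: "?D (y, t) = ?v" if y: "y \<in> topspace (fst P)" and t: "t \<in> {0..1}" and c: "t = 0 \<or> t = 1 \<or> y = snd P" for y t
  proof -
    have "?D (y, t) = bracket concat_path (Branch l r) (?L y) t" using D[OF y t] by simp
    then show ?thesis
      using c ends[OF Branch.prems(1) y] base[OF Branch.prems(1)] t by auto
  qed
  have "iterated_comult P J (Branch l r) q = ?D q" for q
    by (cases q) (auto split: prod.splits bool.splits)
  then have "iterated_comult P J (Branch l r) (susp_in P (y, t)) = ?D (susp_in P (y, t))" by blast
  also have "\<dots> = ?D (y, t)"
    by (rule susp_in_respects[where f = ?D and z = ?v]) (rule Dbase)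
  also have "\<dots> = bracket concat_path (Branch l r) (?L y) t"
    using D[OF Branch.prems(2,3)] by simp
  finally show ?case .
qed

section \<open>The homotopy equivalence\<close>

lemma pointed_map_loops_paths:
  assumes "pointed_map P (loops Z z0, c) f" "y \<in> topspace (fst P)"
  shows "f y \<in> paths Z"
proof -
  have "continuous_map (fst P) (loops Z z0) f" using assms(1) by (simp add: pointed_map_def)
  from funcset_mem[OF continuous_map_funspace[OF this] assms(2)] show ?thesis
    by (simp add: topspace_loops)
qed

context weighted_polyhedral
begin

text \<open>
  The identity into the compactly generated refinement is continuous on each product, which is compactly
  generated, and therefore on the colimit.
\<close>

lemma k_space_weighted_colimit:
  assumes Q: "weighted_colimit K Q g"
  shows "k_space Q"
proof -
  have c: "continuous_map Q (kification Q) (\<lambda>x. x)"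
  proof (rule weighted_colimit_continuous[OF Q])
    show "continuous_map (face_poly \<sigma>) (kification Q) (\<lambda>x. g \<sigma> x)" if "\<sigma> \<in> K" for \<sigma>
      using weighted_colimitD(1)[OF Q that] by (simp add: continuous_map_into_kification[OF k_space_face_poly])
  qed
  have "openin Q U" if U: "openin (kification Q) U" for U
  proof -
    have "U \<subseteq> topspace Q" using openin_subset[OF U] by simp
    then have "{x \<in> topspace Q. x \<in> U} = U" by blast
    with openin_continuous_map_preimage[OF c U] show ?thesis by simp
  qed
  then have "kification Q = Q"
    by (auto simp: topology_eq openin_kification_finer)
  then show ?thesis by (simp add: kification_eq_self)
qed

lemma k_space_smash: "k_space (fst (smash \<tau>))"
  unfolding smash_def fst_conv by (rule k_space_quotient_map_image[OF quotient_map_collapse k_space_face_poly])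

lemma pK_in:
  assumes K: "simplicial_complex_on m K" and \<tau>: "\<tau> \<subseteq> {1..m}" and z: "z \<in> topspace (WK K)"
  shows "pK \<tau> z \<in> topspace (W \<tau>)"
proof -
  obtain \<delta> x where \<delta>: "\<delta> \<in> K" "x \<in> poly_set \<delta>" "z = inK K \<delta> (eta \<delta> x)" by (rule WK_point[OF K z])
  have d: "\<delta> \<subseteq> {1..m}" by (rule complex_face[OF K \<delta>(1)])
  show ?thesis
    unfolding \<delta>(3) pK_inK[OF K \<delta>(1) \<tau>]
    by (rule iota_in[OF \<tau> _ p_in[OF \<tau> d eta_in[OF d d \<delta>(2)]]]) simp
qed

lemma pK_base:
  assumes K: "simplicial_complex_on m K" and \<tau>: "\<tau> \<subseteq> {1..m}"
  shows "pK \<tau> (snd (pWK K)) = snd (pW \<tau>)"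
proof -
  have "pK \<tau> (snd (pWK K)) = iota {} \<tau> (p \<tau> {} (eta {} base_point))"
    using pK_inK[OF K complex_empty[OF K] \<tau>] by (simp add: pWK_def)
  also have "p \<tau> {} (eta {} base_point) = eta {} base_point"
    using p_eta[OF \<tau>, of "{}" base_point] by (simp add: proj_base_point base_point_fixed)
  finally show ?thesis by (simp add: pW_def)
qed

lemma qc_in:
  assumes \<tau>: "\<tau> \<subseteq> {1..m}" and w: "w \<in> topspace (W \<tau>)"
  shows "qc \<tau> w \<in> topspace (fst (smash \<tau>))"
proof -
  obtain \<nu> x where \<nu>: "\<nu> \<subseteq> \<tau>" "x \<in> poly_set \<nu>" "w = iota \<nu> \<tau> (eta \<nu> x)"
    by (rule W_point[OF \<tau> w])
  show ?thesis
  proof (cases "\<nu> = \<tau>")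
    case True
    then show ?thesis
      using \<nu> qc_eta[OF \<tau>] topspace_smash[OF \<tau>] by (auto simp: iota_self finite_face[OF \<tau>])
  next
    case False
    have "eta \<nu> x \<in> topspace (W \<nu>)" using \<nu> \<tau> by (intro eta_in) auto
    then have "w \<in> W_bd \<tau>" using \<nu> False by (auto simp: W_bd_def bd_def)
    then show ?thesis using qc_bd[OF \<tau>] topspace_smash[OF \<tau>] by auto
  qed
qed

lemma pW_base_in: "\<tau> \<subseteq> {1..m} \<Longrightarrow> snd (pW \<tau>) \<in> topspace (fst (pW \<tau>))"
  unfolding pW_def fst_conv snd_conv by (rule iota_in) (auto intro: eta_in)

lemma qc_base: "\<tau> \<subseteq> {1..m} \<Longrightarrow> qc \<tau> (snd (pW \<tau>)) = snd (smash \<tau>)"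
proof -
  assume \<tau>: "\<tau> \<subseteq> {1..m}"
  have "eta \<tau> base_point = iota {} \<tau> (eta {} base_point)"
    using eta_face[OF \<tau> \<tau>, of "{}" base_point] by (simp add: base_point_fixed[OF \<tau>])
  then show ?thesis using qc_eta[OF \<tau>, of base_point] by (simp add: pW_def smash_def)
qed

context
  fixes K :: "nat set set" and T :: "nat set bracketing"
  assumes K: "simplicial_complex_on m K" and T: "distinct (leaves T)" "set (leaves T) = K"
begin

private abbreviation "V \<equiv> wedge (\<lambda>\<tau>. susp (smash \<tau>)) K"
private abbreviation "Y \<equiv> pWK K"

text \<open>
  The canonical map \<open>C\<^sub>\<tau> \<rightarrow> \<Omega>V\<close>, adjoint to the inclusion of a summand.
\<close>

definition smash_loop :: "nat set \<Rightarrow> (nat \<Rightarrow> 'a) \<Rightarrow> real \<Rightarrow> nat set \<times> (nat \<Rightarrow> 'a) \<times> real" where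
  "smash_loop \<tau> x = (\<lambda>t\<in>{0..1}. wedge_in (\<lambda>\<tau>. susp (smash \<tau>)) K (\<tau>, susp_in (smash \<tau>) (x, t)))"

definition e_adjoint :: "nat set \<times> 'a wpoint \<Rightarrow> real \<Rightarrow> nat set \<times> (nat \<Rightarrow> 'a) \<times> real" where
  "e_adjoint z = bracket concat_path T (\<lambda>\<tau>. smash_loop \<tau> (face_map \<tau> z))"

private lemma face: "\<tau> \<in> set (leaves T) \<Longrightarrow> \<tau> \<subseteq> {1..m}" "\<tau> \<in> K \<Longrightarrow> \<tau> \<subseteq> {1..m}"
  using T(2) complex_face[OF K] by auto

private lemma Yb: "snd Y \<in> topspace (fst Y)"
  using WK_base_in[OF K] by (simp add: pWK_def)

private lemma fstY: "fst Y = WK K" by (simp add: pWK_def)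

private lemma sb: "\<tau> \<in> K \<Longrightarrow> snd (susp (smash \<tau>)) \<in> topspace (fst (susp (smash \<tau>)))"
  by (rule susp_base_in[OF smash_base_in[OF face(2)]])

private lemma Vb: "snd V \<in> topspace (fst V)"
  by (rule wedge_base_point_in[where Z = "\<lambda>\<tau>. susp (smash \<tau>)", OF complex_empty[OF K] sb[OF complex_empty[OF K]]])

lemma smash_loop_map:
  assumes "\<tau> \<in> K"
  shows "pointed_map (smash \<tau>) (loops (fst V) (snd V), const_path (snd V)) (smash_loop \<tau>)"
proof -
  let ?S = "susp (smash \<tau>)"
  have u: "pointed_map (smash \<tau>) (loops (fst ?S) (snd ?S), const_path (snd ?S)) (susp_unit (smash \<tau>))"
    by (rule susp_unit_map[OF k_space_smash smash_base_in[OF face(2)[OF assms]]])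
  have w: "pointed_map (fst ?S, snd ?S) (fst V, snd V) (\<lambda>q. wedge_in (\<lambda>\<tau>. susp (smash \<tau>)) K (\<tau>, q))"
    using wedge_in_map[OF assms, of "\<lambda>\<tau>. susp (smash \<tau>)"] by simp
  have "pointed_map (smash \<tau>) (loops (fst V) (snd V), const_path (snd V))
     (\<lambda>x. \<lambda>t\<in>{0..1}. wedge_in (\<lambda>\<tau>. susp (smash \<tau>)) K (\<tau>, susp_unit (smash \<tau>) x t))"
    using pointed_homotopic_imp_maps[OF pointed_homotopic_compose_left[OF pointed_homotopic_refl[OF u]
          loops_map[OF w sb[OF assms]]]] by blast
  moreover have "(\<lambda>x. \<lambda>t\<in>{0..1}. wedge_in (\<lambda>\<tau>. susp (smash \<tau>)) K (\<tau>, susp_unit (smash \<tau>) x t)) = smash_loop \<tau>"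
    by (auto simp: smash_loop_def susp_unit_def fun_eq_iff)
  ultimately show ?thesis by simp
qed

private lemma OV: "h_group (loops (fst V) (snd V)) (const_path (snd V)) concat_path rev_path"
  by (rule loops_h_group[OF Vb])

private lemma OY: "h_group (loops (fst (susp Y)) (snd (susp Y))) (const_path (snd (susp Y))) concat_path rev_path"
  by (rule loops_h_group[OF susp_base_in[OF Yb]])

private lemma bracket_face_maps:
  assumes G: "h_group G e0 mul neg"
    and a: "\<And>\<tau>. \<tau> \<in> K \<Longrightarrow> pointed_map (smash \<tau>) (G, e0) (a \<tau>)"
  shows "pointed_map Y (G, e0) (\<lambda>z. bracket mul T (\<lambda>\<tau>. a \<tau> (face_map \<tau> z)))"
proof -
  have "pointed_map (fst Y, snd Y) (G, e0) (\<lambda>z. bracket mul T (\<lambda>\<tau>. a \<tau> (face_map \<tau> z)))"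
  proof (rule h_group.bracket_map[OF G Yb])
    fix \<tau> assume "\<tau> \<in> set (leaves T)"
    then have \<tau>: "\<tau> \<in> K" using T(2) by simp
    show "pointed_map (fst Y, snd Y) (G, e0) (\<lambda>z. a \<tau> (face_map \<tau> z))"
      using pointed_homotopic_imp_maps[OF pointed_homotopic_compose_right[OF
            pointed_homotopic_refl[OF a[OF \<tau>]] face_map_pointed[OF K face(2)[OF \<tau>]]]] by simp
  qed
  then show ?thesis by simp
qed

lemma e_adjoint_map: "pointed_map Y (loops (fst V) (snd V), const_path (snd V)) e_adjoint"
  unfolding e_adjoint_def[abs_def] by (rule bracket_face_maps[OF OV smash_loop_map])

text \<open>
  The two wedge maps in \<open>e\<close> are applied to each leaf of the iterated comultiplication separately,
  where together they are the suspension of \<open>f\<^sub>\<tau>\<close>.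
\<close>

lemma e_susp_in:
  assumes z: "z \<in> topspace (WK K)" and t: "t \<in> {0..1}"
  shows "e K T (susp_in Y (z, t)) = e_adjoint z t"
proof -
  let ?M1 = "wedge_map (\<lambda>\<tau>. susp (pW \<tau>)) K (\<lambda>\<tau>. susp_map (pW \<tau>) (pK \<tau>))"
  let ?M2 = "wedge_map (\<lambda>\<tau>. susp (smash \<tau>)) K (\<lambda>\<tau>. susp_map (smash \<tau>) (qc \<tau>))"
  have M: "?M2 (?M1 (wedge_in (\<lambda>_. susp Y) K (\<tau>, susp_in Y (z, s)))) =
      wedge_in (\<lambda>\<tau>. susp (smash \<tau>)) K (\<tau>, susp_in (smash \<tau>) (face_map \<tau> z, s))" if \<tau>: "\<tau> \<in> K" for \<tau> s
  proof -
    have 1: "susp_map (pW \<tau>) (pK \<tau>) (susp_in Y (z, s)) = susp_in (pW \<tau>) (pK \<tau> z, s)"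
      "susp_map (pW \<tau>) (pK \<tau>) (snd (susp Y)) = snd (susp (pW \<tau>))" if "\<tau> \<in> K" for \<tau> s
      by (rule susp_map_in; use pK_in[OF K face(2)[OF that]] pK_base[OF K face(2)[OF that]] Yb in \<open>simp add: fstY pW_def\<close>)+
    have 2: "susp_map (smash \<tau>) (qc \<tau>) (susp_in (pW \<tau>) (w, s)) = susp_in (smash \<tau>) (qc \<tau> w, s)"
      "susp_map (smash \<tau>) (qc \<tau>) (snd (susp (pW \<tau>))) = snd (susp (smash \<tau>))" if "\<tau> \<in> K" for \<tau> w s
      by (rule susp_map_in; use qc_in[OF face(2)[OF that]] qc_base[OF face(2)[OF that]] pW_base_in[OF face(2)[OF that]] in \<open>simp add: pW_def\<close>)+
    have "?M1 (wedge_in (\<lambda>_. susp Y) K (\<tau>, susp_in Y (z, s))) = wedge_in (\<lambda>\<tau>. susp (pW \<tau>)) K (\<tau>, susp_in (pW \<tau>) (pK \<tau> z, s))"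
      using wedge_map_in[where Z = "\<lambda>_. susp Y" and Z' = "\<lambda>\<tau>. susp (pW \<tau>)" and J = K and f = "\<lambda>\<tau>. susp_map (pW \<tau>) (pK \<tau>)", OF 1(2) \<tau>]
      by (simp add: 1(1)[OF \<tau>])
    moreover have "?M2 (wedge_in (\<lambda>\<tau>. susp (pW \<tau>)) K (\<tau>, susp_in (pW \<tau>) (pK \<tau> z, s))) =
        wedge_in (\<lambda>\<tau>. susp (smash \<tau>)) K (\<tau>, susp_in (smash \<tau>) (qc \<tau> (pK \<tau> z), s))"
      using wedge_map_in[where Z = "\<lambda>\<tau>. susp (pW \<tau>)" and Z' = "\<lambda>\<tau>. susp (smash \<tau>)" and J = K and f = "\<lambda>\<tau>. susp_map (smash \<tau>) (qc \<tau>)", OF 2(2) \<tau>]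
      by (simp add: 2(1)[OF \<tau>])
    ultimately show ?thesis by (simp add: face_map_def)
  qed
  have "e K T (susp_in Y (z, t)) = ?M2 (?M1 (iterated_comult Y K T (susp_in Y (z, t))))"
    by (simp add: e_def)
  also have "iterated_comult Y K T (susp_in Y (z, t)) =
      bracket concat_path T (\<lambda>\<tau>. \<lambda>s\<in>{0..1}. wedge_in (\<lambda>_. susp Y) K (\<tau>, susp_in Y (z, s))) t"
    by (rule iterated_comult_susp_in[OF Yb]) (use T z t in \<open>auto simp: fstY\<close>)
  also have "?M2 (?M1 \<dots>) = bracket concat_path T (\<lambda>\<tau>. \<lambda>s\<in>{0..1}. ?M2 (?M1 ((\<lambda>s\<in>{0..1}. wedge_in (\<lambda>_. susp Y) K (\<tau>, susp_in Y (z, s))) s))) t"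
    by (rule bracket_concat_natural[OF t, of "\<lambda>q. ?M2 (?M1 q)"])
  also have "\<dots> = e_adjoint z t"
    unfolding e_adjoint_def
  proof (rule arg_cong[of _ _ "\<lambda>f. f t"], rule bracket_cong)
    fix \<tau> assume "\<tau> \<in> set (leaves T)"
    then show "(\<lambda>s\<in>{0..1}. ?M2 (?M1 ((\<lambda>s\<in>{0..1}. wedge_in (\<lambda>_. susp Y) K (\<tau>, susp_in Y (z, s))) s))) = smash_loop \<tau> (face_map \<tau> z)"
      using M T(2) by (auto simp: smash_loop_def fun_eq_iff)
  qed
  finally show ?thesis .
qed

lemma e_point:
  assumes "q \<in> topspace (fst (susp Y))"
  shows "e K T q = (\<lambda>(z, t). e_adjoint z t) q"
  using e_susp_in[of "fst q" "snd q"] susp_point[OF assms] by (simp add: fstY case_prod_unfold)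

lemma e_map: "pointed_map (susp Y) V (e K T)"
proof -
  have "pointed_map (susp Y) (fst V, snd V) (\<lambda>(z, t). e_adjoint z t)"
    by (rule susp_lift(1)[OF _ Yb]) (use e_adjoint_map in simp)
  then have "pointed_map (susp Y) V (\<lambda>(z, t). e_adjoint z t)" by simp
  then show ?thesis
    using e_point e_point[OF susp_base_in[OF Yb]]
    by (auto simp: pointed_map_def intro: continuous_map_eq)
qed

text \<open>
  A factorization of the unit \<open>Y \<rightarrow> \<Omega>\<Sigma>Y\<close> as a product of maps \<open>a\<^sub>\<tau> \<circ> f\<^sub>\<tau>\<close> says that the map \<open>g\<close> assembled from
  the adjoints of the \<open>a\<^sub>\<tau>\<close> is a left inverse of \<open>e\<close>. Hence \<open>e \<circ> g \<circ> e\<close> is homotopic to \<open>e\<close>. Both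
  adjoints are bracketed products, and comparing their factors shows that \<open>e \<circ> g\<close> is homotopic
  to the inclusion on each summand.
\<close>

theorem e_equivalence: "pointed_homotopy_equivalence (susp Y) V (e K T)"
proof -
  let ?\<Sigma> = "susp Y"
  let ?O\<Sigma> = "(loops (fst ?\<Sigma>) (snd ?\<Sigma>), const_path (snd ?\<Sigma>))"
  let ?OV = "(loops (fst V) (snd V), const_path (snd V))"
  have \<Sigma>b: "snd ?\<Sigma> \<in> topspace (fst ?\<Sigma>)" by (rule susp_base_in[OF Yb])
  have unit: "pointed_map Y ?O\<Sigma> (susp_unit Y)"
    by (rule susp_unit_map[OF _ Yb]) (use k_space_weighted_colimit[OF WK_colimit[OF K]] in \<open>simp add: fstY\<close>)
  have "\<exists>a. (\<forall>\<tau>\<in>set (leaves T). pointed_map (smash \<tau>) ?O\<Sigma> (a \<tau>)) \<and>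
      pointed_homotopic Y ?O\<Sigma> (\<lambda>z. bracket concat_path T (\<lambda>\<tau>. a \<tau> (face_map \<tau> z))) (susp_unit Y)"
    by (rule maps_from_WK_surj[OF OY T(1) face(1) K _ unit]) (use T(2) in auto)
  then obtain a where a: "\<And>\<tau>. \<tau> \<in> K \<Longrightarrow> pointed_map (smash \<tau>) ?O\<Sigma> (a \<tau>)"
    and aunit: "pointed_homotopic Y ?O\<Sigma> (\<lambda>z. bracket concat_path T (\<lambda>\<tau>. a \<tau> (face_map \<tau> z))) (susp_unit Y)"
    using T(2) by blast
  let ?A = "\<lambda>z. bracket concat_path T (\<lambda>\<tau>. a \<tau> (face_map \<tau> z))"
  define g where "g = (\<lambda>(\<tau>, q). (\<lambda>(x, t). a \<tau> x t) q)"
  have al: "pointed_map (susp (smash \<tau>)) ?\<Sigma> (\<lambda>(x, t). a \<tau> x t)" if "\<tau> \<in> K" for \<tau>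
    using susp_lift(1)[of "smash \<tau>" "fst ?\<Sigma>" "snd ?\<Sigma>" "a \<tau>"] a[OF that] smash_base_in[OF face(2)[OF that]] by simp
  note e0 = complex_empty[OF K]
  have g: "pointed_map V ?\<Sigma> g"
    unfolding g_def using wedge_lift(1)[where Z = "\<lambda>\<tau>. susp (smash \<tau>)" and Q = ?\<Sigma> and f = "\<lambda>\<tau>. \<lambda>(x, t). a \<tau> x t", OF al e0] .
  have g_in: "g (wedge_in (\<lambda>\<tau>. susp (smash \<tau>)) K (\<tau>, susp_in (smash \<tau>) (x, t))) = a \<tau> x t" if "\<tau> \<in> K" for \<tau> x t
    using wedge_lift(2)[where Z = "\<lambda>\<tau>. susp (smash \<tau>)" and Q = ?\<Sigma> and f = "\<lambda>\<tau>. \<lambda>(x, t). a \<tau> x t" and q = "(\<tau>, susp_in (smash \<tau>) (x, t))", OF al e0]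
      susp_lift(2)[of "smash \<tau>" "fst ?\<Sigma>" "snd ?\<Sigma>" "a \<tau>" "(x, t)"] a[OF that] smash_base_in[OF face(2)[OF that]]
    by (simp add: g_def)
  have fin: "face_map \<tau> z \<in> topspace (fst (smash \<tau>))" if "\<tau> \<in> K" "z \<in> topspace (WK K)" for \<tau> z
    using funcset_mem[OF continuous_map_funspace[OF face_map_continuous[OF K face(2)[OF that(1)]]] that(2)] .
  have a_ext: "(\<lambda>s\<in>{0..1}. a \<tau> x s) = a \<tau> x" if "\<tau> \<in> K" "x \<in> topspace (fst (smash \<tau>))" for \<tau> x
    using pointed_map_loops_paths[OF a[OF that(1)] that(2)] by (simp add: paths_def extensional_restrict)
  have ge: "g (e_adjoint z t) = ?A z t" if z: "z \<in> topspace (WK K)" and t: "t \<in> {0..1}" for z t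
  proof -
    have "g (e_adjoint z t) = bracket concat_path T (\<lambda>\<tau>. \<lambda>s\<in>{0..1}. g (smash_loop \<tau> (face_map \<tau> z) s)) t"
      unfolding e_adjoint_def by (rule bracket_concat_natural[OF t])
    also have "\<dots> = ?A z t"
    proof (rule arg_cong[of _ _ "\<lambda>f. f t"], rule bracket_cong)
      fix \<tau> assume "\<tau> \<in> set (leaves T)"
      then have \<tau>: "\<tau> \<in> K" using T(2) by simp
      have "(\<lambda>s\<in>{0..1}. g (smash_loop \<tau> (face_map \<tau> z) s)) = (\<lambda>s\<in>{0..1}. a \<tau> (face_map \<tau> z) s)"
        by (rule restrict_ext) (simp add: smash_loop_def g_in[OF \<tau>])
      then show "(\<lambda>s\<in>{0..1}. g (smash_loop \<tau> (face_map \<tau> z) s)) = a \<tau> (face_map \<tau> z)"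
        using a_ext[OF \<tau> fin[OF \<tau> z]] by simp
    qed
    finally show ?thesis .
  qed
  have eta_e: "g (e K T q) = (\<lambda>(z, t). ?A z t) q" if q: "q \<in> topspace (fst ?\<Sigma>)" for q
    using e_point[OF q] ge[of "fst q" "snd q"] susp_point[OF q] by (simp add: fstY case_prod_unfold)
  have ee: "pointed_map ?\<Sigma> V (e K T)" by (rule e_map)
  have gem: "pointed_map (fst ?\<Sigma>, snd ?\<Sigma>) ?\<Sigma> (g \<circ> e K T)"
    using pointed_homotopic_imp_maps[OF pointed_homotopic_compose_left[OF pointed_homotopic_refl[OF ee] g]] by (simp add: o_def)
  have idm: "pointed_map (fst ?\<Sigma>, snd ?\<Sigma>) ?\<Sigma> id" by (simp add: pointed_map_def)
  have "pointed_homotopic (fst ?\<Sigma>, snd ?\<Sigma>) ?\<Sigma> (g \<circ> e K T) (\<lambda>(z, t). ?A z t)"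
    by (rule pointed_homotopic_eq[OF gem \<Sigma>b]) (simp add: eta_e)
  also have "pointed_homotopic (fst ?\<Sigma>, snd ?\<Sigma>) ?\<Sigma> \<dots> (\<lambda>(z, t). susp_unit Y z t)"
    using susp_lift_homotopic[OF aunit Yb] by simp
  also have "pointed_homotopic (fst ?\<Sigma>, snd ?\<Sigma>) ?\<Sigma> \<dots> id"
  proof (rule pointed_homotopic_sym[OF pointed_homotopic_eq[OF idm \<Sigma>b]])
    fix q assume q: "q \<in> topspace (fst ?\<Sigma>)"
    show "id q = (\<lambda>(z, t). susp_unit Y z t) q"
      using susp_point[OF q] by (simp add: susp_unit_def case_prod_unfold)
  qed
  finally have left: "pointed_homotopic ?\<Sigma> ?\<Sigma> (g \<circ> e K T) id" by simp
  \<comment> \<open>The other composite is compared with the identity on each summand, where injectivity applies.\<close>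
  define \<psi> where "\<psi> = (\<lambda>\<tau> x. \<lambda>t\<in>{0..1}. e K T (a \<tau> x t))"
  have Oe: "pointed_map ?O\<Sigma> ?OV (\<lambda>f. \<lambda>t\<in>{0..1}. e K T (f t))"
    by (rule loops_map[OF _ \<Sigma>b]) (use ee in simp)
  have \<psi>: "pointed_map (smash \<tau>) ?OV (\<psi> \<tau>)" if "\<tau> \<in> K" for \<tau>
    unfolding \<psi>_def using pointed_homotopic_imp_maps[OF pointed_homotopic_compose_left[OF pointed_homotopic_refl[OF a[OF that]] Oe]] by blast
  have ext: "bracket concat_path T (\<lambda>\<tau>. b \<tau> (face_map \<tau> z)) \<in> paths (fst V)"
    if "\<And>\<tau>. \<tau> \<in> K \<Longrightarrow> pointed_map (smash \<tau>) ?OV (b \<tau>)" "z \<in> topspace (WK K)" for b z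
    by (rule pointed_map_loops_paths[OF bracket_face_maps[OF OV that(1)]]) (simp_all add: fstY that(2))
  have b\<psi>: "bracket concat_path T (\<lambda>\<tau>. \<psi> \<tau> (face_map \<tau> z)) = (\<lambda>t\<in>{0..1}. e K T (?A z t))" if z: "z \<in> topspace (WK K)" for z
  proof
    fix t
    show "bracket concat_path T (\<lambda>\<tau>. \<psi> \<tau> (face_map \<tau> z)) t = (\<lambda>t\<in>{0..1}. e K T (?A z t)) t"
    proof (cases "t \<in> {0..1}")
      case True
      then show ?thesis
        using bracket_concat_natural[OF True, of "e K T" T "\<lambda>\<tau>. a \<tau> (face_map \<tau> z)"] by (simp add: \<psi>_def)
    next
      case False
      then show ?thesis
        using ext[OF \<psi> z] by (auto simp: paths_def extensional_def)
    qed
  qed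
  have e_unit: "(\<lambda>t\<in>{0..1}. e K T (susp_unit Y z t)) = e_adjoint z" if z: "z \<in> topspace (WK K)" for z
  proof
    fix t
    show "(\<lambda>t\<in>{0..1}. e K T (susp_unit Y z t)) t = e_adjoint z t"
    proof (cases "t \<in> {0..1}")
      case True
      then show ?thesis using e_susp_in[OF z True] by (simp add: susp_unit_def)
    next
      case False
      then show ?thesis
        using ext[OF smash_loop_map z] by (auto simp: e_adjoint_def paths_def extensional_def)
    qed
  qed
  have \<psi>m: "pointed_map (fst Y, snd Y) ?OV (\<lambda>z. bracket concat_path T (\<lambda>\<tau>. \<psi> \<tau> (face_map \<tau> z)))"
    using bracket_face_maps[OF OV \<psi>] by simp
  have adm: "pointed_map (fst Y, snd Y) ?OV (\<lambda>z. bracket concat_path T (\<lambda>\<tau>. smash_loop \<tau> (face_map \<tau> z)))"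
    using bracket_face_maps[OF OV smash_loop_map] by simp
  have "pointed_homotopic (fst Y, snd Y) ?OV (\<lambda>z. bracket concat_path T (\<lambda>\<tau>. \<psi> \<tau> (face_map \<tau> z))) (\<lambda>z. \<lambda>t\<in>{0..1}. e K T (?A z t))"
    by (rule pointed_homotopic_eq[OF \<psi>m Yb]) (simp add: b\<psi> fstY)
  also have "pointed_homotopic (fst Y, snd Y) ?OV \<dots> (\<lambda>z. \<lambda>t\<in>{0..1}. e K T (susp_unit Y z t))"
    using pointed_homotopic_compose_left[OF aunit Oe] by simp
  also have "pointed_homotopic (fst Y, snd Y) ?OV \<dots> (\<lambda>z. bracket concat_path T (\<lambda>\<tau>. smash_loop \<tau> (face_map \<tau> z)))"
    by (rule pointed_homotopic_sym[OF pointed_homotopic_eq[OF adm Yb]]) (simp add: e_unit fstY flip: e_adjoint_def)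
  finally have hom: "pointed_homotopic Y ?OV (\<lambda>z. bracket concat_path T (\<lambda>\<tau>. \<psi> \<tau> (face_map \<tau> z)))
      (\<lambda>z. bracket concat_path T (\<lambda>\<tau>. smash_loop \<tau> (face_map \<tau> z)))" by simp
  have summand: "pointed_homotopic (smash \<tau>) ?OV (\<psi> \<tau>) (smash_loop \<tau>)" if "\<tau> \<in> K" for \<tau>
    by (rule maps_from_WK_inj[OF OV T(1) face(1) K _ _ _ hom that]) (use T(2) \<psi> smash_loop_map in auto)
  have w: "pointed_homotopic V (fst V, snd V) (\<lambda>(\<tau>, q). (\<lambda>(x, t). \<psi> \<tau> x t) q) (\<lambda>(\<tau>, q). (\<lambda>(x, t). smash_loop \<tau> x t) q)"
  proof (rule wedge_lift_homotopic[where Z = "\<lambda>\<tau>. susp (smash \<tau>)", OF _ e0 sb])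
    show "pointed_homotopic (susp (smash \<tau>)) (fst V, snd V) (\<lambda>(x, t). \<psi> \<tau> x t) (\<lambda>(x, t). smash_loop \<tau> x t)" if "\<tau> \<in> K" for \<tau>
      by (rule susp_lift_homotopic[OF summand[OF that] smash_base_in[OF face(2)[OF that]]])
  qed
  have egm: "pointed_map (fst V, snd V) V (e K T \<circ> g)"
    using pointed_homotopic_imp_maps[OF pointed_homotopic_compose_left[OF pointed_homotopic_refl[OF g] ee]] by (simp add: o_def)
  have idV: "pointed_map (fst V, snd V) V id" by (simp add: pointed_map_def)
  have pts: "snd (snd q) \<in> {0..1} \<and> susp_in (smash (fst q)) (snd q) = snd q \<and> wedge_in (\<lambda>\<tau>. susp (smash \<tau>)) K q = q"
    if q: "q \<in> topspace (fst V)" for q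
    using wedge_point[OF q sb] susp_point[of "snd q" "smash (fst q)"] by auto
  have "pointed_homotopic (fst V, snd V) V (e K T \<circ> g) (\<lambda>(\<tau>, q). (\<lambda>(x, t). \<psi> \<tau> x t) q)"
    by (rule pointed_homotopic_eq[OF egm Vb]) (use pts in \<open>simp add: g_def \<psi>_def case_prod_unfold\<close>)
  also have "pointed_homotopic (fst V, snd V) V \<dots> (\<lambda>(\<tau>, q). (\<lambda>(x, t). smash_loop \<tau> x t) q)"
    using w by simp
  also have "pointed_homotopic (fst V, snd V) V \<dots> id"
    by (rule pointed_homotopic_sym[OF pointed_homotopic_eq[OF idV Vb]])
      (use pts in \<open>simp add: smash_loop_def case_prod_unfold\<close>)
  finally have right: "pointed_homotopic V V (e K T \<circ> g) id" by simp
  show ?thesis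
    unfolding pointed_homotopy_equivalence_def using ee g left right by blast
qed

end

end

theorem theorem6p5:
  fixes m :: nat
    and X :: "nat \<Rightarrow> 'a topology"
    and pt :: "nat \<Rightarrow> 'a"
    and rho :: "nat \<Rightarrow> nat \<Rightarrow> 'a \<Rightarrow> 'a"
    and c :: "nat set \<Rightarrow> nat \<Rightarrow> nat"
    and K :: "nat set set"
    and T :: "nat set bracketing"
  assumes "\<And>i. i \<in> {1..m} \<Longrightarrow> CW_power_couple (X i) {pt i} (pt i) (rho i)"
    and "power_sequence m c"
    and "simplicial_complex_on m K"
    and "distinct (leaves T)" and "set (leaves T) = K"
  shows "pointed_homotopy_equivalence
           (susp (pointed_polyhedral.pWK m X pt rho c K))
           (wedge (\<lambda>\<tau>. susp (pointed_polyhedral.smash m X pt \<tau>)) K)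
           (pointed_polyhedral.e m X pt rho c K T)"
proof -
  interpret weighted_polyhedral m X pt rho c
    by unfold_locales (use assms in auto)
  show ?thesis
    by (rule e_equivalence[OF assms(3-5)])
qed

end
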